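(* There are constants $0<c<C$, independent of $\epsilon$ and $L$, such that for every $L>0$ there is $\epsilon_0>0$ with the following property: for each $i\in\{1,2,3\}$, $$\frac{c\,\epsilon}{L}\;\le\;\Delta_i\;\le\;\frac{C\,\epsilon}{L}\qquad\text{if } 0<\epsilon<\epsilon_0 .$$ Moreover, for all $\Delta\ge 0$ a global minimizer $U_i$ of $E_i(\cdot;\epsilon,\Delta)$ in $\mathcal{A}_i$ exists, and when $\Delta/\Delta_i$ is large enough (that is, for given $L$, $\epsilon$ and $i$ there is $K>0$ such that this holds whenever $\Delta/\Delta_i\ge K$) it satisfies $\mathcal{L}^2(B(U_i))>0$.
   Context: Let $L>0$, $\Omega=[0,L]\times[0,1]\subset\mathbb{R}^2$ with coordinates $(x,y)$, and let $\epsilon>0$, $\Delta\ge 0$ be parameters. $\mathcal{L}^2$ is two-dimensional Lebesgue measure, and subscripts $x,y$ denote (weak) partial derivatives. For a function $u$ on $\Omega$ put $B(u)=\{(x,y)\in\Omega:\ |u_y(x,y)|\ge 1\}$ and $A(u)=\Omega\setminus B(u)$ and define $$E_1(u;\epsilon,\Delta)=\int_\Omega \epsilon^2u_{yy}^2+u_x^2\,d\mathcal{L}^2+\Delta\,\mathcal{L}^2(A(u)),$$ $$E_2(u;\epsilon,\Delta)=\int_\Omega \epsilon^2|\nabla(u_y)|^2+u_x^2\,d\mathcal{L}^2+\Delta\,\mathcal{L}^2(A(u)),$$ $$E_3(u;\epsilon,\Delta)=\int_\Omega \epsilon^2|D^2u|^2+u_x^2\,d\mathcal{L}^2+\Delta\,\mathcal{L}^2(A(u)),$$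 where $D^2u=\nabla(\nabla u)$. Let $W^{1,2}_p(\Omega,\mathbb{R})=\{u\in W^{1,2}(\Omega,\mathbb{R}): u(x,1)=u(x,0),\ 0\le x\le L\}$ (in the sense of traces). The admissible classes are $\mathcal{A}_1=\{u\in W^{1,2}_p(\Omega,\mathbb{R}): u_{yy}\in L^2(\Omega),\ u(0,y)=0 \text{ for } 0\le y\le 1\}$, $\mathcal{A}_2=\{u\in W^{1,2}_p(\Omega,\mathbb{R}): u_y\in W^{1,2}(\Omega),\ u(0,y)=0 \text{ for } 0\le y\le 1\}$, $\mathcal{A}_3=\{u\in W^{1,2}_p(\Omega,\mathbb{R}): \nabla u\in W^{1,2}(\Omega),\ u(0,y)=0 \text{ for } 0\le y\le 1\}$ (boundary values in the sense of traces). The critical well-depth is $\Delta_i=\Delta_i(\epsilon,L)=\sup\{\Delta\ge 0:\ u=0 \text{ globally minimizes } E_i(\cdot;\epsilon,\Delta) \text{ in } \mathcal{A}_i\}$. *)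

theory Defs
  imports "HOL-Analysis.Analysis"
begin

section \<open>Sobolev spaces, weak derivatives and traces\<close>

text \<open>
  All integrals over a set \<open>S\<close> are taken with respect to \<open>lebesgue_on S\<close>. Elements of the function
  spaces are represented by total functions whose values off \<open>S\<close> are irrelevant. The sets \<open>S\<close>
  used below are closed rectangles; test functions are supported in the interior of \<open>S\<close>.
\<close>

primrec Ck :: "nat \<Rightarrow> ('a::euclidean_space \<Rightarrow> real) \<Rightarrow> bool" where
  "Ck 0 f \<longleftrightarrow> continuous_on UNIV f"
| "Ck (Suc k) f \<longleftrightarrow>
     f differentiable_on UNIV \<and> (\<forall>i\<in>Basis. Ck k (\<lambda>p. frechet_derivative f (at p) i))"

definition smooth :: "('a::euclidean_space \<Rightarrow> real) \<Rightarrow> bool" where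
  "smooth f \<longleftrightarrow> (\<forall>k. Ck k f)"

definition test_function :: "'a::euclidean_space set \<Rightarrow> ('a \<Rightarrow> real) \<Rightarrow> bool" where
  "test_function S \<phi> \<longleftrightarrow>
     smooth \<phi> \<and> compact (closure {p. \<phi> p \<noteq> 0}) \<and> closure {p. \<phi> p \<noteq> 0} \<subseteq> interior S"

definition locally_integrable :: "'a::euclidean_space set \<Rightarrow> ('a \<Rightarrow> real) \<Rightarrow> bool" where
  "locally_integrable S u \<longleftrightarrow>
     (\<forall>K. compact K \<and> K \<subseteq> interior S \<longrightarrow> integrable (lebesgue_on K) u)"

definition has_weak_deriv ::
    "'a::euclidean_space set \<Rightarrow> 'a \<Rightarrow> ('a \<Rightarrow> real) \<Rightarrow> ('a \<Rightarrow> real) \<Rightarrow> bool" where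
  "has_weak_deriv S i u v \<longleftrightarrow>
     locally_integrable S u \<and> locally_integrable S v \<and>
     (\<forall>\<phi>. test_function S \<phi> \<longrightarrow>
        (LINT p|lebesgue_on S. u p * frechet_derivative \<phi> (at p) i)
          = - (LINT p|lebesgue_on S. v p * \<phi> p))"

text \<open>
  Weak derivatives are unique up to null sets in the interior of \<open>S\<close>; the following selects a
  representative. It is only meaningful when some weak derivative exists.
\<close>

definition weak_deriv :: "'a::euclidean_space set \<Rightarrow> 'a \<Rightarrow> ('a \<Rightarrow> real) \<Rightarrow> 'a \<Rightarrow> real" where
  "weak_deriv S i u = (SOME v. has_weak_deriv S i u v)"

definition L2 :: "'a::euclidean_space set \<Rightarrow> ('a \<Rightarrow> real) set" where
  "L2 S = {u \<in> borel_measurable (lebesgue_on S). integrable (lebesgue_on S) (\<lambda>p. (u p)\<^sup>2)}"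

definition W12 :: "'a::euclidean_space set \<Rightarrow> ('a \<Rightarrow> real) set" where
  "W12 S = {u \<in> L2 S. \<forall>i\<in>Basis. \<exists>v\<in>L2 S. has_weak_deriv S i u v}"

text \<open>
  \<open>g \<in> L2 T\<close> is the trace of \<open>u \<in> W12 S\<close> along the boundary piece parametrized by
  \<open>\<gamma>\<close> on \<open>T\<close>. As usual, the trace is the continuous extension of the restriction map from
  functions smooth up to the boundary: \<open>g\<close> is the limit in \<open>L2 T\<close> of the restrictions of
  smooth functions converging to \<open>u\<close> in \<open>W12 S\<close>.
\<close>

definition has_trace ::
    "'a::euclidean_space set \<Rightarrow> (real \<Rightarrow> 'a) \<Rightarrow> real set \<Rightarrow> ('a \<Rightarrow> real) \<Rightarrow> (real \<Rightarrow> real) \<Rightarrow> bool" where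
  "has_trace S \<gamma> T u g \<longleftrightarrow>
     u \<in> W12 S \<and> g \<in> L2 T \<and>
     (\<exists>\<phi>. (\<forall>n. smooth (\<phi> n)) \<and>
        (\<lambda>n. LINT p|lebesgue_on S. (\<phi> n p - u p)\<^sup>2) \<longlonglongrightarrow> 0 \<and>
        (\<forall>i\<in>Basis. (\<lambda>n. LINT p|lebesgue_on S.
            (frechet_derivative (\<phi> n) (at p) i - weak_deriv S i u p)\<^sup>2) \<longlonglongrightarrow> 0) \<and>
        (\<lambda>n. LINT t|lebesgue_on T. (\<phi> n (\<gamma> t) - g t)\<^sup>2) \<longlonglongrightarrow> 0)"

section \<open>Admissible classes and energies\<close>

definition Omega :: "real \<Rightarrow> (real \<times> real) set" where
  "Omega L = {0..L} \<times> {0..1}"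

abbreviation D\<^sub>x :: "real \<Rightarrow> (real \<times> real \<Rightarrow> real) \<Rightarrow> real \<times> real \<Rightarrow> real" where
  "D\<^sub>x L u \<equiv> weak_deriv (Omega L) (1, 0) u"

abbreviation D\<^sub>y :: "real \<Rightarrow> (real \<times> real \<Rightarrow> real) \<Rightarrow> real \<times> real \<Rightarrow> real" where
  "D\<^sub>y L u \<equiv> weak_deriv (Omega L) (0, 1) u"

text \<open>Periodicity in \<open>y\<close> means that the traces on the edges \<open>y = 0\<close> and \<open>y = 1\<close> agree.\<close>

definition W12p :: "real \<Rightarrow> (real \<times> real \<Rightarrow> real) set" where
  "W12p L = {u \<in> W12 (Omega L). \<exists>g.
     has_trace (Omega L) (\<lambda>x. (x, 0)) {0..L} u g \<and>
     has_trace (Omega L) (\<lambda>x. (x, 1)) {0..L} u g}"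

definition vanishes_left :: "real \<Rightarrow> (real \<times> real \<Rightarrow> real) \<Rightarrow> bool" where
  "vanishes_left L u \<longleftrightarrow> has_trace (Omega L) (\<lambda>y. (0, y)) {0..1} u (\<lambda>y. 0)"

definition adm1 :: "real \<Rightarrow> (real \<times> real \<Rightarrow> real) set" where
  "adm1 L = {u \<in> W12p L.
     (\<exists>v\<in>L2 (Omega L). has_weak_deriv (Omega L) (0, 1) (D\<^sub>y L u) v) \<and> vanishes_left L u}"

definition adm2 :: "real \<Rightarrow> (real \<times> real \<Rightarrow> real) set" where
  "adm2 L = {u \<in> W12p L. D\<^sub>y L u \<in> W12 (Omega L) \<and> vanishes_left L u}"

definition adm3 :: "real \<Rightarrow> (real \<times> real \<Rightarrow> real) set" where
  "adm3 L = {u \<in> W12p L.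
     D\<^sub>x L u \<in> W12 (Omega L) \<and> D\<^sub>y L u \<in> W12 (Omega L) \<and> vanishes_left L u}"

definition B_set :: "real \<Rightarrow> (real \<times> real \<Rightarrow> real) \<Rightarrow> (real \<times> real) set" where
  "B_set L u = {p \<in> Omega L. \<bar>D\<^sub>y L u p\<bar> \<ge> 1}"

definition A_set :: "real \<Rightarrow> (real \<times> real \<Rightarrow> real) \<Rightarrow> (real \<times> real) set" where
  "A_set L u = Omega L - B_set L u"

definition E1 :: "real \<Rightarrow> real \<Rightarrow> real \<Rightarrow> (real \<times> real \<Rightarrow> real) \<Rightarrow> real" where
  "E1 L \<epsilon> \<Delta> u =
     (LINT p|lebesgue_on (Omega L). \<epsilon>\<^sup>2 * (D\<^sub>y L (D\<^sub>y L u) p)\<^sup>2 + (D\<^sub>x L u p)\<^sup>2)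
       + \<Delta> * measure lebesgue (A_set L u)"

definition E2 :: "real \<Rightarrow> real \<Rightarrow> real \<Rightarrow> (real \<times> real \<Rightarrow> real) \<Rightarrow> real" where
  "E2 L \<epsilon> \<Delta> u =
     (LINT p|lebesgue_on (Omega L).
        \<epsilon>\<^sup>2 * ((D\<^sub>x L (D\<^sub>y L u) p)\<^sup>2 + (D\<^sub>y L (D\<^sub>y L u) p)\<^sup>2) + (D\<^sub>x L u p)\<^sup>2)
       + \<Delta> * measure lebesgue (A_set L u)"

definition E3 :: "real \<Rightarrow> real \<Rightarrow> real \<Rightarrow> (real \<times> real \<Rightarrow> real) \<Rightarrow> real" where
  "E3 L \<epsilon> \<Delta> u =
     (LINT p|lebesgue_on (Omega L).
        \<epsilon>\<^sup>2 * ((D\<^sub>x L (D\<^sub>x L u) p)\<^sup>2 + (D\<^sub>y L (D\<^sub>x L u) p)\<^sup>2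
             + (D\<^sub>x L (D\<^sub>y L u) p)\<^sup>2 + (D\<^sub>y L (D\<^sub>y L u) p)\<^sup>2) + (D\<^sub>x L u p)\<^sup>2)
       + \<Delta> * measure lebesgue (A_set L u)"

datatype model = Model1 | Model2 | Model3

primrec adm :: "model \<Rightarrow> real \<Rightarrow> (real \<times> real \<Rightarrow> real) set" where
  "adm Model1 = adm1"
| "adm Model2 = adm2"
| "adm Model3 = adm3"

primrec energy :: "model \<Rightarrow> real \<Rightarrow> real \<Rightarrow> real \<Rightarrow> (real \<times> real \<Rightarrow> real) \<Rightarrow> real" where
  "energy Model1 = E1"
| "energy Model2 = E2"
| "energy Model3 = E3"

definition global_minimizer :: "model \<Rightarrow> real \<Rightarrow> real \<Rightarrow> real \<Rightarrow> (real \<times> real \<Rightarrow> real) \<Rightarrow> bool" where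
  "global_minimizer i L \<epsilon> \<Delta> u \<longleftrightarrow>
     u \<in> adm i L \<and> (\<forall>v\<in>adm i L. energy i L \<epsilon> \<Delta> u \<le> energy i L \<epsilon> \<Delta> v)"

text \<open>The supremum is taken in \<^typ>\<open>ereal\<close>, so that its finiteness is not presupposed.\<close>

definition critical_depth :: "model \<Rightarrow> real \<Rightarrow> real \<Rightarrow> ereal" where
  "critical_depth i L \<epsilon> = Sup {ereal \<Delta> |\<Delta>. \<Delta> \<ge> 0 \<and> global_minimizer i L \<epsilon> \<Delta> (\<lambda>p. 0)}"

end

theory Submission
  imports Defs "HOL-Complex_Analysis.Great_Picard"
begin

text \<open>
  Writing \<open>Q\<^sub>i\<close> for the quadratic part of the energy, the state \<open>u = 0\<close> has energy \<open>\<Delta> L\<close>, and it is a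
  minimizer exactly if \<open>\<Delta> |B(u)| \<le> Q\<^sub>i(u)\<close> for every admissible \<open>u\<close>. The critical depth is thus the
  best constant in this inequality, and it is of order \<open>\<epsilon> / L\<close> for the following reasons.

  \<^item> Since \<open>|u\<^sub>y| \<ge> 1\<close> on \<open>B(u)\<close>, its area is at most \<open>\<parallel>u\<^sub>y\<parallel>\<^sup>2\<close>. Poincare's inequality from the edge
    \<open>x = 0\<close> gives \<open>\<parallel>u\<parallel> \<le> \<surd>2 L \<parallel>u\<^sub>x\<parallel>\<close>, and interpolation between \<open>u\<close> and \<open>u\<^sub>y\<^sub>y\<close> gives
    \<open>\<parallel>u\<^sub>y\<parallel>\<^sup>2 \<le> 16 l\<^sup>-\<^sup>2 \<parallel>u\<parallel>\<^sup>2 + l\<^sup>2 \<parallel>u\<^sub>y\<^sub>y\<parallel>\<^sup>2\<close> for \<open>0 < l \<le> 1/2\<close> (lemma \<open>interpolation\<close>). With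
    \<open>l\<^sup>2 = \<epsilon> L / 4\<close> both terms are controlled by \<open>(L / \<epsilon>) Q\<^sub>i(u)\<close>; this is the lower bound, and the
    restriction \<open>l \<le> 1/2\<close> is where small \<open>\<epsilon>\<close> enters.
  \<^item> The function \<open>x sin(2\<pi>Ny) / (LN)\<close> with \<open>N\<close> of order \<open>(\<epsilon> L)\<^sup>-\<^sup>1\<^sup>/\<^sup>2\<close> balances \<open>\<epsilon>\<^sup>2 u\<^sub>y\<^sub>y\<^sup>2\<close> against \<open>u\<^sub>x\<^sup>2\<close>.
    It is smooth and admissible in all three classes, has \<open>Q\<^sub>i\<close> of order \<open>\<epsilon>\<close>, and is steep on a fixed
    fraction of the rectangle; this is the upper bound.

  Existence is proved by the direct method, in a form that uses strong convergence only. Every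
  admissible function has a trace, so by definition it is a \<open>W\<^sup>1\<^sup>,\<^sup>2\<close> limit of smooth functions. Hence the
  Poincare inequality, the trace inequality and Rellich's theorem are needed for smooth functions on
  a rectangle only. Rellich's theorem extracts from a minimizing sequence a subsequence converging in
  \<open>L\<^sup>2\<close> to some \<open>U\<close>. Instead of passing to weak limits of the derivatives, one minimizes \<open>Q\<^sub>i\<close> over the
  admissible functions within distance \<open>1/k\<close> of \<open>U\<close>: these sets are convex, so by the parallelogram law
  near-minimizers form a sequence whose derivatives converge strongly. This shows that \<open>U\<close> is
  admissible and that \<open>Q\<^sub>i\<close> is lower semicontinuous (lemma \<open>adm_lower_semicontinuous\<close>). Finally the
  interpolation inequality yields \<open>D\<^sub>y u\<^sub>n \<rightarrow> D\<^sub>y U\<close> strongly, and because \<open>{t. |t| \<ge> 1}\<close> is closed, the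
  measure of \<open>B\<close> is upper semicontinuous along the sequence.

  The last claim needs no estimate: if \<open>\<Delta> > 0\<close> is at least twice the critical depth and a minimizer had
  \<open>|B| = 0\<close>, its energy would be at least \<open>\<Delta> L\<close>, so that \<open>u = 0\<close> would be a minimizer at a depth beyond
  the critical one.
\<close>

section \<open>Smooth functions\<close>

lemma smooth_CkD: "smooth f \<Longrightarrow> Ck k f"
  by (simp add: smooth_def)

lemma Ck_SucD: "Ck (Suc k) f \<Longrightarrow> Ck k f"
proof (induction k arbitrary: f)
  case 0
  then show ?case by (simp add: differentiable_imp_continuous_on)
qed (simp del: Ck.simps(1))

lemma Ck_continuous: "Ck k f \<Longrightarrow> continuous_on UNIV f"
  by (cases k) (auto simp: differentiable_imp_continuous_on)

lemma smooth_continuous: "smooth f \<Longrightarrow> continuous_on S f"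
  using Ck_continuous[OF smooth_CkD] continuous_on_subset by blast

lemma Ck_Suc_differentiable:
  assumes "Ck (Suc k) f" shows "(f has_derivative frechet_derivative f (at p)) (at p)"
  using assms by (auto simp: differentiable_on_def frechet_derivative_works[symmetric])

lemma smooth_has_derivative:
  "smooth f \<Longrightarrow> (f has_derivative frechet_derivative f (at p)) (at p)"
  using Ck_Suc_differentiable[OF smooth_CkD] .

lemma smooth_partial:
  "smooth f \<Longrightarrow> i \<in> Basis \<Longrightarrow> smooth (\<lambda>p. frechet_derivative f (at p) i)"
  unfolding smooth_def by (metis Ck.simps(2))

lemma Ck_SucI:
  assumes "\<And>p. (f has_derivative f' p) (at p)" "\<And>i. i \<in> Basis \<Longrightarrow> Ck k (\<lambda>p. f' p i)"
  shows "Ck (Suc k) f"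
proof -
  have "frechet_derivative f (at p) = f' p" for p
    using frechet_derivative_at[OF assms(1)] by simp
  then show ?thesis
    using assms by (auto simp: differentiable_on_def differentiable_def)
qed

lemma Ck_const: "Ck k (\<lambda>p. c)"
proof (induction k arbitrary: c)
  case (Suc k)
  show ?case by (rule Ck_SucI[OF has_derivative_const Suc])
qed simp

lemma Ck_add: "Ck k f \<Longrightarrow> Ck k g \<Longrightarrow> Ck k (\<lambda>p. f p + g p)"
proof (induction k arbitrary: f g)
  case (Suc k)
  show ?case
    by (rule Ck_SucI[OF has_derivative_add[OF Suc.prems[THEN Ck_Suc_differentiable]]],
        rule Suc.IH) (use Suc.prems in auto)
qed (simp add: continuous_on_add)

lemma Ck_mult: "Ck k f \<Longrightarrow> Ck k g \<Longrightarrow> Ck k (\<lambda>p. f p * g p)"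
proof (induction k arbitrary: f g)
  case (Suc k)
  show ?case
    by (rule Ck_SucI[OF has_derivative_mult[OF Suc.prems[THEN Ck_Suc_differentiable]]],
        intro Ck_add Suc.IH Suc.prems[THEN Ck_SucD]) (use Suc.prems in auto)
qed (simp add: continuous_on_mult)

lemma smooth_const: "smooth (\<lambda>p. c)"
  by (simp add: smooth_def Ck_const)

lemma smooth_add: "smooth f \<Longrightarrow> smooth g \<Longrightarrow> smooth (\<lambda>p. f p + g p)"
  by (simp add: smooth_def Ck_add)

lemma smooth_mult: "smooth f \<Longrightarrow> smooth g \<Longrightarrow> smooth (\<lambda>p. f p * g p)"
  by (simp add: smooth_def Ck_mult)

lemma smooth_scale: "smooth f \<Longrightarrow> smooth (\<lambda>p. c * f p)"
  by (intro smooth_mult smooth_const)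

lemma Ck_translate: "Ck k f \<Longrightarrow> Ck k (\<lambda>p. f (p + a))"
proof (induction k arbitrary: f)
  case 0
  then show ?case by (auto intro!: continuous_on_compose2[of UNIV f] continuous_intros)
next
  case (Suc k)
  have "((\<lambda>p. f (p + a)) has_derivative frechet_derivative f (at (p + a))) (at p)" for p
    using has_derivative_compose[OF _ Ck_Suc_differentiable[OF Suc.prems],
        of "\<lambda>p. p + a" "\<lambda>h. h" p] has_derivative_add_const[OF has_derivative_ident, of a]
    by auto
  then show ?case
    by (rule Ck_SucI) (use Suc in auto)
qed

lemma smooth_translate: "smooth f \<Longrightarrow> smooth (\<lambda>p. f (p + a))"
  by (simp add: smooth_def Ck_translate)

lemma partial_add:
  assumes "smooth f" "smooth g"
  shows "frechet_derivative (\<lambda>p. f p + g p) (at p) i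
       = frechet_derivative f (at p) i + frechet_derivative g (at p) i"
  using frechet_derivative_at[OF has_derivative_add[OF assms[THEN smooth_has_derivative]], symmetric]
  by simp

lemma partial_mult:
  assumes "smooth f" "smooth g"
  shows "frechet_derivative (\<lambda>p. f p * g p) (at p) i
       = f p * frechet_derivative g (at p) i + frechet_derivative f (at p) i * g p"
  using frechet_derivative_at[OF has_derivative_mult[OF assms[THEN smooth_has_derivative]], symmetric]
  by simp

lemma partial_scale:
  assumes "smooth f"
  shows "frechet_derivative (\<lambda>p. c * f p) (at p) i = c * frechet_derivative f (at p) i"
  using partial_mult[OF smooth_const assms] by simp

lemma partial_translate:
  assumes "smooth f"
  shows "frechet_derivative (\<lambda>p. f (p + a)) (at p) = frechet_derivative f (at (p + a))"
proof -
  have "((\<lambda>p. f (p + a)) has_derivative frechet_derivative f (at (p + a))) (at p)"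
    using has_derivative_compose[OF _ smooth_has_derivative[OF assms],
        of "\<lambda>p. p + a" "\<lambda>h. h" p] has_derivative_add_const[OF has_derivative_ident, of a]
    by auto
  from frechet_derivative_at[OF this] show ?thesis by simp
qed

lemma smooth_has_real_derivative_line:
  assumes "smooth f"
  shows "((\<lambda>t. f (p + t *\<^sub>R e)) has_real_derivative frechet_derivative f (at (p + t *\<^sub>R e)) e) (at t)"
proof -
  have "((\<lambda>t. p + t *\<^sub>R e) has_derivative (\<lambda>h. h *\<^sub>R e)) (at t)"
    by (auto intro!: derivative_eq_intros)
  from has_derivative_compose[OF this smooth_has_derivative[OF assms]]
  have "((\<lambda>t. f (p + t *\<^sub>R e)) has_derivative
      (\<lambda>h. frechet_derivative f (at (p + t *\<^sub>R e)) (h *\<^sub>R e))) (at t)" .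
  moreover have "linear (frechet_derivative f (at (p + t *\<^sub>R e)))"
    using has_derivative_linear[OF smooth_has_derivative[OF assms]] .
  then have "(\<lambda>h. frechet_derivative f (at (p + t *\<^sub>R e)) (h *\<^sub>R e))
      = (*) (frechet_derivative f (at (p + t *\<^sub>R e)) e)"
    by (simp add: fun_eq_iff linear_cmul mult.commute)
  ultimately show ?thesis
    unfolding has_field_derivative_def by simp
qed

text \<open>Provides the concrete smooth functions of the construction, affine functions and sines of affine
  functions, from their explicitly known derivatives.\<close>

lemma Ck_derivative_sequence:
  fixes F :: "nat \<Rightarrow> real \<Rightarrow> real"
  assumes F: "\<And>n t. (F n has_real_derivative F (Suc n) t) (at t)"
  shows "Ck k (\<lambda>p. F n (e \<bullet> p + c))"
proof (induction k arbitrary: n)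
  case 0
  have "continuous_on UNIV (F n)"
    using DERIV_isCont[OF F] by (simp add: continuous_at_imp_continuous_on)
  then show ?case
    by (auto intro!: continuous_on_compose2[of UNIV "F n"] continuous_intros)
next
  case (Suc k)
  have "((\<lambda>p. F n (e \<bullet> p + c)) has_derivative (\<lambda>h. F (Suc n) (e \<bullet> p + c) * (e \<bullet> h))) (at p)" for p
  proof -
    have "((\<lambda>p. e \<bullet> p + c) has_derivative (\<lambda>h. e \<bullet> h)) (at p)"
      by (auto intro!: derivative_eq_intros)
    from has_derivative_compose[OF this F[unfolded has_field_derivative_def]] show ?thesis .
  qed
  then show ?case
    by (rule Ck_SucI) (intro Ck_mult Ck_const Suc.IH)
qed

lemma smooth_affine: "smooth (\<lambda>p. e \<bullet> p + c)"
proof -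
  define F :: "nat \<Rightarrow> real \<Rightarrow> real" where "F n t = (if n = 0 then t else if n = 1 then 1 else 0)" for n t
  have "(F n has_real_derivative F (Suc n) t) (at t)" for n t
    unfolding F_def by (auto intro!: derivative_eq_intros)
  from Ck_derivative_sequence[of F _ 0, OF this] show ?thesis
    unfolding smooth_def F_def by (auto simp del: Ck.simps)
qed

lemma smooth_sin_affine: "smooth (\<lambda>p. sin (e \<bullet> p + c))"
proof -
  have "((\<lambda>t. sin (t + real n * pi / 2)) has_real_derivative sin (t + real (Suc n) * pi / 2)) (at t)" for n t
  proof -
    have "sin (t + real (Suc n) * pi / 2) = cos (t + real n * pi / 2)"
      using sin_add[of "t + real n * pi / 2" "pi/2"] by (simp add: algebra_simps add_divide_distrib)
    then show ?thesis by (auto intro!: derivative_eq_intros)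
  qed
  from Ck_derivative_sequence[of "\<lambda>n t. sin (t + real n * pi / 2)" _ 0, OF this] show ?thesis
    unfolding smooth_def by (auto simp del: Ck.simps)
qed

section \<open>Cutoff functions\<close>

text \<open>The derivative of \<open>t\<^sup>-\<^sup>n e\<^sup>-\<^sup>1\<^sup>/\<^sup>t\<close> is a combination of functions of the same form.
  Hence the whole family is smooth as soon as all its members are once differentiable, and only
  the origin needs an argument.\<close>

definition flat_exp :: "nat \<Rightarrow> real \<Rightarrow> real" where
  "flat_exp n t = (if t > 0 then (1/t)^n * exp (- (1/t)) else 0)"

lemma flat_exp_tendsto_0: "(flat_exp n \<longlongrightarrow> 0) (at 0)"
proof -
  have "((\<lambda>x::real. x^n / exp x) \<longlongrightarrow> 0) at_top"
    by (rule tendsto_power_div_exp_0)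
  then have "((\<lambda>t::real. (1/t)^n / exp (1/t)) \<longlongrightarrow> 0) (at_right 0)"
    by (rule filterlim_compose) (use filterlim_inverse_at_top_right in \<open>simp add: inverse_eq_divide\<close>)
  then have "(flat_exp n \<longlongrightarrow> 0) (at_right 0)"
    by (rule Lim_transform_eventually)
      (auto simp: eventually_at_filter flat_exp_def exp_minus field_simps)
  moreover have "(flat_exp n \<longlongrightarrow> 0) (at_left 0)"
    by (rule tendsto_eventually) (auto simp: eventually_at_filter flat_exp_def)
  ultimately show ?thesis
    by (simp add: filterlim_split_at)
qed

lemma flat_exp_has_derivative:
  "(flat_exp n has_real_derivative flat_exp (n + 2) t - real n * flat_exp (n + 1) t) (at t)"
proof -
  consider "t > 0" | "t = 0" | "t < 0" by linarith
  then show ?thesis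
  proof cases
    case 1
    have inv: "((\<lambda>t. 1/t) has_real_derivative - ((1/t) * (1/t))) (at t)"
      using 1 by (auto intro!: derivative_eq_intros)
    have "((\<lambda>t. (1/t)^n) has_real_derivative - real n * (1/t)^(n + 1)) (at t)"
    proof (cases n)
      case (Suc m)
      show ?thesis
        unfolding Suc by (rule DERIV_cong[OF DERIV_power[OF inv]]) (simp add: divide_simps; simp add: algebra_simps)
    qed simp
    from DERIV_mult[OF this DERIV_fun_exp[OF DERIV_minus[OF inv]]]
    have "((\<lambda>t. (1/t)^n * exp (- (1/t))) has_real_derivative
        flat_exp (n + 2) t - real n * flat_exp (n + 1) t) (at t)"
      by (rule DERIV_cong) (use 1 in \<open>simp add: flat_exp_def algebra_simps\<close>)
    then show ?thesis
      by (rule has_field_derivative_transform_within_open[of _ _ _ "{0<..}"])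
        (use 1 in \<open>auto simp: flat_exp_def\<close>)
  next
    case 2
    have "((\<lambda>h. (flat_exp n (0 + h) - flat_exp n 0) / h) \<longlongrightarrow> 0) (at 0)"
      by (rule Lim_transform_eventually[OF flat_exp_tendsto_0[of "Suc n"]])
        (auto simp: eventually_at_filter flat_exp_def)
    then show ?thesis using 2
      by (simp add: DERIV_def flat_exp_def)
  next
    case 3
    have "((\<lambda>t. 0) has_real_derivative flat_exp (n + 2) t - real n * flat_exp (n + 1) t) (at t)"
      using 3 by (simp add: flat_exp_def)
    then show ?thesis
      by (rule has_field_derivative_transform_within_open[of _ _ _ "{..<0}"])
        (use 3 in \<open>auto simp: flat_exp_def\<close>)
  qed
qed

lemma smooth_flat_exp: "smooth (\<lambda>p. flat_exp n (e \<bullet> p + c))"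
proof -
  have "Ck k (\<lambda>p. flat_exp n (e \<bullet> p + c))" for k
  proof (induction k arbitrary: n)
    case 0
    have "continuous_on UNIV (flat_exp n)"
      using DERIV_isCont[OF flat_exp_has_derivative] by (simp add: continuous_at_imp_continuous_on)
    then show ?case
      by (auto intro!: continuous_on_compose2[of UNIV "flat_exp n"] continuous_intros)
  next
    case (Suc k)
    have "((\<lambda>p. flat_exp n (e \<bullet> p + c)) has_derivative
        (\<lambda>h. (flat_exp (n + 2) (e \<bullet> p + c) + (- real n) * flat_exp (n + 1) (e \<bullet> p + c)) * (e \<bullet> h))) (at p)" for p
    proof -
      have "((\<lambda>p. e \<bullet> p + c) has_derivative (\<lambda>h. e \<bullet> h)) (at p)"
        by (auto intro!: derivative_eq_intros)
      from has_derivative_compose[OF this flat_exp_has_derivative[unfolded has_field_derivative_def]]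
      show ?thesis by simp
    qed
    then show ?case
      by (rule Ck_SucI) (intro Ck_mult Ck_add Ck_const Suc.IH)
  qed
  then show ?thesis by (simp add: smooth_def)
qed

text \<open>Each factor is a copy of \<open>e\<^sup>-\<^sup>1\<^sup>/\<^sup>t\<close>, which tends to \<open>1\<close> at infinity. Scaling by \<open>k\<close> therefore makes
  the product converge to the indicator of the open box, and the shift by \<open>1\<close> keeps the support at
  distance \<open>1/k\<close> from the complement of the box.\<close>

definition cutoff :: "real \<Rightarrow> real \<Rightarrow> real \<Rightarrow> real \<Rightarrow> nat \<Rightarrow> real \<times> real \<Rightarrow> real" where
  "cutoff a b c d k p =
     flat_exp 0 (real k * (fst p - a) - 1) * flat_exp 0 (real k * (b - fst p) - 1) *
     (flat_exp 0 (real k * (snd p - c) - 1) * flat_exp 0 (real k * (d - snd p) - 1))"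

lemma flat_exp_0_bounds: "0 \<le> flat_exp 0 t" "flat_exp 0 t \<le> 1"
  by (auto simp: flat_exp_def)

lemma cutoff_bounds: "0 \<le> cutoff a b c d k p" "cutoff a b c d k p \<le> 1"
  unfolding cutoff_def by (auto intro!: mult_nonneg_nonneg mult_le_one flat_exp_0_bounds)

lemma smooth_cutoff: "smooth (cutoff a b c d k)"
proof -
  have 1: "smooth (\<lambda>p::real \<times> real. flat_exp 0 (real k * (fst p - a) - 1))"
    using smooth_flat_exp[of 0 "(real k, 0::real)" "- real k * a - 1"]
    by (simp add: inner_prod_def algebra_simps)
  have 2: "smooth (\<lambda>p::real \<times> real. flat_exp 0 (real k * (b - fst p) - 1))"
    using smooth_flat_exp[of 0 "(- real k, 0::real)" "real k * b - 1"]
    by (simp add: inner_prod_def algebra_simps)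
  have 3: "smooth (\<lambda>p::real \<times> real. flat_exp 0 (real k * (snd p - c) - 1))"
    using smooth_flat_exp[of 0 "(0::real, real k)" "- real k * c - 1"]
    by (simp add: inner_prod_def algebra_simps)
  have 4: "smooth (\<lambda>p::real \<times> real. flat_exp 0 (real k * (d - snd p) - 1))"
    using smooth_flat_exp[of 0 "(0::real, - real k)" "real k * d - 1"]
    by (simp add: inner_prod_def algebra_simps)
  have "cutoff a b c d k = (\<lambda>p. 
     flat_exp 0 (real k * (fst p - a) - 1) * flat_exp 0 (real k * (b - fst p) - 1) *
     (flat_exp 0 (real k * (snd p - c) - 1) * flat_exp 0 (real k * (d - snd p) - 1)))"
    by (simp add: fun_eq_iff cutoff_def)
  then show ?thesis
    using 1 2 3 4 by (simp add: smooth_mult)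
qed

lemma cutoff_tendsto:
  "(\<lambda>k. cutoff a b c d k p) \<longlonglongrightarrow> indicator ({a<..<b} \<times> {c<..<d}) p"
proof -
  have *: "(\<lambda>k. flat_exp 0 (real k * s - 1)) \<longlonglongrightarrow> (if s > 0 then 1 else 0)" for s
  proof (cases "s > 0")
    case True
    have "filterlim (\<lambda>k. -1 + s * real k) at_top sequentially"
      by (intro filterlim_tendsto_add_at_top[OF tendsto_const]
          filterlim_tendsto_pos_mult_at_top[OF tendsto_const True] filterlim_real_sequentially)
    then have "filterlim (\<lambda>k. real k * s - 1) at_top sequentially"
      by (simp add: algebra_simps)
    moreover have "((\<lambda>t. flat_exp 0 t) \<longlongrightarrow> 1) at_top"
    proof (rule Lim_transform_eventually)
      have "((\<lambda>t::real. 1/t) \<longlongrightarrow> 0) at_top"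
        using tendsto_inverse_0_at_top[OF filterlim_ident] by (simp add: inverse_eq_divide)
      then have "((\<lambda>t::real. exp (- (1/t))) \<longlongrightarrow> exp (- 0)) at_top"
        by (intro tendsto_exp tendsto_minus)
      then show "((\<lambda>t. exp (- (1/t))) \<longlongrightarrow> (1::real)) at_top" by simp
      show "\<forall>\<^sub>F t in at_top. exp (- (1/t)) = flat_exp 0 t"
        using eventually_gt_at_top[of 0] by eventually_elim (auto simp: flat_exp_def)
    qed
    ultimately have "(\<lambda>k. flat_exp 0 (real k * s - 1)) \<longlonglongrightarrow> 1"
      by (rule filterlim_compose[rotated])
    then show ?thesis using True by simp
  next
    case False
    then have "real k * s - 1 \<le> 0" for k
      by (smt (verit) mult_nonneg_nonpos of_nat_0_le_iff)
    then have "flat_exp 0 (real k * s - 1) = 0" for k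
      by (simp add: flat_exp_def not_less)
    then show ?thesis using False by simp
  qed
  have "indicator ({a<..<b} \<times> {c<..<d}) p =
     (if fst p - a > 0 then 1 else 0) * (if b - fst p > 0 then 1 else 0) *
     ((if snd p - c > 0 then 1 else 0) * (if d - snd p > 0 then 1 else (0::real)))"
    by (cases p) (auto simp: indicator_def)
  then show ?thesis
    unfolding cutoff_def by (simp only:) (intro tendsto_mult *)
qed

lemma cutoff_nonzeroD:
  assumes "cutoff a b c d k p \<noteq> 0"
  shows "p \<in> cbox (a + 1 / real k, c + 1 / real k) (b - 1 / real k, d - 1 / real k)" "k > 0"
proof -
  have *: "s \<ge> 1 / real k \<and> k > 0" if "flat_exp 0 (real k * s - 1) \<noteq> 0" for s
  proof -
    have "real k * s > 1" using that by (auto simp: flat_exp_def split: if_splits)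
    moreover from this have "k > 0" by (cases k) auto
    ultimately show ?thesis by (simp add: field_simps)
  qed
  have "fst p - a \<ge> 1 / real k" "b - fst p \<ge> 1 / real k" "snd p - c \<ge> 1 / real k" "d - snd p \<ge> 1 / real k" "k > 0"
    using assms * unfolding cutoff_def by auto
  then show "p \<in> cbox (a + 1 / real k, c + 1 / real k) (b - 1 / real k, d - 1 / real k)" "k > 0"
    by (cases p; auto simp: cbox_Pair_eq)+
qed

lemma cutoff_support:
  "closure {p. cutoff a b c d k p \<noteq> 0} \<subseteq> {a<..<b} \<times> {c<..<d}"
  "compact (closure {p. cutoff a b c d k p \<noteq> 0})"
proof -
  define Q :: "(real \<times> real) set"
    where "Q = cbox (a + 1 / real k, c + 1 / real k) (b - 1 / real k, d - 1 / real k)"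
  have sub: "{p. cutoff a b c d k p \<noteq> 0} \<subseteq> Q"
    using cutoff_nonzeroD(1) unfolding Q_def by blast
  have "closed Q" unfolding Q_def by (rule closed_cbox)
  with sub have cl: "closure {p. cutoff a b c d k p \<noteq> 0} \<subseteq> Q"
    by (rule closure_minimal)
  have "bounded Q" unfolding Q_def by (rule bounded_cbox)
  then show "compact (closure {p. cutoff a b c d k p \<noteq> 0})"
    using sub bounded_subset by (auto simp: compact_closure)
  show "closure {p. cutoff a b c d k p \<noteq> 0} \<subseteq> {a<..<b} \<times> {c<..<d}"
  proof (cases "k = 0")
    case True
    then have E: "{p. cutoff a b c d k p \<noteq> 0} = {}" using cutoff_nonzeroD(2)[of a b c d k] by blast
    show ?thesis unfolding E by simp
  next
    case False
    then have "1 / real k > 0" by simp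
    moreover have "x < y" if "1 / real k > 0" "x + 1 / real k \<le> y" for x y using that by linarith
    moreover have "x < y" if "1 / real k > 0" "x \<le> y - 1 / real k" for x y using that by linarith
    ultimately have "Q \<subseteq> {a<..<b} \<times> {c<..<d}"
      unfolding Q_def cbox_Pair_eq by (force simp del: zero_less_divide_iff)
    then show ?thesis using cl by blast
  qed
qed

lemma test_function_mult_cutoff:
  assumes "smooth f" "{a<..<b} \<times> {c<..<d} \<subseteq> S"
  shows "test_function S (\<lambda>p. f p * cutoff a b c d k p)"
proof -
  have sub: "{p. f p * cutoff a b c d k p \<noteq> 0} \<subseteq> {p. cutoff a b c d k p \<noteq> 0}"
    by auto
  have "open ({a<..<b} \<times> {c<..<d})" by (intro open_Times) auto
  then have "{a<..<b} \<times> {c<..<d} \<subseteq> interior S"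
    using assms(2) by (simp add: interior_maximal)
  moreover have "bounded {p. cutoff a b c d k p \<noteq> 0}"
    using cutoff_support(2) by (simp add: compact_closure)
  then have "compact (closure {p. f p * cutoff a b c d k p \<noteq> 0})"
    using sub bounded_subset by (auto simp: compact_closure)
  ultimately show ?thesis
    using closure_mono[OF sub] cutoff_support(1)[of a b c d k] assms(1)
    unfolding test_function_def by (auto intro!: smooth_mult smooth_cutoff)
qed

section \<open>Square-integrable functions\<close>

definition norm2 :: "'a::euclidean_space set \<Rightarrow> ('a \<Rightarrow> real) \<Rightarrow> real" where
  "norm2 S f = sqrt (LINT p|lebesgue_on S. (f p)\<^sup>2)"

lemma norm2_nonneg [simp]: "norm2 S f \<ge> 0"
  by (simp add: norm2_def)

lemma norm2_power2: "(norm2 S f)\<^sup>2 = (LINT p|lebesgue_on S. (f p)\<^sup>2)"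
  by (simp add: norm2_def)

lemma L2_measurable: "f \<in> L2 S \<Longrightarrow> f \<in> borel_measurable (lebesgue_on S)"
  and L2_square_integrable: "f \<in> L2 S \<Longrightarrow> integrable (lebesgue_on S) (\<lambda>p. (f p)\<^sup>2)"
  by (simp_all add: L2_def)

lemma L2_mult_integrable:
  assumes "f \<in> L2 S" "g \<in> L2 S"
  shows "integrable (lebesgue_on S) (\<lambda>p. f p * g p)"
proof (rule Bochner_Integration.integrable_bound)
  show "integrable (lebesgue_on S) (\<lambda>p. (f p)\<^sup>2 + (g p)\<^sup>2)"
    using assms by (auto simp: L2_def)
  show "(\<lambda>p. f p * g p) \<in> borel_measurable (lebesgue_on S)"
    using assms[THEN L2_measurable] by measurable
  have "\<bar>a * b\<bar> \<le> a\<^sup>2 + b\<^sup>2" for a b :: real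
  proof -
    have "0 \<le> (\<bar>a\<bar> - \<bar>b\<bar>)\<^sup>2" by simp
    then have "2 * \<bar>a * b\<bar> \<le> a\<^sup>2 + b\<^sup>2" by (simp add: power2_diff abs_mult)
    then show ?thesis by (smt (verit) abs_ge_zero)
  qed
  then show "AE p in lebesgue_on S. norm (f p * g p) \<le> norm ((f p)\<^sup>2 + (g p)\<^sup>2)"
    by simp
qed

lemma L2_scale: "f \<in> L2 S \<Longrightarrow> (\<lambda>p. c * f p) \<in> L2 S"
  by (auto simp: L2_def power_mult_distrib)

lemma L2_add:
  assumes "f \<in> L2 S" "g \<in> L2 S"
  shows "(\<lambda>p. f p + g p) \<in> L2 S"
proof -
  have "integrable (lebesgue_on S) (\<lambda>p. (f p)\<^sup>2 + (g p)\<^sup>2 + 2 * (f p * g p))"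
    using assms L2_mult_integrable[OF assms] by (auto simp: L2_def)
  then show ?thesis
    using assms by (auto simp: L2_def power2_sum algebra_simps)
qed

lemma L2_diff: "f \<in> L2 S \<Longrightarrow> g \<in> L2 S \<Longrightarrow> (\<lambda>p. f p - g p) \<in> L2 S"
  using L2_add[of f S "\<lambda>p. (-1) * g p"] L2_scale[of g S "-1"] by simp

lemma L2_zero: "(\<lambda>p. 0) \<in> L2 S"
  by (simp add: L2_def)

lemma norm2_zero [simp]: "norm2 S (\<lambda>p. 0) = 0"
  by (simp add: norm2_def)

lemma norm2_scale: "norm2 S (\<lambda>p. c * f p) = \<bar>c\<bar> * norm2 S f"
  by (simp add: norm2_def power_mult_distrib real_sqrt_mult)

lemma norm2_add_power2:
  assumes "f \<in> L2 S" "g \<in> L2 S"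
  shows "(norm2 S (\<lambda>p. f p + g p))\<^sup>2
       = (norm2 S f)\<^sup>2 + (norm2 S g)\<^sup>2 + 2 * (LINT p|lebesgue_on S. f p * g p)"
proof -
  have "(norm2 S (\<lambda>p. f p + g p))\<^sup>2
      = (LINT p|lebesgue_on S. (f p)\<^sup>2 + (g p)\<^sup>2 + 2 * (f p * g p))"
    unfolding norm2_power2 by (simp add: power2_sum algebra_simps)
  also have "\<dots> = (norm2 S f)\<^sup>2 + (norm2 S g)\<^sup>2 + 2 * (LINT p|lebesgue_on S. f p * g p)"
    unfolding norm2_power2 using assms L2_mult_integrable[OF assms]
    by (simp add: L2_square_integrable)
  finally show ?thesis .
qed

lemma norm2_parallelogram:
  assumes "f \<in> L2 S" "g \<in> L2 S"
  shows "(norm2 S (\<lambda>p. f p + g p))\<^sup>2 + (norm2 S (\<lambda>p. f p - g p))\<^sup>2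
       = 2 * (norm2 S f)\<^sup>2 + 2 * (norm2 S g)\<^sup>2"
  using norm2_add_power2[OF assms] norm2_add_power2[OF assms(1) L2_scale[OF assms(2), of "-1"]]
    norm2_scale[of S "-1" g]
  by simp

lemma L2_Cauchy_Schwarz:
  assumes "f \<in> L2 S" "g \<in> L2 S"
  shows "\<bar>LINT p|lebesgue_on S. f p * g p\<bar> \<le> norm2 S f * norm2 S g"
proof -
  let ?b = "LINT p|lebesgue_on S. f p * g p"
  let ?a = "(norm2 S f)\<^sup>2" and ?c = "(norm2 S g)\<^sup>2"
  have "?b\<^sup>2 \<le> ?a * ?c"
  proof (cases "?c = 0")
    case True
    then have "AE p in lebesgue_on S. (g p)\<^sup>2 = 0"
      using integral_nonneg_eq_0_iff_AE[OF L2_square_integrable[OF assms(2)]]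
      by (simp add: norm2_power2[of S g, symmetric])
    then have "AE p in lebesgue_on S. f p * g p = 0" by eventually_elim simp
    then have "?b = 0" by (rule integral_eq_zero_AE)
    then show ?thesis by simp
  next
    case False
    have "0 \<le> (norm2 S (\<lambda>p. ?c * f p + (- ?b) * g p))\<^sup>2" by simp
    also have "\<dots> = ?c\<^sup>2 * ?a + ?b\<^sup>2 * ?c - 2 * ?c * ?b * ?b"
      unfolding norm2_add_power2[OF L2_scale[OF assms(1)] L2_scale[OF assms(2)]] norm2_scale
        power_mult_distrib
      by (simp add: mult.assoc mult.left_commute[of "f _"] power_mult_distrib)
    also have "\<dots> = ?c * (?a * ?c - ?b\<^sup>2)" by (simp add: power2_eq_square algebra_simps)
    finally have "0 \<le> ?a * ?c - ?b\<^sup>2"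
      using False zero_le_mult_iff[of ?c "?a * ?c - ?b\<^sup>2"] by auto
    then show ?thesis by simp
  qed
  then have "?b\<^sup>2 \<le> (norm2 S f * norm2 S g)\<^sup>2" by (simp add: power_mult_distrib)
  then have "\<bar>?b\<bar> \<le> \<bar>norm2 S f * norm2 S g\<bar>" by (simp only: abs_le_square_iff)
  then show ?thesis by simp
qed

lemma norm2_triangle:
  assumes "f \<in> L2 S" "g \<in> L2 S"
  shows "norm2 S (\<lambda>p. f p + g p) \<le> norm2 S f + norm2 S g"
proof -
  have "(norm2 S (\<lambda>p. f p + g p))\<^sup>2 \<le> (norm2 S f + norm2 S g)\<^sup>2"
    using norm2_add_power2[OF assms] L2_Cauchy_Schwarz[OF assms]
    by (simp add: power2_sum)
  then show ?thesis
    by (rule power2_le_imp_le) simp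
qed

lemma norm2_uminus: "norm2 S (\<lambda>p. f p - g p) = norm2 S (\<lambda>p. g p - f p)"
  by (simp add: norm2_def power2_commute)

lemma norm2_triangle_diff:
  assumes "f \<in> L2 S" "g \<in> L2 S" "h \<in> L2 S"
  shows "norm2 S (\<lambda>p. f p - h p) \<le> norm2 S (\<lambda>p. f p - g p) + norm2 S (\<lambda>p. g p - h p)"
  using norm2_triangle[OF L2_diff[OF assms(1,2)] L2_diff[OF assms(2,3)]] by simp

lemma norm2_diff_le:
  assumes "f \<in> L2 S" "g \<in> L2 S"
  shows "norm2 S (\<lambda>p. f p - g p) \<le> norm2 S f + norm2 S g"
  using norm2_triangle_diff[OF assms(1) L2_zero assms(2)] norm2_uminus[of S "\<lambda>_. 0" g] by simp

lemma norm2_le_add_diff: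
  assumes "f \<in> L2 S" "g \<in> L2 S"
  shows "norm2 S f \<le> norm2 S g + norm2 S (\<lambda>p. f p - g p)"
  using norm2_triangle[OF assms(2) L2_diff[OF assms]] by simp

lemma norm2_mono_AE:
  assumes "g \<in> L2 S" "f \<in> borel_measurable (lebesgue_on S)"
    "AE p in lebesgue_on S. \<bar>f p\<bar> \<le> \<bar>g p\<bar>"
  shows "f \<in> L2 S" "norm2 S f \<le> norm2 S g"
proof -
  have *: "AE p in lebesgue_on S. (f p)\<^sup>2 \<le> (g p)\<^sup>2"
    using assms(3) by eventually_elim (simp add: abs_le_square_iff)
  show f: "f \<in> L2 S"
    unfolding L2_def
    using assms(2) * Bochner_Integration.integrable_bound[OF L2_square_integrable[OF assms(1)], of "\<lambda>p. (f p)\<^sup>2"]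
    by simp
  show "norm2 S f \<le> norm2 S g"
    unfolding norm2_def using assms(1) f * by (intro real_sqrt_le_mono integral_mono_AE) (auto simp: L2_def)
qed

lemma L2_bounded_mult:
  assumes "f \<in> L2 S" "g \<in> borel_measurable (lebesgue_on S)" "\<And>p. p \<in> S \<Longrightarrow> \<bar>g p\<bar> \<le> C"
  shows "(\<lambda>p. f p * g p) \<in> L2 S" "norm2 S (\<lambda>p. f p * g p) \<le> \<bar>C\<bar> * norm2 S f"
proof -
  have m: "(\<lambda>p. f p * g p) \<in> borel_measurable (lebesgue_on S)"
    using assms(2) L2_measurable[OF assms(1)] by measurable
  have "AE p in lebesgue_on S. \<bar>f p * g p\<bar> \<le> \<bar>C * f p\<bar>"
  proof (rule AE_I2)
    fix p assume "p \<in> space (lebesgue_on S)"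
    then have "\<bar>g p\<bar> \<le> \<bar>C\<bar>" using assms(3)[of p] by simp
    then show "\<bar>f p * g p\<bar> \<le> \<bar>C * f p\<bar>"
      unfolding abs_mult by (metis abs_ge_zero mult.commute mult_right_mono)
  qed
  from norm2_mono_AE[OF L2_scale[OF assms(1)] m this]
  show "(\<lambda>p. f p * g p) \<in> L2 S" "norm2 S (\<lambda>p. f p * g p) \<le> \<bar>C\<bar> * norm2 S f"
    by (simp_all add: norm2_scale)
qed

lemma measurable_lebesgue_on_AE:
  fixes f g :: "'a::euclidean_space \<Rightarrow> real"
  assumes "f \<in> borel_measurable (lebesgue_on S)" "S \<in> sets lebesgue"
    "AE p in lebesgue_on S. f p = g p"
  shows "g \<in> borel_measurable (lebesgue_on S)"
proof -
  have "(\<lambda>x. if x \<in> S then f x else 0) \<in> borel_measurable lebesgue"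
    using assms by (simp add: borel_measurable_if)
  moreover have "AE p in lebesgue. (if p \<in> S then f p else 0) = (if p \<in> S then g p else 0)"
    using assms(2,3) by (auto simp: AE_restrict_space_iff elim!: AE_mp)
  ultimately have "(\<lambda>x. if x \<in> S then g x else 0) \<in> borel_measurable lebesgue"
    by (rule borel_measurable_AE)
  then show ?thesis by (rule borel_measurable_if_D)
qed

lemma L2_cong_AE:
  assumes "f \<in> L2 S" "S \<in> sets lebesgue" "AE p in lebesgue_on S. f p = g p"
  shows "g \<in> L2 S"
proof (rule norm2_mono_AE(1)[OF assms(1)])
  show "g \<in> borel_measurable (lebesgue_on S)"
    by (rule measurable_lebesgue_on_AE[OF L2_measurable[OF assms(1)] assms(2,3)])
  show "AE p in lebesgue_on S. \<bar>g p\<bar> \<le> \<bar>f p\<bar>"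
    using assms(3) by eventually_elim simp
qed

lemma norm2_cong_AE:
  assumes "f \<in> L2 S" "g \<in> L2 S" "AE p in lebesgue_on S. f p = g p"
  shows "norm2 S f = norm2 S g"
  using assms by (intro antisym norm2_mono_AE(2)) (auto simp: L2_def elim: AE_mp)

lemma norm2_tendsto:
  assumes "\<And>n. f n \<in> L2 S" "g \<in> L2 S" "(\<lambda>n. norm2 S (\<lambda>p. f n p - g p)) \<longlonglongrightarrow> 0"
  shows "(\<lambda>n. norm2 S (f n)) \<longlonglongrightarrow> norm2 S g"
proof -
  have "(\<lambda>n. norm2 S (f n) - norm2 S g) \<longlonglongrightarrow> 0"
  proof (rule Lim_null_comparison[OF always_eventually assms(3)], rule allI)
    show "norm (norm2 S (f n) - norm2 S g) \<le> norm2 S (\<lambda>p. f n p - g p)" for n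
      using norm2_le_add_diff[OF assms(1)[of n] assms(2)] norm2_le_add_diff[OF assms(2) assms(1)[of n]]
        norm2_uminus[of S g "f n"] by auto
  qed
  then show ?thesis by (simp add: LIM_zero_iff)
qed

lemma L2_inner_tendsto:
  assumes "\<And>n. f n \<in> L2 S" "F \<in> L2 S" "(\<lambda>n. norm2 S (\<lambda>p. f n p - F p)) \<longlonglongrightarrow> 0" "g \<in> L2 S"
  shows "(\<lambda>n. LINT p|lebesgue_on S. f n p * g p) \<longlonglongrightarrow> (LINT p|lebesgue_on S. F p * g p)"
proof -
  have "(\<lambda>n. (LINT p|lebesgue_on S. f n p * g p) - (LINT p|lebesgue_on S. F p * g p)) \<longlonglongrightarrow> 0"
  proof (rule Lim_null_comparison[OF always_eventually], rule allI)
    show "(\<lambda>n. norm2 S (\<lambda>p. f n p - F p) * norm2 S g) \<longlonglongrightarrow> 0"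
      using tendsto_mult_right[OF assms(3), of "norm2 S g"] by simp
    show "norm ((LINT p|lebesgue_on S. f n p * g p) - (LINT p|lebesgue_on S. F p * g p))
        \<le> norm2 S (\<lambda>p. f n p - F p) * norm2 S g" for n
      using L2_Cauchy_Schwarz[OF L2_diff[OF assms(1)[of n] assms(2)] assms(4)]
        Bochner_Integration.integral_diff[OF L2_mult_integrable[OF assms(1)[of n] assms(4)]
          L2_mult_integrable[OF assms(2,4)]]
      by (simp add: left_diff_distrib)
  qed
  then show ?thesis by (simp add: LIM_zero_iff)
qed

lemma L2_integrable:
  assumes "f \<in> L2 S" "S \<in> lmeasurable"
  shows "integrable (lebesgue_on S) f"
  by (rule finite_measure.square_integrable_imp_integrable[OF finite_measure_lebesgue_on[OF assms(2)]
        L2_measurable[OF assms(1)] L2_square_integrable[OF assms(1)]])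

lemma L2_const:
  assumes "S \<in> lmeasurable"
  shows "(\<lambda>p. c) \<in> L2 S"
  unfolding L2_def
  using finite_measure.integrable_const[OF finite_measure_lebesgue_on[OF assms], of "c\<^sup>2"] by simp

lemma L2_convergent_AE_subseq:
  assumes "\<And>n. f n \<in> L2 S" "g \<in> L2 S" "(\<lambda>n. norm2 S (\<lambda>p. f n p - g p)) \<longlonglongrightarrow> 0"
  shows "\<exists>r::nat \<Rightarrow> nat. strict_mono r \<and> (AE p in lebesgue_on S. (\<lambda>n. f (r n) p) \<longlonglongrightarrow> g p)"
proof -
  have "(\<lambda>n. (norm2 S (\<lambda>p. f n p - g p))\<^sup>2) \<longlonglongrightarrow> 0"
    using tendsto_power[OF assms(3), of 2] by simp
  then have "(\<lambda>n. LINT p|lebesgue_on S. norm ((f n p - g p)\<^sup>2)) \<longlonglongrightarrow> 0"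
    by (simp add: norm2_power2)
  from tendsto_L1_AE_subseq[OF L2_square_integrable[OF L2_diff[OF assms(1,2)]] this]
  obtain r :: "nat \<Rightarrow> nat" where r: "strict_mono r"
    "AE p in lebesgue_on S. (\<lambda>n. (f (r n) p - g p)\<^sup>2) \<longlonglongrightarrow> 0" by auto
  have "AE p in lebesgue_on S. (\<lambda>n. f (r n) p) \<longlonglongrightarrow> g p"
    using r(2)
  proof eventually_elim
    case (elim p)
    then have "(\<lambda>n. f (r n) p - g p) \<longlonglongrightarrow> 0"
      using tendsto_real_sqrt[OF elim] by (simp add: tendsto_rabs_zero_iff)
    then show ?case by (simp add: LIM_zero_iff)
  qed
  with r(1) show ?thesis by blast
qed

text \<open>On a set of finite measure an \<open>L\<^sup>2\<close>-Cauchy sequence is Cauchy in \<open>L\<^sup>1\<close>, hence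
  has a subsequence that is a.e. Cauchy; Fatou's lemma bounds the distance to its pointwise limit.\<close>

lemma L2_complete:
  assumes f: "\<And>n. f n \<in> L2 S" and S: "S \<in> lmeasurable"
    and C: "\<And>e. e > 0 \<Longrightarrow> \<exists>N. \<forall>m\<ge>N. \<forall>n\<ge>N. norm2 S (\<lambda>p. f m p - f n p) < e"
  obtains F where "F \<in> L2 S" "(\<lambda>n. norm2 S (\<lambda>p. f n p - F p)) \<longlonglongrightarrow> 0"
proof -
  have fm [measurable]: "f n \<in> borel_measurable (lebesgue_on S)" for n
    using L2_measurable[OF f] .
  have d: "(\<lambda>p. f m p - f n p) \<in> L2 S" for m n by (rule L2_diff[OF f f])
  have L1: "(LINT p|lebesgue_on S. norm (f m p - f n p))
      \<le> norm2 S (\<lambda>p. f m p - f n p) * norm2 S (\<lambda>p. 1)" for m n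
  proof -
    have "(\<lambda>p. \<bar>f m p - f n p\<bar>) \<in> L2 S"
      using d[of m n] by (auto simp: L2_def)
    from L2_Cauchy_Schwarz[OF this L2_const[OF S, of 1]] show ?thesis
      by (simp add: norm2_def)
  qed
  have "\<exists>N. \<forall>i\<ge>N. \<forall>j\<ge>N. LINT p|lebesgue_on S. norm (f i p - f j p) < e" if "e > 0" for e
  proof -
    have "e / (norm2 S (\<lambda>p. 1) + 1) > 0" using that by (simp add: add_nonneg_pos)
    from C[OF this] obtain N where N: "\<And>m n. m \<ge> N \<Longrightarrow> n \<ge> N \<Longrightarrow>
        norm2 S (\<lambda>p. f m p - f n p) < e / (norm2 S (\<lambda>p. 1) + 1)" by blast
    have "(LINT p|lebesgue_on S. norm (f i p - f j p)) < e" if "i \<ge> N" "j \<ge> N" for i j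
    proof -
      let ?K = "norm2 S (\<lambda>p. 1)"
      have "(LINT p|lebesgue_on S. norm (f i p - f j p)) \<le> norm2 S (\<lambda>p. f i p - f j p) * ?K"
        by (rule L1)
      also have "\<dots> \<le> norm2 S (\<lambda>p. f i p - f j p) * (?K + 1)"
        by (intro mult_left_mono) auto
      also have "\<dots> < e"
        using N[OF that] by (simp add: pos_less_divide_eq add_nonneg_pos)
      finally show ?thesis .
    qed
    then show ?thesis by blast
  qed
  from cauchy_L1_AE_cauchy_subseq[OF L2_integrable[OF f S] this]
  obtain r where r: "strict_mono r" "AE p in lebesgue_on S. Cauchy (\<lambda>i. f (r i) p)" by blast
  define F where "F p = lim (\<lambda>i. f (r i) p)" for p
  have Fm [measurable]: "F \<in> borel_measurable (lebesgue_on S)"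
    unfolding F_def by measurable
  have lim: "AE p in lebesgue_on S. (\<lambda>i. f (r i) p) \<longlonglongrightarrow> F p"
    using r(2) by eventually_elim (simp add: F_def Cauchy_convergent convergent_LIMSEQ_iff[symmetric])
  have bound: "(\<lambda>p. f n p - F p) \<in> L2 S \<and> norm2 S (\<lambda>p. f n p - F p) \<le> e"
    if N: "\<And>m n. m \<ge> N \<Longrightarrow> n \<ge> N \<Longrightarrow> norm2 S (\<lambda>p. f m p - f n p) < e" and n: "n \<ge> N" for n N e
  proof -
    have e: "e > 0" using N[OF n n] by (simp add: norm2_def)
    have "(\<integral>\<^sup>+ p. ennreal ((f n p - F p)\<^sup>2) \<partial>lebesgue_on S)
        = (\<integral>\<^sup>+ p. liminf (\<lambda>i. ennreal ((f n p - f (r i) p)\<^sup>2)) \<partial>lebesgue_on S)"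
    proof (rule nn_integral_cong_AE)
      show "AE p in lebesgue_on S. ennreal ((f n p - F p)\<^sup>2)
          = liminf (\<lambda>i. ennreal ((f n p - f (r i) p)\<^sup>2))"
        using lim
      proof eventually_elim
        case (elim p)
        have "(\<lambda>i. ennreal ((f n p - f (r i) p)\<^sup>2)) \<longlonglongrightarrow> ennreal ((f n p - F p)\<^sup>2)"
          by (intro tendsto_ennrealI tendsto_intros elim)
        from lim_imp_Liminf[OF _ this, symmetric] show ?case by simp
      qed
    qed
    also have "\<dots> \<le> liminf (\<lambda>i. \<integral>\<^sup>+ p. ennreal ((f n p - f (r i) p)\<^sup>2) \<partial>lebesgue_on S)"
      by (rule nn_integral_liminf) measurable
    also have "\<dots> \<le> limsup (\<lambda>i. \<integral>\<^sup>+ p. ennreal ((f n p - f (r i) p)\<^sup>2) \<partial>lebesgue_on S)"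
      by (rule Liminf_le_Limsup) simp
    also have "\<dots> \<le> ennreal (e\<^sup>2)"
    proof (rule Limsup_bounded, rule eventually_sequentiallyI[of N])
      fix i assume "i \<ge> N"
      then have ri: "r i \<ge> N" using seq_suble[OF r(1), of i] by simp
      have "(\<integral>\<^sup>+ p. ennreal ((f n p - f (r i) p)\<^sup>2) \<partial>lebesgue_on S)
          = ennreal ((norm2 S (\<lambda>p. f n p - f (r i) p))\<^sup>2)"
        unfolding norm2_power2 by (rule nn_integral_eq_integral[OF L2_square_integrable[OF d]]) simp
      also have "\<dots> \<le> ennreal (e\<^sup>2)"
        using N[OF n ri] by (intro ennreal_leI power_mono) auto
      finally show "(\<integral>\<^sup>+ p. ennreal ((f n p - f (r i) p)\<^sup>2) \<partial>lebesgue_on S) \<le> ennreal (e\<^sup>2)" .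
    qed
    finally have le: "(\<integral>\<^sup>+ p. ennreal ((f n p - F p)\<^sup>2) \<partial>lebesgue_on S) \<le> ennreal (e\<^sup>2)" .
    have "integrable (lebesgue_on S) (\<lambda>p. (f n p - F p)\<^sup>2)"
      by (rule integrableI_nonneg) (use le_less_trans[OF le ennreal_less_top] in auto)
    then have L: "(\<lambda>p. f n p - F p) \<in> L2 S" by (simp add: L2_def)
    have "ennreal ((norm2 S (\<lambda>p. f n p - F p))\<^sup>2) \<le> ennreal (e\<^sup>2)"
      unfolding norm2_power2 using le nn_integral_eq_integral[OF L2_square_integrable[OF L]] by simp
    then have "(norm2 S (\<lambda>p. f n p - F p))\<^sup>2 \<le> e\<^sup>2" by (simp add: ennreal_le_iff)
    then have "norm2 S (\<lambda>p. f n p - F p) \<le> e" using e by (auto intro: power2_le_imp_le)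
    with L show ?thesis by blast
  qed
  obtain N where N: "\<And>m n. m \<ge> N \<Longrightarrow> n \<ge> N \<Longrightarrow> norm2 S (\<lambda>p. f m p - f n p) < 1"
    using C[of 1] by auto
  have "(\<lambda>p. f N p - F p) \<in> L2 S" using bound[OF N order_refl] by blast
  from L2_diff[OF f[of N] this] have FL: "F \<in> L2 S" by simp
  have "(\<lambda>n. norm2 S (\<lambda>p. f n p - F p)) \<longlonglongrightarrow> 0"
  proof (rule LIMSEQ_I)
    fix e :: real assume "e > 0"
    then obtain N where "\<And>m n. m \<ge> N \<Longrightarrow> n \<ge> N \<Longrightarrow> norm2 S (\<lambda>p. f m p - f n p) < e / 2"
      using C[of "e/2"] by auto
    from bound[OF this] have "norm2 S (\<lambda>p. f n p - F p) \<le> e / 2" if "n \<ge> N" for n using that by blast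
    with \<open>e > 0\<close> show "\<exists>N. \<forall>n\<ge>N. norm (norm2 S (\<lambda>p. f n p - F p) - 0) < e"
      by (intro exI[of _ N]) fastforce
  qed
  with FL show ?thesis by (rule that)
qed

lemma L2_convergent_imp_Cauchy:
  assumes f: "\<And>n. f n \<in> L2 S" and F: "F \<in> L2 S" and l: "(\<lambda>n. norm2 S (\<lambda>p. f n p - F p)) \<longlonglongrightarrow> 0" and e: "e > 0"
  shows "\<exists>N. \<forall>m\<ge>N. \<forall>n\<ge>N. norm2 S (\<lambda>p. f m p - f n p) < e"
proof -
  obtain N where N: "\<And>n. n \<ge> N \<Longrightarrow> norm2 S (\<lambda>p. f n p - F p) < e / 2"
    using LIMSEQ_D[OF l, of "e/2"] e by auto
  have "norm2 S (\<lambda>p. f m p - f n p) < e" if "m \<ge> N" "n \<ge> N" for m n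
    using norm2_triangle_diff[OF f[of m] F f[of n]] N[OF that(1)] N[OF that(2)] norm2_uminus[of S F "f n"] by simp
  then show ?thesis by blast
qed

section \<open>Weak derivatives on the rectangle\<close>

lemma Basis_real2: "(Basis :: (real \<times> real) set) = {(1, 0), (0, 1)}"
  by (auto simp: Basis_prod_def)

lemma box_real2: "box (a, c) (b, d) = {a<..<b} \<times> {c<..<d::real}" for a b :: real
  by (auto simp: box_def Basis_real2)

lemma cbox_real2: "cbox (a, c) (b, d) = {a..b} \<times> {c..d::real}" for a b :: real
  by (simp add: cbox_Pair_eq)

lemma Omega_cbox: "Omega L = cbox (0, 0) (L, 1)"
  by (simp add: Omega_def cbox_real2)

lemma interior_Omega: "interior (Omega L) = {0<..<L} \<times> {0<..<1}"
  by (simp add: Omega_def interior_Times)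

lemma Omega_lmeasurable: "Omega L \<in> lmeasurable"
  and Omega_sets: "Omega L \<in> sets lebesgue"
  by (simp_all add: Omega_cbox)

lemma measure_Omega: "L > 0 \<Longrightarrow> measure lebesgue (Omega L) = L"
  unfolding Omega_cbox by (simp add: content_Pair)

lemma AE_lebesgue_onI:
  assumes "AE p in lebesgue. P p" "S \<in> sets lebesgue"
  shows "AE p in lebesgue_on S. P p"
proof -
  have "AE p in lebesgue. p \<in> S \<longrightarrow> P p" using assms(1) by eventually_elim simp
  then show ?thesis using assms(2) by (simp add: AE_restrict_space_iff)
qed

lemma AE_in_open_box:
  fixes a b :: "'a::euclidean_space"
  shows "AE p in lebesgue_on (cbox a b). p \<in> box a b"
proof -
  have "cbox a b - box a b \<in> null_sets lebesgue"
    using negligible_frontier_interval[of a b] by (simp add: negligible_iff_null_sets)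
  then have "AE p in lebesgue. p \<notin> cbox a b - box a b" by (rule AE_not_in)
  then show ?thesis by (simp add: AE_restrict_space_iff)
qed

lemma AE_interior_Omega: "AE p in lebesgue_on (Omega L). p \<in> interior (Omega L)"
  using AE_in_open_box[of "(0,0)" "(L,1)"] unfolding Omega_cbox by simp

lemma locally_integrable_L2:
  assumes "u \<in> L2 (Omega L)" shows "locally_integrable (Omega L) u"
  unfolding locally_integrable_def
proof (intro allI impI)
  fix K :: "(real \<times> real) set" assume K: "compact K \<and> K \<subseteq> interior (Omega L)"
  then have Ks: "K \<in> sets lebesgue" "K \<subseteq> Omega L"
    using interior_subset by (auto simp: compact_imp_closed)
  have "integrable lebesgue (\<lambda>x. if x \<in> Omega L then u x else 0)"
    using L2_integrable[OF assms Omega_lmeasurable] by (simp add: Lebesgue_Measure.integrable_restrict_UNIV Omega_sets)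
  from integrable_mult_indicator[OF Ks(1) this]
  have "integrable lebesgue (\<lambda>x. if x \<in> K then u x else 0)"
    by (rule Bochner_Integration.integrable_cong[THEN iffD1, OF refl, rotated])
      (use Ks in \<open>auto simp: indicator_def\<close>)
  then show "integrable (lebesgue_on K) u" by (simp add: Lebesgue_Measure.integrable_restrict_UNIV Ks)
qed

lemma continuous_L2:
  fixes f :: "'a::euclidean_space \<Rightarrow> real"
  assumes "continuous_on (cbox a b) f"
  shows "f \<in> L2 (cbox a b)"
  unfolding L2_def
  using assms continuous_imp_integrable[of a b "\<lambda>p. (f p)\<^sup>2"]
    borel_measurable_integrable[OF continuous_imp_integrable[OF assms]]
  by (auto intro!: continuous_intros)

lemma smooth_L2: "smooth f \<Longrightarrow> f \<in> L2 (Omega L)"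
  unfolding Omega_cbox by (intro continuous_L2 smooth_continuous)

lemma LINT_continuous:
  fixes f :: "'a::euclidean_space \<Rightarrow> real"
  assumes "continuous_on (cbox a b) f"
  shows "(LINT p|lebesgue_on (cbox a b). f p) = integral (cbox a b) f"
  by (intro lebesgue_integral_eq_integral continuous_imp_integrable assms) simp

lemma smooth_measurable:
  assumes "smooth f" shows "f \<in> borel_measurable (lebesgue_on S)"
proof -
  have "f \<in> borel_measurable borel"
    by (intro borel_measurable_continuous_onI smooth_continuous assms)
  then have "f \<in> borel_measurable lebesgue"
    by (intro measurable_completion) simp
  then show ?thesis by (rule measurable_restrict_space1)
qed

lemma test_function_smooth: "test_function S \<phi> \<Longrightarrow> smooth \<phi>"
  by (simp add: test_function_def)

lemma test_function_eq_0:
  assumes "test_function S \<phi>" "p \<notin> interior S" shows "\<phi> p = 0"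
  using assms closure_subset[of "{p. \<phi> p \<noteq> 0}"] by (auto simp: test_function_def)

lemma partial_support:
  "{p. frechet_derivative \<phi> (at p) i \<noteq> 0} \<subseteq> closure {p. \<phi> p \<noteq> 0}"
proof
  fix p assume p: "p \<in> {p. frechet_derivative \<phi> (at p) i \<noteq> 0}"
  show "p \<in> closure {p. \<phi> p \<noteq> 0}"
  proof (rule ccontr)
    assume n: "p \<notin> closure {p. \<phi> p \<noteq> 0}"
    have "(\<phi> has_derivative (\<lambda>h. 0)) (at p)"
    proof (rule has_derivative_transform_within_open[of "\<lambda>_. 0"])
      show "open (- closure {p. \<phi> p \<noteq> 0})" by (simp add: open_Compl)
      show "p \<in> - closure {p. \<phi> p \<noteq> 0}" using n by simp
      show "0 = \<phi> q" if "q \<in> - closure {p. \<phi> p \<noteq> 0}" for q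
        using that closure_subset[of "{p. \<phi> p \<noteq> 0}"] by auto
    qed simp
    from fun_cong[OF frechet_derivative_at[OF this], of i] p show False by simp
  qed
qed

lemma test_function_support_mono:
  assumes t: "test_function S \<phi>" and s: "smooth \<psi>" and sub: "{p. \<psi> p \<noteq> 0} \<subseteq> closure {p. \<phi> p \<noteq> 0}"
  shows "test_function S \<psi>"
proof -
  have cl: "closure {p. \<psi> p \<noteq> 0} \<subseteq> closure {p. \<phi> p \<noteq> 0}"
    by (rule closure_minimal[OF sub]) simp
  have "bounded (closure {p. \<phi> p \<noteq> 0})"
    using t by (simp add: test_function_def compact_imp_bounded)
  then have "compact (closure {p. \<psi> p \<noteq> 0})"
    using sub bounded_subset by (simp add: compact_closure)
  with cl t s show ?thesis
    unfolding test_function_def by blast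
qed

lemma test_function_partial:
  assumes "test_function S \<phi>" "i \<in> Basis"
  shows "test_function S (\<lambda>p. frechet_derivative \<phi> (at p) i)"
  by (rule test_function_support_mono[OF assms(1) _ partial_support])
    (intro smooth_partial test_function_smooth[OF assms(1)] assms(2))

lemma test_function_mult:
  assumes "test_function S \<phi>" "smooth f"
  shows "test_function S (\<lambda>p. f p * \<phi> p)"
proof (rule test_function_support_mono[OF assms(1)])
  show "{p. f p * \<phi> p \<noteq> 0} \<subseteq> closure {p. \<phi> p \<noteq> 0}"
    using closure_subset[of "{p. \<phi> p \<noteq> 0}"] by auto
qed (intro smooth_mult test_function_smooth[OF assms(1)] assms(2))

lemma locally_integrable_test_integrable:
  assumes u: "locally_integrable S u" and t: "test_function S \<phi>" and S: "S \<in> sets lebesgue"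
  shows "integrable (lebesgue_on S) (\<lambda>p. u p * \<phi> p)"
proof -
  define K where "K = closure {p. \<phi> p \<noteq> 0}"
  have K: "compact K" "K \<subseteq> interior S" using t by (auto simp: test_function_def K_def)
  then have KS: "K \<in> sets lebesgue" "K \<subseteq> S" using interior_subset by (auto simp: compact_imp_closed)
  have uK: "integrable (lebesgue_on K) u" using u K by (simp add: locally_integrable_def)
  have "bounded (\<phi> ` K)"
    by (intro compact_imp_bounded compact_continuous_image smooth_continuous[OF test_function_smooth[OF t]] K(1))
  then obtain C where C: "\<And>p. p \<in> K \<Longrightarrow> \<bar>\<phi> p\<bar> \<le> C" unfolding bounded_iff by auto
  have "integrable (lebesgue_on K) (\<lambda>p. u p * \<phi> p)"
  proof (rule Bochner_Integration.integrable_bound)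
    show "integrable (lebesgue_on K) (\<lambda>p. C * u p)" using uK by simp
    show "(\<lambda>p. u p * \<phi> p) \<in> borel_measurable (lebesgue_on K)"
      using borel_measurable_integrable[OF uK] smooth_measurable[OF test_function_smooth[OF t]] by measurable
    show "AE p in lebesgue_on K. norm (u p * \<phi> p) \<le> norm (C * u p)"
    proof (rule AE_I2)
      fix p assume "p \<in> space (lebesgue_on K)"
      then have "\<bar>\<phi> p\<bar> \<le> \<bar>C\<bar>" using C[of p] by simp
      then show "norm (u p * \<phi> p) \<le> norm (C * u p)"
        unfolding real_norm_def abs_mult by (metis abs_ge_zero mult.commute mult_right_mono)
    qed
  qed
  then have "integrable lebesgue (\<lambda>p. if p \<in> K then u p * \<phi> p else 0)"
    by (simp add: Lebesgue_Measure.integrable_restrict_UNIV KS)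
  moreover have "(\<lambda>p. if p \<in> K then u p * \<phi> p else 0) = (\<lambda>p. if p \<in> S then u p * \<phi> p else 0)"
    using KS(2) closure_subset[of "{p. \<phi> p \<noteq> 0}"] by (auto simp: fun_eq_iff K_def)
  ultimately show ?thesis using S by (simp add: Lebesgue_Measure.integrable_restrict_UNIV)
qed

text \<open>Dominated convergence along the cutoffs, which converge to the indicator of the box.\<close>

lemma box_integral_zero:
  assumes d: "locally_integrable (Omega L) d"
    and z: "\<And>\<phi>. test_function (Omega L) \<phi> \<Longrightarrow> (LINT p|lebesgue_on (Omega L). d p * \<phi> p) = 0"
    and Q: "cbox (a, c) (b, e) \<subseteq> interior (Omega L)"
  shows "integral (cbox (a, c) (b, e)) d = 0"
proof -
  let ?Q = "cbox (a, c) (b, e)"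
  have Qs: "?Q \<in> sets lebesgue" "?Q \<subseteq> Omega L" using Q interior_subset by auto
  have dQ: "integrable (lebesgue_on ?Q) d"
    using d Q by (simp add: locally_integrable_def compact_cbox)
  have sub: "{a<..<b} \<times> {c<..<e} \<subseteq> ?Q" unfolding box_real2[symmetric] by (rule box_subset_cbox)
  have zk: "(LINT p|lebesgue_on ?Q. d p * cutoff a b c e k p) = 0" for k
  proof -
    have t: "test_function (Omega L) (cutoff a b c e k)"
      using test_function_mult_cutoff[OF smooth_const[of 1], of a b c e "Omega L" k] sub Qs by simp
    have out: "cutoff a b c e k p = 0" if "p \<notin> ?Q" for p
      using cutoff_support(1)[of a b c e k] closure_subset[of "{p. cutoff a b c e k p \<noteq> 0}"] sub that by blast
    have "0 = (LINT p|lebesgue_on (Omega L). d p * cutoff a b c e k p)" using z[OF t] by simp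
    also have "\<dots> = (LINT p|lebesgue_on (Omega L). (if p \<in> ?Q then d p * cutoff a b c e k p else 0))"
      using out by (intro Bochner_Integration.integral_cong) auto
    also have "\<dots> = (LINT p|lebesgue_on ?Q. d p * cutoff a b c e k p)"
      by (rule integral_restrict[OF Qs(2,1) Omega_sets])
    finally show ?thesis by simp
  qed
  have "(\<lambda>k. LINT p|lebesgue_on ?Q. d p * cutoff a b c e k p) \<longlonglongrightarrow> (LINT p|lebesgue_on ?Q. d p)"
  proof (rule integral_dominated_convergence[where w="\<lambda>p. \<bar>d p\<bar>"])
    show "AE p in lebesgue_on ?Q. (\<lambda>k. d p * cutoff a b c e k p) \<longlonglongrightarrow> d p"
      using AE_in_open_box[of "(a,c)" "(b,e)"]
    proof eventually_elim
      case (elim p)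
      then have "indicator ({a<..<b} \<times> {c<..<e}) p = (1::real)" by (simp add: box_real2)
      then show ?case using tendsto_mult_left[OF cutoff_tendsto[of a b c e p], of "d p"] by simp
    qed
    show "AE p in lebesgue_on ?Q. norm (d p * cutoff a b c e k p) \<le> \<bar>d p\<bar>" for k
      using cutoff_bounds[of a b c e k] by (intro AE_I2) (auto simp: abs_mult intro!: mult_left_le)
    show "(\<lambda>p. d p * cutoff a b c e k p) \<in> borel_measurable (lebesgue_on ?Q)" for k
      using borel_measurable_integrable[OF dQ] smooth_measurable[OF smooth_cutoff] by measurable
  qed (use dQ in \<open>auto intro: borel_measurable_integrable\<close>)
  then have "(LINT p|lebesgue_on ?Q. d p) = 0" by (simp add: zk LIMSEQ_const_iff)
  then show ?thesis using lebesgue_integral_eq_integral[OF dQ Qs(1)] by simp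
qed

text \<open>By Lebesgue differentiation it suffices that all integrals over boxes vanish.\<close>

lemma fundamental_lemma:
  assumes d: "locally_integrable (Omega L) d"
    and z: "\<And>\<phi>. test_function (Omega L) \<phi> \<Longrightarrow> (LINT p|lebesgue_on (Omega L). d p * \<phi> p) = 0"
  shows "AE p in lebesgue_on (Omega L). d p = 0"
proof -
  \<comment> \<open>\<open>d\<close> is integrable on compact subsets of the interior only, which these boxes exhaust.\<close>
  define K :: "nat \<Rightarrow> (real \<times> real) set"
    where "K n = cbox (1 / Suc n, 1 / Suc n) (L - 1 / Suc n, 1 - 1 / Suc n)" for n
  have KI: "K n \<subseteq> interior (Omega L)" for n
  proof -
    have *: "1 / real (Suc n) > 0" by simp
    have "0 < x" if "1 / real (Suc n) \<le> x" for x using * that by linarith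
    moreover have "x < y" if "x \<le> y - 1 / real (Suc n)" for x y using * that by linarith
    ultimately show ?thesis
      unfolding K_def interior_Omega cbox_real2 by (force simp del: of_nat_Suc)
  qed
  have "\<exists>N. negligible N \<and> (\<forall>p \<in> interior (K n) - N. d p = 0)" for n
  proof -
    define g where "g p = (if p \<in> K n then d p else 0)" for p
    have "integrable (lebesgue_on (K n)) d"
      using d KI[of n] by (simp add: locally_integrable_def K_def compact_cbox)
    then have "integrable lebesgue g"
      unfolding g_def by (subst Lebesgue_Measure.integrable_restrict_UNIV) (auto simp: K_def)
    then have "g integrable_on UNIV" by (rule integrable_on_lebesgue)
    then have "g integrable_on cbox a b" for a b
      using integrable_on_subcbox by blast
    then obtain N where N: "negligible N" "\<And>x e. \<lbrakk>x \<notin> N; 0 < e\<rbrakk> \<Longrightarrow>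
        \<exists>r>0. \<forall>h. 0 < h \<and> h < r \<longrightarrow>
          norm (integral (cbox x (x + h *\<^sub>R One)) g /\<^sub>R h ^ DIM(real \<times> real) - g x) < e"
      using integrable_ccontinuous_explicit[of g] by blast
    have "d p = 0" if p: "p \<in> interior (K n)" "p \<notin> N" for p
    proof -
      obtain x y where xy: "p = (x, y)" by (cases p)
      define s where "s = min (L - 1 / Suc n - x) (1 - 1 / Suc n - y)"
      have pK: "1 / Suc n < x" "x < L - 1 / Suc n" "1 / Suc n < y" "y < 1 - 1 / Suc n"
        using p(1) by (auto simp: K_def box_real2 xy)
      then have s: "s > 0" by (simp add: s_def)
      have zero: "integral (cbox p (p + h *\<^sub>R One)) g = 0" if h: "0 < h" "h < s" for h
      proof -
        have One2: "(One :: real \<times> real) = (1, 1)" by (simp add: Basis_real2)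
        have sub: "cbox p (p + h *\<^sub>R One) \<subseteq> K n"
          using h pK unfolding xy One2 K_def s_def by (auto simp: cbox_real2)
        have "integral (cbox p (p + h *\<^sub>R One)) g = integral (cbox p (p + h *\<^sub>R One)) d"
          using sub by (intro Henstock_Kurzweil_Integration.integral_cong) (auto simp: g_def)
        also have "\<dots> = 0"
          using box_integral_zero[OF d z, where a=x and c=y and b="x + h" and e="y + h"] sub KI[of n]
          unfolding xy One2 by simp
        finally show ?thesis .
      qed
      have "\<bar>g p\<bar> < e" if e: "e > 0" for e
      proof -
        obtain r where r: "r > 0" "\<And>h. 0 < h \<Longrightarrow> h < r \<Longrightarrow>
            norm (integral (cbox p (p + h *\<^sub>R One)) g /\<^sub>R h ^ DIM(real \<times> real) - g p) < e"
          using N(2)[OF p(2) e] by blast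
        define h where "h = min r s / 2"
        have "0 < h" "h < r" "h < s" using r(1) s by (auto simp: h_def)
        with r(2)[of h] zero[of h] show ?thesis by simp
      qed
      then have "g p = 0" by (metis abs_ge_zero abs_le_zero_iff less_irrefl not_less)
      moreover have "p \<in> K n" using p(1) interior_subset by blast
      ultimately show ?thesis by (simp add: g_def)
    qed
    with N(1) show ?thesis by blast
  qed
  then obtain N where N: "\<And>n. negligible (N n)" "\<And>n p. p \<in> interior (K n) - N n \<Longrightarrow> d p = 0"
    by metis
  have "(\<Union>n. N n) \<in> null_sets lebesgue"
    using N(1) negligible_iff_null_sets by (intro null_sets_UN) auto
  then have "AE p in lebesgue. p \<notin> (\<Union>n. N n)" by (rule AE_not_in)
  then have "AE p in lebesgue_on (Omega L). p \<notin> (\<Union>n. N n)"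
    by (rule AE_lebesgue_onI[OF _ Omega_sets])
  with AE_interior_Omega[of L] show ?thesis
  proof eventually_elim
    case (elim p)
    obtain x y where xy: "p = (x, y)" by (cases p)
    have "0 < x" "x < L" "0 < y" "y < 1" using elim(1) by (auto simp: interior_Omega xy)
    then have "min (min x (L - x)) (min y (1 - y)) > 0" by simp
    then obtain n where "1 / real (Suc n) < min (min x (L - x)) (min y (1 - y))"
      using nat_approx_posE by blast
    then have "p \<in> interior (K n)" by (auto simp: K_def box_real2 xy)
    with elim(2) N(2)[of p n] show ?case by blast
  qed
qed

text \<open>A relation rather than an operator: limits and linear combinations produce weak derivatives that
  agree with the selected representative only almost everywhere, and in this form the derivative is
  a linear relation that is closed in \<open>L\<^sup>2\<close>.\<close>

definition L2_deriv :: "real \<Rightarrow> real \<times> real \<Rightarrow> (real \<times> real \<Rightarrow> real) \<Rightarrow> (real \<times> real \<Rightarrow> real) \<Rightarrow> bool" where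
  "L2_deriv L i u v \<longleftrightarrow> u \<in> L2 (Omega L) \<and> v \<in> L2 (Omega L) \<and> has_weak_deriv (Omega L) i u v"

lemma L2_deriv_iff:
  "L2_deriv L i u v \<longleftrightarrow> u \<in> L2 (Omega L) \<and> v \<in> L2 (Omega L) \<and>
    (\<forall>\<phi>. test_function (Omega L) \<phi> \<longrightarrow>
        (LINT p|lebesgue_on (Omega L). u p * frechet_derivative \<phi> (at p) i)
          = - (LINT p|lebesgue_on (Omega L). v p * \<phi> p))"
  by (auto simp: L2_deriv_def has_weak_deriv_def locally_integrable_L2)

lemma L2_derivD:
  assumes "L2_deriv L i u v"
  shows "u \<in> L2 (Omega L)" "v \<in> L2 (Omega L)"
    "\<And>\<phi>. test_function (Omega L) \<phi> \<Longrightarrow>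
        (LINT p|lebesgue_on (Omega L). u p * frechet_derivative \<phi> (at p) i)
          = - (LINT p|lebesgue_on (Omega L). v p * \<phi> p)"
  using assms by (auto simp: L2_deriv_iff)

lemma has_weak_deriv_unique:
  assumes "has_weak_deriv (Omega L) i u v" "has_weak_deriv (Omega L) i u w"
  shows "AE p in lebesgue_on (Omega L). v p = w p"
proof -
  have l: "locally_integrable (Omega L) v" "locally_integrable (Omega L) w"
    using assms by (auto simp: has_weak_deriv_def)
  then have "locally_integrable (Omega L) (\<lambda>p. v p - w p)"
    by (auto simp: locally_integrable_def)
  moreover have "(LINT p|lebesgue_on (Omega L). (v p - w p) * \<phi> p) = 0"
    if t: "test_function (Omega L) \<phi>" for \<phi>
    using assms t locally_integrable_test_integrable[OF l(1) t Omega_sets]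
      locally_integrable_test_integrable[OF l(2) t Omega_sets]
    by (auto simp: has_weak_deriv_def left_diff_distrib)
  ultimately have "AE p in lebesgue_on (Omega L). v p - w p = 0"
    by (rule fundamental_lemma)
  then show ?thesis by simp
qed

text \<open>Uniqueness of weak derivatives transfers whatever is known about some derivative to the
  representative that occurs in the energies.\<close>

lemma L2_deriv_weak_deriv:
  assumes "L2_deriv L i u v"
  shows "L2_deriv L i u (weak_deriv (Omega L) i u)"
    "AE p in lebesgue_on (Omega L). weak_deriv (Omega L) i u p = v p"
proof -
  have "has_weak_deriv (Omega L) i u (weak_deriv (Omega L) i u)"
    using assms unfolding weak_deriv_def L2_deriv_def by (metis someI)
  moreover from this assms show "AE p in lebesgue_on (Omega L). weak_deriv (Omega L) i u p = v p"
    by (auto intro: has_weak_deriv_unique simp: L2_deriv_def)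
  then have "AE p in lebesgue_on (Omega L). v p = weak_deriv (Omega L) i u p"
    by eventually_elim simp
  then have "weak_deriv (Omega L) i u \<in> L2 (Omega L)"
    using L2_cong_AE[OF _ Omega_sets] assms by (auto simp: L2_deriv_def)
  ultimately show "L2_deriv L i u (weak_deriv (Omega L) i u)"
    using assms by (auto simp: L2_deriv_def)
qed

lemma test_function_L2: "test_function S \<phi> \<Longrightarrow> \<phi> \<in> L2 (Omega L)"
  by (intro smooth_L2 test_function_smooth)

lemma test_partial_L2:
  "test_function S \<phi> \<Longrightarrow> i \<in> Basis \<Longrightarrow> (\<lambda>p. frechet_derivative \<phi> (at p) i) \<in> L2 (Omega L)"
  by (intro smooth_L2 smooth_partial test_function_smooth)

lemma L2_deriv_linear:
  assumes "L2_deriv L i u v" "L2_deriv L i u' v'" "i \<in> Basis"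
  shows "L2_deriv L i (\<lambda>p. a * u p + b * u' p) (\<lambda>p. a * v p + b * v' p)"
  unfolding L2_deriv_iff
proof (intro conjI allI impI)
  note D = assms(1,2)[THEN L2_derivD(1)] assms(1,2)[THEN L2_derivD(2)]
  show "(\<lambda>p. a * u p + b * u' p) \<in> L2 (Omega L)" "(\<lambda>p. a * v p + b * v' p) \<in> L2 (Omega L)"
    by (intro L2_add L2_scale D)+
  fix \<phi> assume t: "test_function (Omega L) \<phi>"
  let ?M = "lebesgue_on (Omega L)" and ?d = "\<lambda>p. frechet_derivative \<phi> (at p) i"
  have *: "(LINT p|?M. (a * f p + b * g p) * h p) = a * (LINT p|?M. f p * h p) + b * (LINT p|?M. g p * h p)"
    if "f \<in> L2 (Omega L)" "g \<in> L2 (Omega L)" "h \<in> L2 (Omega L)" for f g h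
    using L2_mult_integrable[OF that(1,3)] L2_mult_integrable[OF that(2,3)]
    by (simp add: distrib_right mult.assoc)
  show "(LINT p|?M. (a * u p + b * u' p) * ?d p) = - (LINT p|?M. (a * v p + b * v' p) * \<phi> p)"
    unfolding *[OF D(1,2) test_partial_L2[OF t assms(3)]] *[OF D(3,4) test_function_L2[OF t]]
    using L2_derivD(3)[OF assms(1) t] L2_derivD(3)[OF assms(2) t] by simp
qed

lemma L2_deriv_cong_AE:
  assumes "L2_deriv L i u v" "i \<in> Basis"
    "AE p in lebesgue_on (Omega L). u p = u' p" "AE p in lebesgue_on (Omega L). v p = v' p"
  shows "L2_deriv L i u' v'"
  unfolding L2_deriv_iff
proof (intro conjI allI impI)
  note D = L2_derivD[OF assms(1)]
  show u': "u' \<in> L2 (Omega L)" and v': "v' \<in> L2 (Omega L)"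
    using D assms(3,4) L2_cong_AE[OF _ Omega_sets] by auto
  fix \<phi> assume t: "test_function (Omega L) \<phi>"
  let ?M = "lebesgue_on (Omega L)" and ?d = "\<lambda>p. frechet_derivative \<phi> (at p) i"
  have [measurable]: "u \<in> borel_measurable ?M" "v \<in> borel_measurable ?M" "u' \<in> borel_measurable ?M"
    "v' \<in> borel_measurable ?M" "\<phi> \<in> borel_measurable ?M" "?d \<in> borel_measurable ?M"
    by (intro L2_measurable D u' v' test_function_L2[OF t] test_partial_L2[OF t assms(2)])+
  have "(LINT p|?M. u' p * ?d p) = (LINT p|?M. u p * ?d p)"
    by (intro integral_cong_AE) (use assms(3) in \<open>auto elim: AE_mp\<close>)
  moreover have "(LINT p|?M. v' p * \<phi> p) = (LINT p|?M. v p * \<phi> p)"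
    by (intro integral_cong_AE) (use assms(4) in \<open>auto elim: AE_mp\<close>)
  ultimately show "(LINT p|?M. u' p * ?d p) = - (LINT p|?M. v' p * \<phi> p)" using D(3)[OF t] by simp
qed

lemma L2_deriv_limit:
  assumes "\<And>n. L2_deriv L i (u n) (v n)" "i \<in> Basis" "U \<in> L2 (Omega L)" "V \<in> L2 (Omega L)"
    "(\<lambda>n. norm2 (Omega L) (\<lambda>p. u n p - U p)) \<longlonglongrightarrow> 0"
    "(\<lambda>n. norm2 (Omega L) (\<lambda>p. v n p - V p)) \<longlonglongrightarrow> 0"
  shows "L2_deriv L i U V"
  unfolding L2_deriv_iff
proof (intro conjI allI impI assms)
  note D = L2_derivD[OF assms(1)]
  fix \<phi> assume t: "test_function (Omega L) \<phi>"
  let ?M = "lebesgue_on (Omega L)" and ?d = "\<lambda>p. frechet_derivative \<phi> (at p) i"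
  have "(\<lambda>n. LINT p|?M. u n p * ?d p) \<longlonglongrightarrow> (LINT p|?M. U p * ?d p)"
    by (intro L2_inner_tendsto D assms test_partial_L2[OF t])
  moreover have "(\<lambda>n. - (LINT p|?M. v n p * \<phi> p)) \<longlonglongrightarrow> - (LINT p|?M. V p * \<phi> p)"
    by (intro tendsto_minus L2_inner_tendsto D assms test_function_L2[OF t])
  ultimately show "(LINT p|?M. U p * ?d p) = - (LINT p|?M. V p * \<phi> p)"
    unfolding D(3)[OF t] by (rule LIMSEQ_unique)
qed

lemma W12_iff:
  "u \<in> W12 (Omega L) \<longleftrightarrow> (\<exists>v. L2_deriv L (1, 0) u v) \<and> (\<exists>v. L2_deriv L (0, 1) u v)"
  by (auto simp: W12_def L2_deriv_def Basis_real2)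

subsection \<open>Classical derivatives are weak derivatives\<close>

lemma smooth_DERIV_x:
  fixes f :: "real \<times> real \<Rightarrow> real"
  assumes "smooth f"
  shows "((\<lambda>t. f (t, y)) has_real_derivative frechet_derivative f (at (t, y)) (1, 0)) (at t)"
  using smooth_has_real_derivative_line[OF assms, of "(0, y)" "(1, 0)" t] by simp

lemma smooth_DERIV_y:
  fixes f :: "real \<times> real \<Rightarrow> real"
  assumes "smooth f"
  shows "((\<lambda>t. f (x, t)) has_real_derivative frechet_derivative f (at (x, t)) (0, 1)) (at t)"
  using smooth_has_real_derivative_line[OF assms, of "(x, 0)" "(0, 1)" t] by simp

lemma smooth_FTC_x:
  fixes f :: "real \<times> real \<Rightarrow> real"
  assumes "smooth f" "a \<le> b"
  shows "((\<lambda>t. frechet_derivative f (at (t, y)) (1, 0)) has_integral f (b, y) - f (a, y)) {a..b}"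
  using fundamental_theorem_of_calculus[OF assms(2), of "\<lambda>t. f (t, y)"]
    smooth_DERIV_x[OF assms(1), THEN has_field_derivative_at_within]
  by (simp add: has_real_derivative_iff_has_vector_derivative)

lemma smooth_FTC_y:
  fixes f :: "real \<times> real \<Rightarrow> real"
  assumes "smooth f" "a \<le> b"
  shows "((\<lambda>t. frechet_derivative f (at (x, t)) (0, 1)) has_integral f (x, b) - f (x, a)) {a..b}"
  using fundamental_theorem_of_calculus[OF assms(2), of "\<lambda>t. f (x, t)"]
    smooth_DERIV_y[OF assms(1), THEN has_field_derivative_at_within]
  by (simp add: has_real_derivative_iff_has_vector_derivative)

lemma iterated_integral:
  fixes f :: "real \<times> real \<Rightarrow> real"
  assumes "continuous_on UNIV f"
  shows "integral (cbox (a, c) (b, d)) f = integral {a..b} (\<lambda>x. integral {c..d} (\<lambda>y. f (x, y)))"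
    "integral (cbox (a, c) (b, d)) f = integral {c..d} (\<lambda>y. integral {a..b} (\<lambda>x. f (x, y)))"
proof -
  have c: "continuous_on (cbox (a, c) (b, d)) f" using assms continuous_on_subset by blast
  from integral_prod_continuous[OF this]
  show 1: "integral (cbox (a, c) (b, d)) f = integral {a..b} (\<lambda>x. integral {c..d} (\<lambda>y. f (x, y)))"
    by simp
  have "continuous_on (cbox (a, c) (b, d)) (\<lambda>(x, y). f (x, y))" using c by simp
  from integral_swap_continuous[OF this] 1
  show "integral (cbox (a, c) (b, d)) f = integral {c..d} (\<lambda>y. integral {a..b} (\<lambda>x. f (x, y)))"
    by simp
qed

lemma test_integral_partial:
  assumes t: "test_function (Omega L) \<psi>" and i: "i \<in> Basis" and L: "L > 0"
  shows "(LINT p|lebesgue_on (Omega L). frechet_derivative \<psi> (at p) i) = 0"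
proof -
  let ?d = "\<lambda>p. frechet_derivative \<psi> (at p) i"
  note s = test_function_smooth[OF t]
  have c: "continuous_on A ?d" for A by (intro smooth_continuous smooth_partial s i)
  have 0: "\<psi> (x, y) = 0" if "x \<le> 0 \<or> x \<ge> L \<or> y \<le> 0 \<or> y \<ge> 1" for x y
    using that by (intro test_function_eq_0[OF t]) (auto simp: interior_Omega)
  have "integral (cbox (0, 0) (L, 1)) ?d = 0"
  proof (cases "i = (1, 0)")
    case True
    have "integral {0..L} (\<lambda>x. frechet_derivative \<psi> (at (x, y)) (1, 0)) = 0" for y
      using integral_unique[OF smooth_FTC_x[OF s, of 0 L y]] L by (simp add: 0)
    then show ?thesis
      using iterated_integral(2)[OF c, of 0 0 L 1] unfolding True by simp
  next
    case False
    then have i: "i = (0, 1)" using i by (auto simp: Basis_real2)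
    have "integral {0..1} (\<lambda>y. frechet_derivative \<psi> (at (x, y)) (0, 1)) = 0" for x
      using integral_unique[OF smooth_FTC_y[OF s, of 0 1 x]] by (simp add: 0)
    then show ?thesis
      using iterated_integral(1)[OF c, of 0 0 L 1] unfolding i by simp
  qed
  then show ?thesis unfolding Omega_cbox LINT_continuous[OF c] .
qed

text \<open>Integration by parts: the product of \<open>f\<close> with a test function is again a test function, and its
  derivatives have integral zero.\<close>

lemma smooth_L2_deriv:
  assumes s: "smooth f" and i: "i \<in> Basis" and L: "L > 0"
  shows "L2_deriv L i f (\<lambda>p. frechet_derivative f (at p) i)"
  unfolding L2_deriv_iff
proof (intro conjI allI impI smooth_L2 smooth_partial s i)
  fix \<phi> assume t: "test_function (Omega L) \<phi>"
  let ?M = "lebesgue_on (Omega L)"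
  note st = test_function_smooth[OF t]
  have "0 = (LINT p|?M. f p * frechet_derivative \<phi> (at p) i + frechet_derivative f (at p) i * \<phi> p)"
    using test_integral_partial[OF test_function_mult[OF t s] i L] by (simp add: partial_mult[OF s st])
  also have "\<dots> = (LINT p|?M. f p * frechet_derivative \<phi> (at p) i) + (LINT p|?M. frechet_derivative f (at p) i * \<phi> p)"
    by (intro Bochner_Integration.integral_add L2_mult_integrable smooth_L2 smooth_partial s st i)
  finally show "(LINT p|?M. f p * frechet_derivative \<phi> (at p) i) = - (LINT p|?M. frechet_derivative f (at p) i * \<phi> p)"
    by simp
qed

section \<open>Inequalities for smooth functions on rectangles\<close>

lemma norm2_continuous:
  fixes f :: "'a::euclidean_space \<Rightarrow> real"
  assumes "continuous_on (cbox a b) f"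
  shows "(norm2 (cbox a b) f)\<^sup>2 = integral (cbox a b) (\<lambda>p. (f p)\<^sup>2)"
  unfolding norm2_power2 by (intro LINT_continuous continuous_intros assms)

lemma continuous_integrable_cbox:
  fixes f :: "'a::euclidean_space \<Rightarrow> real"
  shows "continuous_on UNIV f \<Longrightarrow> f integrable_on cbox a b"
  by (rule integrable_continuous) (rule continuous_on_subset[of UNIV], auto)

lemma integral_square_le:
  fixes g :: "'a::euclidean_space \<Rightarrow> real"
  assumes g: "continuous_on UNIV g"
  shows "(integral (cbox a b) g)\<^sup>2 \<le> measure lebesgue (cbox a b) * integral (cbox a b) (\<lambda>p. (g p)\<^sup>2)"
proof -
  have c: "continuous_on (cbox a b) g" using g continuous_on_subset by blast
  have "\<bar>LINT p|lebesgue_on (cbox a b). g p * 1\<bar> \<le> norm2 (cbox a b) g * norm2 (cbox a b) (\<lambda>p. 1)"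
    by (intro L2_Cauchy_Schwarz continuous_L2 c continuous_intros)
  then have "\<bar>integral (cbox a b) g\<bar> \<le> norm2 (cbox a b) g * norm2 (cbox a b) (\<lambda>p. 1)"
    using LINT_continuous[OF c] by simp
  then have "(integral (cbox a b) g)\<^sup>2 \<le> (norm2 (cbox a b) g * norm2 (cbox a b) (\<lambda>p. 1))\<^sup>2"
    by (metis abs_ge_zero power2_abs power_mono)
  also have "\<dots> = measure lebesgue (cbox a b) * integral (cbox a b) (\<lambda>p. (g p)\<^sup>2)"
    unfolding power_mult_distrib norm2_continuous[OF c]
    by (subst norm2_continuous) (auto intro: continuous_intros)
  finally show ?thesis .
qed

lemma increment_square_le:
  fixes F F' :: "real \<Rightarrow> real"
  assumes D: "\<And>t. (F has_real_derivative F' t) (at t)" and c: "continuous_on UNIV F'"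
    and s: "s \<in> {a..b}" and t: "t \<in> {a..b}"
  shows "(F s - F t)\<^sup>2 \<le> (b - a) * integral {a..b} (\<lambda>x. (F' x)\<^sup>2)"
proof -
  have *: "(F v - F u)\<^sup>2 \<le> (b - a) * integral {a..b} (\<lambda>x. (F' x)\<^sup>2)"
    if "a \<le> u" "u \<le> v" "v \<le> b" for u v
  proof -
    have c2: "continuous_on A (\<lambda>x. (F' x)\<^sup>2)" for A
      by (intro continuous_intros continuous_on_subset[OF c]) auto
    have "(F' has_integral F v - F u) {u..v}"
      using that D by (intro fundamental_theorem_of_calculus)
        (auto simp: has_real_derivative_iff_has_vector_derivative[symmetric] intro: has_field_derivative_at_within)
    then have "(F v - F u)\<^sup>2 = (integral (cbox u v) F')\<^sup>2"
      by (simp add: integral_unique)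
    also have "\<dots> \<le> measure lebesgue (cbox u v) * integral (cbox u v) (\<lambda>x. (F' x)\<^sup>2)"
      by (rule integral_square_le[OF c])
    also have "\<dots> \<le> (b - a) * integral {a..b} (\<lambda>x. (F' x)\<^sup>2)"
    proof (intro mult_mono)
      show "integral (cbox u v) (\<lambda>x. (F' x)\<^sup>2) \<le> integral {a..b} (\<lambda>x. (F' x)\<^sup>2)"
        using that by (intro integral_subset_le integrable_continuous integrable_continuous_real c2) auto
      show "0 \<le> integral (cbox u v) (\<lambda>x. (F' x)\<^sup>2)"
        by (intro integral_nonneg integrable_continuous c2) auto
    qed (use that in auto)
    finally show ?thesis .
  qed
  show ?thesis
    using *[of s t] *[of t s] s t by (cases "s \<le> t") (auto simp: power2_commute)
qed

text \<open>Functions of both variables although constant in one of them: pointwise bounds on increments can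
  then be integrated over the rectangle directly.\<close>

definition slice_x :: "real \<Rightarrow> real \<Rightarrow> (real \<times> real \<Rightarrow> real) \<Rightarrow> real \<times> real \<Rightarrow> real" where
  "slice_x a b g p = integral {a..b} (\<lambda>s. g (s, snd p))"

definition slice_y :: "real \<Rightarrow> real \<Rightarrow> (real \<times> real \<Rightarrow> real) \<Rightarrow> real \<times> real \<Rightarrow> real" where
  "slice_y c d g p = integral {c..d} (\<lambda>t. g (fst p, t))"

lemma continuous_slice:
  assumes g: "continuous_on UNIV g"
  shows "continuous_on UNIV (slice_x a b g)" "continuous_on UNIV (slice_y c d g)"
proof -
  have "continuous_on (UNIV \<times> cbox a b) (\<lambda>(p, s). g (s, snd p))"
    unfolding case_prod_beta by (intro continuous_on_compose2[OF g] continuous_intros) auto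
  from integral_continuous_on_param[OF this]
  show "continuous_on UNIV (slice_x a b g)" by (simp add: slice_x_def[abs_def])
  have "continuous_on (UNIV \<times> cbox c d) (\<lambda>(p, s). g (fst p, s))"
    unfolding case_prod_beta by (intro continuous_on_compose2[OF g] continuous_intros) auto
  from integral_continuous_on_param[OF this]
  show "continuous_on UNIV (slice_y c d g)" by (simp add: slice_y_def[abs_def])
qed

lemma integral_slice:
  assumes g: "continuous_on UNIV g" and ab: "a \<le> b" "c \<le> d"
  shows "integral (cbox (a, c) (b, d)) (slice_x a b g) = (b - a) * integral (cbox (a, c) (b, d)) g"
    "integral (cbox (a, c) (b, d)) (slice_y c d g) = (d - c) * integral (cbox (a, c) (b, d)) g"
  using ab unfolding iterated_integral(1)[OF continuous_slice(1)[OF g]] iterated_integral(2)[OF g]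
    iterated_integral(2)[OF continuous_slice(2)[OF g]] 
  by (simp_all add: slice_x_def slice_y_def iterated_integral(2)[OF g, symmetric] iterated_integral(1)[OF g, symmetric])

abbreviation (input) part_x :: "(real \<times> real \<Rightarrow> real) \<Rightarrow> real \<times> real \<Rightarrow> real" where
  "part_x f \<equiv> \<lambda>p. frechet_derivative f (at p) (1, 0)"

abbreviation (input) part_y :: "(real \<times> real \<Rightarrow> real) \<Rightarrow> real \<times> real \<Rightarrow> real" where
  "part_y f \<equiv> \<lambda>p. frechet_derivative f (at p) (0, 1)"

lemma Basis_xy [simp]: "(1, 0) \<in> (Basis :: (real \<times> real) set)" "(0, 1) \<in> (Basis :: (real \<times> real) set)"
  by (auto simp: Basis_real2)

lemma continuous_part_square:
  assumes "smooth f" "i \<in> Basis"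
  shows "continuous_on A (\<lambda>p. (frechet_derivative f (at p) i)\<^sup>2)"
  by (intro continuous_intros smooth_continuous smooth_partial assms)

lemma smooth_increment_x:
  fixes f :: "real \<times> real \<Rightarrow> real"
  assumes f: "smooth f" and "x \<in> {a..b}" "x' \<in> {a..b}"
  shows "(f (x, y) - f (x', y))\<^sup>2 \<le> (b - a) * slice_x a b (\<lambda>p. (part_x f p)\<^sup>2) (z, y)"
  unfolding slice_x_def snd_conv
  by (rule increment_square_le[OF smooth_DERIV_x[OF f] _ assms(2,3)])
    (intro continuous_on_compose2[OF smooth_continuous[OF smooth_partial[OF f]]] continuous_intros; auto)

lemma smooth_increment_y:
  fixes f :: "real \<times> real \<Rightarrow> real"
  assumes f: "smooth f" and "y \<in> {c..d}" "y' \<in> {c..d}"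
  shows "(f (x, y) - f (x, y'))\<^sup>2 \<le> (d - c) * slice_y c d (\<lambda>p. (part_y f p)\<^sup>2) (x, z)"
  unfolding slice_y_def fst_conv
  by (rule increment_square_le[OF smooth_DERIV_y[OF f] _ assms(2,3)])
    (intro continuous_on_compose2[OF smooth_continuous[OF smooth_partial[OF f]]] continuous_intros; auto)

lemma square_le_double:
  fixes u v w :: real
  assumes "(u - v)\<^sup>2 \<le> w" shows "u\<^sup>2 \<le> 2 * v\<^sup>2 + 2 * w"
proof -
  have "0 \<le> (u - 2 * v)\<^sup>2" by simp
  then show ?thesis using assms by (simp add: power2_eq_square algebra_simps)
qed

lemma smooth_poincare_left:
  assumes f: "smooth f" and L: "L > 0"
  shows "(norm2 (Omega L) f)\<^sup>2
     \<le> 2 * L * (norm2 {0..1} (\<lambda>y. f (0, y)))\<^sup>2 + 2 * L\<^sup>2 * (norm2 (Omega L) (part_x f))\<^sup>2"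
proof -
  let ?Q = "cbox (0, 0) (L, 1)" and ?h = "slice_x 0 L (\<lambda>p. (part_x f p)\<^sup>2)"
  have cf: "continuous_on A f" for A by (rule smooth_continuous[OF f])
  note cx = continuous_part_square[OF f Basis_xy(1)]
  note ch = continuous_slice(1)[OF cx, of 0 L]
  have c0: "continuous_on UNIV (\<lambda>p::real \<times> real. (f (0, snd p))\<^sup>2)"
    by (intro continuous_intros continuous_on_compose2[OF cf[of UNIV]]) auto
  have c0': "continuous_on UNIV (\<lambda>y. f (0, y))"
    by (intro continuous_on_compose2[OF cf[of UNIV]] continuous_intros) auto
  have "(norm2 (Omega L) f)\<^sup>2 = integral ?Q (\<lambda>p. (f p)\<^sup>2)"
    unfolding Omega_cbox by (rule norm2_continuous[OF cf])
  also have "\<dots> \<le> integral ?Q (\<lambda>p. 2 * (f (0, snd p))\<^sup>2 + 2 * (L * ?h p))"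
  proof (rule integral_le)
    fix p :: "real \<times> real" assume "p \<in> ?Q"
    then have "(f (fst p, snd p) - f (0, snd p))\<^sup>2 \<le> (L - 0) * ?h (fst p, snd p)"
      by (intro smooth_increment_x[OF f]) (auto simp: cbox_real2)
    then show "(f p)\<^sup>2 \<le> 2 * (f (0, snd p))\<^sup>2 + 2 * (L * ?h p)"
      by (intro square_le_double) simp
  qed (intro continuous_integrable_cbox continuous_intros cf ch c0)+
  also have "\<dots> = 2 * integral ?Q (\<lambda>p. (f (0, snd p))\<^sup>2) + 2 * (L * integral ?Q ?h)"
    by (subst Henstock_Kurzweil_Integration.integral_add)
      (simp_all add: continuous_integrable_cbox c0 ch continuous_intros)
  also have "integral ?Q (\<lambda>p. (f (0, snd p))\<^sup>2) = L * (norm2 {0..1} (\<lambda>y. f (0, y)))\<^sup>2"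
    using norm2_continuous[OF continuous_on_subset[OF c0'], of 0 1] L
    unfolding iterated_integral(1)[OF c0] by simp
  also have "integral ?Q ?h = L * (norm2 (Omega L) (part_x f))\<^sup>2"
    using norm2_continuous[OF smooth_continuous[OF smooth_partial[OF f Basis_xy(1)]], of "(0,0)" "(L,1)"] L
    by (simp add: integral_slice(1)[OF cx] Omega_cbox)
  finally show ?thesis by (simp add: power2_eq_square algebra_simps)
qed

lemma smooth_trace_inequality:
  assumes f: "smooth f" and L: "L > 0" and z: "z \<in> {0..1}"
  shows "(norm2 {0..L} (\<lambda>x. f (x, z)))\<^sup>2
     \<le> 2 * (norm2 (Omega L) f)\<^sup>2 + 2 * (norm2 (Omega L) (part_y f))\<^sup>2"
proof -
  let ?Q = "cbox (0, 0) (L, 1)" and ?h = "slice_y 0 1 (\<lambda>p. (part_y f p)\<^sup>2)"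
  have cf: "continuous_on A f" for A by (rule smooth_continuous[OF f])
  have cf2: "continuous_on UNIV (\<lambda>p. (f p)\<^sup>2)" by (intro continuous_intros cf)
  note cy = continuous_part_square[OF f Basis_xy(2)]
  note ch = continuous_slice(2)[OF cy, of 0 1]
  have c0: "continuous_on UNIV (\<lambda>p::real \<times> real. (f (fst p, z))\<^sup>2)"
    by (intro continuous_intros continuous_on_compose2[OF cf[of UNIV]]) auto
  have c0': "continuous_on UNIV (\<lambda>x. f (x, z))"
    by (intro continuous_on_compose2[OF cf[of UNIV]] continuous_intros) auto
  have "(norm2 {0..L} (\<lambda>x. f (x, z)))\<^sup>2 = integral ?Q (\<lambda>p::real \<times> real. (f (fst p, z))\<^sup>2)"
    using norm2_continuous[OF continuous_on_subset[OF c0'], of 0 L]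
    unfolding iterated_integral(2)[OF c0] by simp
  also have "\<dots> \<le> integral ?Q (\<lambda>p. 2 * (f p)\<^sup>2 + 2 * ?h p)"
  proof (rule integral_le)
    fix p :: "real \<times> real" assume "p \<in> ?Q"
    then have "(f (fst p, z) - f (fst p, snd p))\<^sup>2 \<le> (1 - 0) * ?h (fst p, snd p)"
      using z by (intro smooth_increment_y[OF f]) (auto simp: cbox_real2)
    then show "(f (fst p, z))\<^sup>2 \<le> 2 * (f p)\<^sup>2 + 2 * ?h p"
      by (intro square_le_double) simp
  qed (intro continuous_integrable_cbox continuous_intros cf ch c0)+
  also have "\<dots> = 2 * integral ?Q (\<lambda>p. (f p)\<^sup>2) + 2 * integral ?Q ?h"
    by (subst Henstock_Kurzweil_Integration.integral_add)
      (simp_all add: continuous_integrable_cbox cf2 ch continuous_intros)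
  also have "integral ?Q (\<lambda>p. (f p)\<^sup>2) = (norm2 (Omega L) f)\<^sup>2"
    unfolding Omega_cbox by (rule norm2_continuous[OF cf, symmetric])
  also have "integral ?Q ?h = (norm2 (Omega L) (part_y f))\<^sup>2"
    using norm2_continuous[OF smooth_continuous[OF smooth_partial[OF f Basis_xy(2)]], of "(0,0)" "(L,1)"] L
    by (simp add: integral_slice(2)[OF cy] Omega_cbox)
  finally show ?thesis .
qed

text \<open>Compare \<open>f\<close> at \<open>(x, y)\<close> and \<open>(x', y')\<close> through the corner \<open>(x', y)\<close>. The integral of \<open>(f p - f q)\<^sup>2\<close>
  over \<open>q\<close> and then over \<open>p\<close> equals \<open>2 |Q| \<integral> f\<^sup>2 - 2 (\<integral> f)\<^sup>2\<close>.\<close>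

lemma smooth_poincare_cell:
  assumes f: "smooth f" and ab: "a < b" "c < d"
  defines "Q \<equiv> cbox (a, c) (b, d)"
  shows "integral Q (\<lambda>p. (f p)\<^sup>2) \<le> (integral Q f)\<^sup>2 / ((b - a) * (d - c))
     + (b - a)\<^sup>2 * integral Q (\<lambda>p. (part_x f p)\<^sup>2) + (d - c)\<^sup>2 * integral Q (\<lambda>p. (part_y f p)\<^sup>2)"
proof -
  let ?G = "slice_x a b (\<lambda>p. (part_x f p)\<^sup>2)" and ?H = "slice_y c d (\<lambda>p. (part_y f p)\<^sup>2)"
  let ?m = "(b - a) * (d - c)"
  let ?I = "integral Q f" and ?J = "integral Q (\<lambda>p. (f p)\<^sup>2)"
  have m: "?m > 0" using ab by simp
  have cf: "continuous_on UNIV f" by (rule smooth_continuous[OF f])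
  have cf2: "continuous_on UNIV (\<lambda>p. (f p)\<^sup>2)" by (intro continuous_intros cf)
  note cx = continuous_part_square[OF f Basis_xy(1)] and cy = continuous_part_square[OF f Basis_xy(2)]
  note cG = continuous_slice(1)[OF cx, of a b] and cH = continuous_slice(2)[OF cy, of c d]
  have int: "g integrable_on Q" if "continuous_on UNIV g" for g :: "real \<times> real \<Rightarrow> real"
    unfolding Q_def by (rule continuous_integrable_cbox[OF that])
  have const: "integral Q (\<lambda>q. k) = ?m * k" for k :: real
    unfolding Q_def using ab by (simp add: content_Pair)
  have 1: "?m * (f p)\<^sup>2 - 2 * f p * ?I + ?J \<le> 2 * (b - a) * ?m * ?G p + 2 * (d - c) * integral Q ?H"
    if p: "p \<in> Q" for p
  proof -
    have "?m * (f p)\<^sup>2 - 2 * f p * ?I + ?J = integral Q (\<lambda>q. (f p)\<^sup>2 - 2 * f p * f q + (f q)\<^sup>2)"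
      by (simp add: Henstock_Kurzweil_Integration.integral_add Henstock_Kurzweil_Integration.integral_diff
          int cf cf2 continuous_intros const)
    also have "\<dots> \<le> integral Q (\<lambda>q. 2 * (b - a) * ?G p + 2 * (d - c) * ?H q)"
    proof (rule integral_le)
      fix q assume q: "q \<in> Q"
      obtain x y where P: "p = (x, y)" by (cases p)
      obtain x' y' where Qq: "q = (x', y')" by (cases q)
      have "(f (x, y) - f (x', y))\<^sup>2 \<le> (b - a) * ?G (x, y)"
        using p q by (intro smooth_increment_x[OF f]) (auto simp: Q_def cbox_real2 P Qq)
      moreover have "(f (x', y) - f (x', y'))\<^sup>2 \<le> (d - c) * ?H (x', y')"
        using p q by (intro smooth_increment_y[OF f]) (auto simp: Q_def cbox_real2 P Qq)
      moreover have "(f p - f q)\<^sup>2 \<le> 2 * (f (x, y) - f (x', y))\<^sup>2 + 2 * (f (x', y) - f (x', y'))\<^sup>2"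
        using square_le_double[of "f p - f q" "f (x, y) - f (x', y)", OF order_refl] by (simp add: P Qq)
      ultimately have "(f p - f q)\<^sup>2 \<le> 2 * ((b - a) * ?G p) + 2 * ((d - c) * ?H q)"
        unfolding P Qq by linarith
      then show "(f p)\<^sup>2 - 2 * f p * f q + (f q)\<^sup>2 \<le> 2 * (b - a) * ?G p + 2 * (d - c) * ?H q"
        by (simp add: power2_diff algebra_simps)
    qed (intro int continuous_intros cf cH)+
    also have "\<dots> = ?m * (2 * (b - a) * ?G p) + 2 * (d - c) * integral Q ?H"
      by (simp add: Henstock_Kurzweil_Integration.integral_add int cH continuous_intros const)
    finally show ?thesis by (simp add: algebra_simps)
  qed
  have "2 * ?m * ?J - 2 * ?I\<^sup>2 = integral Q (\<lambda>p. ?m * (f p)\<^sup>2 - 2 * ?I * f p + ?J)"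
    by (simp add: Henstock_Kurzweil_Integration.integral_add Henstock_Kurzweil_Integration.integral_diff
          int cf cf2 continuous_intros const power2_eq_square)
  also have "\<dots> \<le> integral Q (\<lambda>p. 2 * (b - a) * ?m * ?G p + 2 * (d - c) * integral Q ?H)"
    using 1 by (intro integral_le int continuous_intros cf cG) (auto simp: mult_ac)
  also have "\<dots> = 2 * (b - a) * ?m * integral Q ?G + ?m * (2 * (d - c) * integral Q ?H)"
    by (simp add: Henstock_Kurzweil_Integration.integral_add int cG continuous_intros const)
  also have "integral Q ?G = (b - a) * integral Q (\<lambda>p. (part_x f p)\<^sup>2)"
    unfolding Q_def using ab by (intro integral_slice cx) auto
  also have "integral Q ?H = (d - c) * integral Q (\<lambda>p. (part_y f p)\<^sup>2)"
    unfolding Q_def using ab by (intro integral_slice cy) auto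
  finally have fin: "2 * ?m * ?J - 2 * ?I\<^sup>2 \<le> 2 * (b - a) * ?m * ((b - a) * integral Q (\<lambda>p. (part_x f p)\<^sup>2))
      + ?m * (2 * (d - c) * ((d - c) * integral Q (\<lambda>p. (part_y f p)\<^sup>2)))" .
  have "J \<le> I / m + p\<^sup>2 * X + q\<^sup>2 * Y"
    if "m > 0" "2 * m * J - 2 * I \<le> 2 * p * m * (p * X) + m * (2 * q * (q * Y))" for m J I p q X Y :: real
    using that by (simp add: field_simps power2_eq_square)
  from this[OF m fin] show ?thesis .
qed

section \<open>Rellich compactness\<close>

lemma integral_uniform_partition:
  fixes f :: "real \<Rightarrow> real"
  assumes "continuous_on UNIV f" "h \<ge> 0"
  shows "integral {0..real m * h} f = (\<Sum>i<m. integral {real i * h..real (Suc i) * h} f)"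
proof (induction m)
  case (Suc m)
  have "integral {0..real m * h} f + integral {real m * h..real (Suc m) * h} f = integral {0..real (Suc m) * h} f"
    using assms by (intro Henstock_Kurzweil_Integration.integral_combine integrable_continuous_real)
      (auto intro: continuous_on_subset mult_right_mono)
  with Suc show ?case by simp
qed simp

definition cell :: "real \<Rightarrow> nat \<Rightarrow> nat \<Rightarrow> nat \<Rightarrow> (real \<times> real) set" where
  "cell L K i j = cbox (real i * (L / K), real j * (1 / K)) (real (Suc i) * (L / K), real (Suc j) * (1 / K))"

lemma integral_cells:
  fixes f :: "real \<times> real \<Rightarrow> real"
  assumes f: "continuous_on UNIV f" and K: "K > 0" and L: "L > 0"
  shows "integral (Omega L) f = (\<Sum>i<K. \<Sum>j<K. integral (cell L K i j) f)"
proof -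
  have eq: "real K * (L / K) = L" "real K * (1 / K) = 1" using K by auto
  have sl: "continuous_on UNIV (\<lambda>x. integral {c..d} (\<lambda>y. f (x, y)))" for c d
  proof -
    have "continuous_on UNIV (\<lambda>x. slice_y c d f (x, 0))"
      by (intro continuous_on_compose2[OF continuous_slice(2)[OF f]] continuous_intros) auto
    then show ?thesis by (simp add: slice_y_def)
  qed
  have fx: "continuous_on UNIV (\<lambda>y. f (x, y))" for x
    by (intro continuous_on_compose2[OF f] continuous_intros) auto
  have "integral (Omega L) f = integral {0..real K * (L / K)} (\<lambda>x. integral {0..real K * (1 / K)} (\<lambda>y. f (x, y)))"
    unfolding Omega_cbox eq by (rule iterated_integral(1)[OF f])
  also have "\<dots> = (\<Sum>i<K. integral {real i * (L / K)..real (Suc i) * (L / K)}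
      (\<lambda>x. integral {0..real K * (1 / K)} (\<lambda>y. f (x, y))))"
    using L K by (intro integral_uniform_partition sl) simp
  also have "\<dots> = (\<Sum>i<K. integral {real i * (L / K)..real (Suc i) * (L / K)}
      (\<lambda>x. \<Sum>j<K. integral {real j * (1 / K)..real (Suc j) * (1 / K)} (\<lambda>y. f (x, y))))"
    by (subst integral_uniform_partition[OF fx]) simp_all
  also have "\<dots> = (\<Sum>i<K. \<Sum>j<K. integral {real i * (L / K)..real (Suc i) * (L / K)}
      (\<lambda>x. integral {real j * (1 / K)..real (Suc j) * (1 / K)} (\<lambda>y. f (x, y))))"
    by (intro sum.cong refl integral_sum integrable_continuous_real continuous_on_subset[OF sl]) auto
  also have "\<dots> = (\<Sum>i<K. \<Sum>j<K. integral (cell L K i j) f)"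
    unfolding cell_def iterated_integral(1)[OF f] ..
  finally show ?thesis .
qed

text \<open>Up to an error of order \<open>1/K\<close> in terms of the gradient, finitely many cell integrals determine the
  norm. This is the source of compactness.\<close>

lemma smooth_norm_cells:
  assumes f: "smooth f" and K: "K > 0" and L: "L > 0"
  shows "(norm2 (Omega L) f)\<^sup>2 \<le> (real K)\<^sup>2 / L * (\<Sum>i<K. \<Sum>j<K. (integral (cell L K i j) f)\<^sup>2)
    + (L\<^sup>2 * (norm2 (Omega L) (part_x f))\<^sup>2 + (norm2 (Omega L) (part_y f))\<^sup>2) / (real K)\<^sup>2"
proof -
  have cf: "continuous_on UNIV f" by (rule smooth_continuous[OF f])
  have cf2: "continuous_on UNIV (\<lambda>p. (f p)\<^sup>2)" by (intro continuous_intros cf)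
  note cx = continuous_part_square[OF f Basis_xy(1)] and cy = continuous_part_square[OF f Basis_xy(2)]
  have n: "(norm2 (Omega L) g)\<^sup>2 = integral (Omega L) (\<lambda>p. (g p)\<^sup>2)" if "smooth g" for g
    unfolding Omega_cbox by (rule norm2_continuous[OF smooth_continuous[OF that]])
  have cell: "integral (cell L K i j) (\<lambda>p. (f p)\<^sup>2) \<le> (real K)\<^sup>2 / L * (integral (cell L K i j) f)\<^sup>2
      + L\<^sup>2 / (real K)\<^sup>2 * integral (cell L K i j) (\<lambda>p. (part_x f p)\<^sup>2)
      + 1 / (real K)\<^sup>2 * integral (cell L K i j) (\<lambda>p. (part_y f p)\<^sup>2)" for i j
  proof -
    have d: "real (Suc i) * (L / K) - real i * (L / K) = L / K" "real (Suc j) * (1 / K) - real j * (1 / K) = 1 / K"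
      by (simp_all add: algebra_simps add_divide_distrib)
    have lt: "real i * (L / K) < real (Suc i) * (L / K)" "real j * (1 / K) < real (Suc j) * (1 / K)"
      using K L by (intro mult_strict_right_mono; simp)+
    have mm: "X / (L / real K * (1 / real K)) = (real K)\<^sup>2 / L * X" for X
      by (simp add: power2_eq_square)
    show ?thesis
      using smooth_poincare_cell[OF f lt] unfolding d cell_def[symmetric] mm power_divide by simp
  qed
  have "(norm2 (Omega L) f)\<^sup>2 = (\<Sum>i<K. \<Sum>j<K. integral (cell L K i j) (\<lambda>p. (f p)\<^sup>2))"
    unfolding n[OF f] by (rule integral_cells[OF cf2 K L])
  also have "\<dots> \<le> (\<Sum>i<K. \<Sum>j<K. (real K)\<^sup>2 / L * (integral (cell L K i j) f)\<^sup>2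
      + L\<^sup>2 / (real K)\<^sup>2 * integral (cell L K i j) (\<lambda>p. (part_x f p)\<^sup>2)
      + 1 / (real K)\<^sup>2 * integral (cell L K i j) (\<lambda>p. (part_y f p)\<^sup>2))"
    by (intro sum_mono cell)
  also have "\<dots> = (real K)\<^sup>2 / L * (\<Sum>i<K. \<Sum>j<K. (integral (cell L K i j) f)\<^sup>2)
      + L\<^sup>2 / (real K)\<^sup>2 * (\<Sum>i<K. \<Sum>j<K. integral (cell L K i j) (\<lambda>p. (part_x f p)\<^sup>2))
      + 1 / (real K)\<^sup>2 * (\<Sum>i<K. \<Sum>j<K. integral (cell L K i j) (\<lambda>p. (part_y f p)\<^sup>2))"
    by (simp only: sum.distrib sum_distrib_left)
  also have "\<dots> = (real K)\<^sup>2 / L * (\<Sum>i<K. \<Sum>j<K. (integral (cell L K i j) f)\<^sup>2)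
    + (L\<^sup>2 * (norm2 (Omega L) (part_x f))\<^sup>2 + (norm2 (Omega L) (part_y f))\<^sup>2) / (real K)\<^sup>2"
    unfolding integral_cells[OF cx K L, symmetric] integral_cells[OF cy K L, symmetric]
      n[OF smooth_partial[OF f Basis_xy(1)], symmetric] n[OF smooth_partial[OF f Basis_xy(2)], symmetric]
    by (simp add: add_divide_distrib)
  finally show ?thesis .
qed

lemma cell_subset:
  assumes "i < K" "j < K" "L > 0" shows "cell L K i j \<subseteq> Omega L"
proof -
  have "real (Suc i) * (L / K) \<le> real K * (L / K)" "real (Suc j) * (1 / K) \<le> real K * (1 / K)"
    using assms by (intro mult_right_mono; simp)+
  moreover have "0 \<le> real i * (L / K)" "0 \<le> real j * (1 / K)" using assms by auto
  moreover have "real K * (L / K) = L" "real K * (1 / K) = 1" using assms by auto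
  ultimately have *: "0 \<le> real i * (L / K)" "real (Suc i) * (L / K) \<le> L"
    "0 \<le> real j * (1 / K)" "real (Suc j) * (1 / K) \<le> 1" by linarith+
  have "{real i * (L / K)..real (Suc i) * (L / K)} \<subseteq> {0..L}"
    "{real j * (1 / K)..real (Suc j) * (1 / K)} \<subseteq> {0..1}"
    unfolding atLeastatMost_subset_iff using * by blast+
  then show ?thesis
    unfolding cell_def Omega_def cbox_real2 by (rule Sigma_mono)
qed

lemma cell_integral_bound:
  assumes f: "smooth f" and ij: "i < K" "j < K" and L: "L > 0"
  shows "(integral (cell L K i j) f)\<^sup>2 \<le> L * (norm2 (Omega L) f)\<^sup>2"
proof -
  have cf: "continuous_on UNIV f" by (rule smooth_continuous[OF f])
  have cf2: "continuous_on UNIV (\<lambda>p. (f p)\<^sup>2)" by (intro continuous_intros cf)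
  have "(integral (cell L K i j) f)\<^sup>2 \<le> measure lebesgue (cell L K i j) * integral (cell L K i j) (\<lambda>p. (f p)\<^sup>2)"
    unfolding cell_def by (rule integral_square_le[OF cf])
  also have "\<dots> \<le> L * integral (Omega L) (\<lambda>p. (f p)\<^sup>2)"
  proof (intro mult_mono)
    have "measure lebesgue (cell L K i j) \<le> measure lebesgue (Omega L)"
      by (intro measure_mono_fmeasurable cell_subset ij L Omega_lmeasurable) (simp add: cell_def)
    then show "measure lebesgue (cell L K i j) \<le> L" by (simp add: measure_Omega L)
    show "integral (cell L K i j) (\<lambda>p. (f p)\<^sup>2) \<le> integral (Omega L) (\<lambda>p. (f p)\<^sup>2)"
      by (intro integral_subset_le cell_subset ij L)
        (auto simp: cell_def Omega_cbox intro: continuous_integrable_cbox[OF cf2])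
    show "0 \<le> integral (cell L K i j) (\<lambda>p. (f p)\<^sup>2)"
      unfolding cell_def by (intro integral_nonneg continuous_integrable_cbox[OF cf2]) auto
  qed (use L in auto)
  also have "integral (Omega L) (\<lambda>p. (f p)\<^sup>2) = (norm2 (Omega L) f)\<^sup>2"
    unfolding Omega_cbox by (rule norm2_continuous[OF smooth_continuous[OF f], symmetric])
  finally show ?thesis .
qed

lemma smooth_diff: "smooth f \<Longrightarrow> smooth g \<Longrightarrow> smooth (\<lambda>p. f p - g p)"
  using smooth_add[of f "\<lambda>p. (-1) * g p"] smooth_scale[of g "-1"] by simp

lemma partial_diff:
  assumes "smooth f" "smooth g"
  shows "frechet_derivative (\<lambda>p. f p - g p) (at p) i
       = frechet_derivative f (at p) i - frechet_derivative g (at p) i"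
  using partial_add[OF assms(1) smooth_scale[OF assms(2), of "-1"], of p i] partial_scale[OF assms(2), of "-1" p i]
  by simp

text \<open>Over all meshes there are countably many cell integrals, and each is bounded along the sequence.
  A diagonal subsequence makes all of them converge.\<close>

lemma rellich_smooth:
  assumes f: "\<And>n. smooth (f n)" and L: "L > 0"
    and b: "\<And>n. norm2 (Omega L) (f n) \<le> C" "\<And>n. norm2 (Omega L) (part_x (f n)) \<le> C"
      "\<And>n. norm2 (Omega L) (part_y (f n)) \<le> C"
  obtains r :: "nat \<Rightarrow> nat" where "strict_mono r"
    "\<And>e. e > 0 \<Longrightarrow> \<exists>N. \<forall>m\<ge>N. \<forall>n\<ge>N. norm2 (Omega L) (\<lambda>p. f (r m) p - f (r n) p) < e"
proof -
  define S where "S = {(K, i, j). i < K \<and> j < (K::nat)}"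
  define X where "X n = (\<lambda>(K, i, j). integral (cell L K i j) (f n))" for n
  have C: "C \<ge> 0" using b(1)[of 0] norm2_nonneg order_trans by blast
  have "norm (X n x) \<le> sqrt L * C" if "x \<in> S" for n x
  proof -
    obtain K i j where x: "x = (K, i, j)" by (cases x)
    with that have ij: "i < K" "j < K" by (auto simp: S_def)
    have "(X n x)\<^sup>2 \<le> L * (norm2 (Omega L) (f n))\<^sup>2"
      using cell_integral_bound[OF f ij L] by (simp add: X_def x)
    also have "\<dots> \<le> L * C\<^sup>2" using L b(1)[of n] by (intro mult_left_mono power_mono) auto
    also have "\<dots> = (sqrt L * C)\<^sup>2" using L by (simp add: power_mult_distrib)
    finally have "\<bar>X n x\<bar>\<^sup>2 \<le> (sqrt L * C)\<^sup>2" by simp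
    then show ?thesis using L C by (auto intro: power2_le_imp_le)
  qed
  then obtain r where r: "strict_mono (r :: nat \<Rightarrow> nat)" "\<And>x. x \<in> S \<Longrightarrow> \<exists>l. (\<lambda>n. X (r n) x) \<longlonglongrightarrow> l"
    using function_convergent_subsequence[of S X "sqrt L * C"] by (metis countableI_type)
  show ?thesis
  proof (rule that[OF r(1)])
    fix e :: real assume e: "e > 0"
    define D where "D = L\<^sup>2 * (2 * C)\<^sup>2 + (2 * C)\<^sup>2"
    obtain K0 :: nat where K0: "2 * D / e\<^sup>2 < real K0" using reals_Archimedean2 by blast
    define K where "K = Suc K0"
    have K: "K > 0" by (simp add: K_def)
    have "D / (real K)\<^sup>2 \<le> D / real K"
      using K by (intro divide_left_mono) (auto simp: D_def power2_eq_square)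
    also have "\<dots> < e\<^sup>2 / 2"
    proof -
      have "2 * D / e\<^sup>2 < real K" using K0 by (simp add: K_def)
      then show ?thesis using e K by (simp add: field_simps)
    qed
    finally have DK: "D / (real K)\<^sup>2 < e\<^sup>2 / 2" .
    define \<delta> where "\<delta> = e * sqrt (L / 8) / (real K)\<^sup>2"
    have \<delta>: "\<delta> > 0" using e L K by (simp add: \<delta>_def)
    have "\<forall>i<K. \<forall>j<K. \<exists>l. (\<lambda>n. X (r n) (K, i, j)) \<longlonglongrightarrow> l"
      using r(2) by (auto simp: S_def)
    then obtain l where l: "\<And>i j. i < K \<Longrightarrow> j < K \<Longrightarrow> (\<lambda>n. X (r n) (K, i, j)) \<longlonglongrightarrow> l i j"
      by metis
    have "\<forall>\<^sub>F n in sequentially. \<forall>i\<in>{..<K}. \<forall>j\<in>{..<K}. dist (X (r n) (K, i, j)) (l i j) < \<delta>"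
      using l \<delta> by (intro eventually_ball_finite ballI) (auto intro: tendstoD)
    then obtain N where N: "\<And>n i j. n \<ge> N \<Longrightarrow> i < K \<Longrightarrow> j < K \<Longrightarrow> dist (X (r n) (K, i, j)) (l i j) < \<delta>"
      by (auto simp: eventually_sequentially)
    have "norm2 (Omega L) (\<lambda>p. f (r m) p - f (r n) p) < e" if mn: "m \<ge> N" "n \<ge> N" for m n
    proof -
      let ?g = "\<lambda>p. f (r m) p - f (r n) p"
      have g: "smooth ?g" by (intro smooth_diff f)
      have "(integral (cell L K i j) ?g)\<^sup>2 \<le> (2 * \<delta>)\<^sup>2" if "i < K" "j < K" for i j
      proof -
        have "integral (cell L K i j) ?g = X (r m) (K, i, j) - X (r n) (K, i, j)"
          unfolding X_def cell_def
          by (simp add: Henstock_Kurzweil_Integration.integral_diff continuous_integrable_cbox smooth_continuous f)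
        also have "\<bar>\<dots>\<bar> \<le> 2 * \<delta>"
          using N[OF mn(1) that] N[OF mn(2) that] by (simp add: dist_real_def)
        finally have "\<bar>integral (cell L K i j) ?g\<bar> \<le> \<bar>2 * \<delta>\<bar>" using \<delta> by simp
        then show ?thesis by (simp only: abs_le_square_iff)
      qed
      then have "(\<Sum>i<K. \<Sum>j<K. (integral (cell L K i j) ?g)\<^sup>2) \<le> (\<Sum>i<K. \<Sum>j<K. (2 * \<delta>)\<^sup>2)"
        by (intro sum_mono) auto
      then have "(real K)\<^sup>2 / L * (\<Sum>i<K. \<Sum>j<K. (integral (cell L K i j) ?g)\<^sup>2)
          \<le> (real K)\<^sup>2 / L * (\<Sum>i<K. \<Sum>j<K. (2 * \<delta>)\<^sup>2)"
        using L by (intro mult_left_mono) auto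
      also have "\<dots> = e\<^sup>2 / 2"
      proof -
        have "\<delta>\<^sup>2 = e\<^sup>2 * (L / 8) / (real K)^4"
          using L by (simp add: \<delta>_def power_mult_distrib power_divide)
        then show ?thesis
          using K L by (simp add: power_mult_distrib field_simps power2_eq_square power4_eq_xxxx)
      qed
      finally have 1: "(real K)\<^sup>2 / L * (\<Sum>i<K. \<Sum>j<K. (integral (cell L K i j) ?g)\<^sup>2) \<le> e\<^sup>2 / 2" .
      have px: "norm2 (Omega L) (\<lambda>p. frechet_derivative ?g (at p) i) \<le> 2 * C"
        if "i \<in> Basis" "\<And>n. norm2 (Omega L) (\<lambda>p. frechet_derivative (f n) (at p) i) \<le> C" for i
        unfolding partial_diff[OF f f]
        using norm2_diff_le[OF smooth_L2[OF smooth_partial[OF f[of "r m"] that(1)], of L]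
            smooth_L2[OF smooth_partial[OF f[of "r n"] that(1)]]] that(2)[of "r m"] that(2)[of "r n"] by linarith
      have "(L\<^sup>2 * (norm2 (Omega L) (part_x ?g))\<^sup>2 + (norm2 (Omega L) (part_y ?g))\<^sup>2) / (real K)\<^sup>2 \<le> D / (real K)\<^sup>2"
        unfolding D_def using px[OF Basis_xy(1) b(2)] px[OF Basis_xy(2) b(3)]
        by (intro divide_right_mono add_mono mult_left_mono power_mono) auto
      with 1 DK smooth_norm_cells[OF g K L] have "(norm2 (Omega L) ?g)\<^sup>2 < e\<^sup>2" by linarith
      then show ?thesis using e by (auto intro: power2_less_imp_less)
    qed
    then show "\<exists>N. \<forall>m\<ge>N. \<forall>n\<ge>N. norm2 (Omega L) (\<lambda>p. f (r m) p - f (r n) p) < e" by blast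
  qed
qed

section \<open>Traces\<close>

lemma norm2_tendsto_0_iff:
  "(\<lambda>n. LINT p|lebesgue_on S. (f n p)\<^sup>2) \<longlonglongrightarrow> 0 \<longleftrightarrow> (\<lambda>n. norm2 S (f n)) \<longlonglongrightarrow> 0"
proof
  assume "(\<lambda>n. LINT p|lebesgue_on S. (f n p)\<^sup>2) \<longlonglongrightarrow> 0"
  from tendsto_real_sqrt[OF this] show "(\<lambda>n. norm2 S (f n)) \<longlonglongrightarrow> 0" by (simp add: norm2_def)
next
  assume "(\<lambda>n. norm2 S (f n)) \<longlonglongrightarrow> 0"
  from tendsto_power[OF this, of 2] show "(\<lambda>n. LINT p|lebesgue_on S. (f n p)\<^sup>2) \<longlonglongrightarrow> 0"
    by (simp add: norm2_power2)
qed

text \<open>An \<open>\<epsilon>\<close>-form of the trace, free of the choice of representatives of the weak derivatives.\<close>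

definition trace_approx where
  "trace_approx L \<gamma> T u a v g e \<phi> \<longleftrightarrow> smooth \<phi> \<and>
     norm2 (Omega L) (\<lambda>p. \<phi> p - u p) < e \<and>
     norm2 (Omega L) (\<lambda>p. part_x \<phi> p - a p) < e \<and>
     norm2 (Omega L) (\<lambda>p. part_y \<phi> p - v p) < e \<and>
     norm2 T (\<lambda>t. \<phi> (\<gamma> t) - g t) < e"

lemma smooth_partial_L2:
  "smooth f \<Longrightarrow> i \<in> Basis \<Longrightarrow> (\<lambda>p. frechet_derivative f (at p) i) \<in> L2 (Omega L)"
  by (intro smooth_L2 smooth_partial)

lemma has_trace_iff_sequence:
  assumes a: "L2_deriv L (1, 0) u a" and v: "L2_deriv L (0, 1) u v"
  shows "has_trace (Omega L) \<gamma> T u g \<longleftrightarrow> g \<in> L2 T \<and>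
     (\<exists>\<phi>. (\<forall>n. smooth (\<phi> n)) \<and>
        (\<lambda>n. norm2 (Omega L) (\<lambda>p. \<phi> n p - u p)) \<longlonglongrightarrow> 0 \<and>
        (\<lambda>n. norm2 (Omega L) (\<lambda>p. part_x (\<phi> n) p - a p)) \<longlonglongrightarrow> 0 \<and>
        (\<lambda>n. norm2 (Omega L) (\<lambda>p. part_y (\<phi> n) p - v p)) \<longlonglongrightarrow> 0 \<and>
        (\<lambda>n. norm2 T (\<lambda>t. \<phi> n (\<gamma> t) - g t)) \<longlonglongrightarrow> 0)"
proof -
  have W: "u \<in> W12 (Omega L)" using a v by (auto simp: W12_iff)
  have D: "norm2 (Omega L) (\<lambda>p. frechet_derivative \<phi> (at p) i - weak_deriv (Omega L) i u p)
      = norm2 (Omega L) (\<lambda>p. frechet_derivative \<phi> (at p) i - b p)"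
    if "smooth \<phi>" "L2_deriv L i u b" "i \<in> Basis" for \<phi> i b
  proof (rule norm2_cong_AE)
    note w = L2_deriv_weak_deriv[OF that(2)]
    show "(\<lambda>p. frechet_derivative \<phi> (at p) i - weak_deriv (Omega L) i u p) \<in> L2 (Omega L)"
      "(\<lambda>p. frechet_derivative \<phi> (at p) i - b p) \<in> L2 (Omega L)"
      by (intro L2_diff smooth_partial_L2 that L2_derivD(2)[OF w(1)] L2_derivD(2)[OF that(2)])+
    show "AE p in lebesgue_on (Omega L). frechet_derivative \<phi> (at p) i - weak_deriv (Omega L) i u p
        = frechet_derivative \<phi> (at p) i - b p"
      using w(2) by eventually_elim simp
  qed
  show ?thesis
    unfolding has_trace_def norm2_tendsto_0_iff
    using W by (auto simp: Basis_real2 D[OF _ a] D[OF _ v] cong: conj_cong)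
qed

text \<open>This gives density of smooth functions up to the boundary, without mollification, for every
  function that has a trace.\<close>

lemma has_trace_sequence:
  assumes a: "L2_deriv L (1, 0) u a" and v: "L2_deriv L (0, 1) u v" and t: "has_trace (Omega L) \<gamma> T u g"
  obtains \<phi> where "\<And>n. smooth (\<phi> n)"
    "(\<lambda>n. norm2 (Omega L) (\<lambda>p. \<phi> n p - u p)) \<longlonglongrightarrow> 0"
    "(\<lambda>n. norm2 (Omega L) (\<lambda>p. part_x (\<phi> n) p - a p)) \<longlonglongrightarrow> 0"
    "(\<lambda>n. norm2 (Omega L) (\<lambda>p. part_y (\<phi> n) p - v p)) \<longlonglongrightarrow> 0"
    "(\<lambda>n. norm2 T (\<lambda>t. \<phi> n (\<gamma> t) - g t)) \<longlonglongrightarrow> 0"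
  using t unfolding has_trace_iff_sequence[OF a v] by blast

lemma has_trace_iff:
  assumes a: "L2_deriv L (1, 0) u a" and v: "L2_deriv L (0, 1) u v"
  shows "has_trace (Omega L) \<gamma> T u g \<longleftrightarrow> g \<in> L2 T \<and> (\<forall>e>0. \<exists>\<phi>. trace_approx L \<gamma> T u a v g e \<phi>)"
proof
  assume t: "has_trace (Omega L) \<gamma> T u g"
  obtain \<phi> where \<phi>: "\<And>n. smooth (\<phi> n)"
    "(\<lambda>n. norm2 (Omega L) (\<lambda>p. \<phi> n p - u p)) \<longlonglongrightarrow> 0"
    "(\<lambda>n. norm2 (Omega L) (\<lambda>p. part_x (\<phi> n) p - a p)) \<longlonglongrightarrow> 0"
    "(\<lambda>n. norm2 (Omega L) (\<lambda>p. part_y (\<phi> n) p - v p)) \<longlonglongrightarrow> 0"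
    "(\<lambda>n. norm2 T (\<lambda>t. \<phi> n (\<gamma> t) - g t)) \<longlonglongrightarrow> 0"
    by (rule has_trace_sequence[OF a v t], rule that)
  have "\<exists>\<phi>. trace_approx L \<gamma> T u a v g e \<phi>" if e: "e > 0" for e
  proof -
    have "\<forall>\<^sub>F n in sequentially. trace_approx L \<gamma> T u a v g e (\<phi> n)"
      unfolding trace_approx_def using \<phi>(1)
      by (simp add: eventually_conj order_tendstoD(2)[OF \<phi>(2) e] order_tendstoD(2)[OF \<phi>(3) e]
          order_tendstoD(2)[OF \<phi>(4) e] order_tendstoD(2)[OF \<phi>(5) e])
    then show ?thesis using eventually_happens'[OF sequentially_bot] by blast
  qed
  with t show "g \<in> L2 T \<and> (\<forall>e>0. \<exists>\<phi>. trace_approx L \<gamma> T u a v g e \<phi>)"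
    unfolding has_trace_iff_sequence[OF a v] by blast
next
  assume R: "g \<in> L2 T \<and> (\<forall>e>0. \<exists>\<phi>. trace_approx L \<gamma> T u a v g e \<phi>)"
  then have "\<forall>n. \<exists>\<phi>. trace_approx L \<gamma> T u a v g (1 / real (Suc n)) \<phi>" by simp
  then obtain \<phi> where \<phi>: "\<And>n. trace_approx L \<gamma> T u a v g (1 / real (Suc n)) (\<phi> n)" by metis
  have lim: "f \<longlonglongrightarrow> 0" if "\<And>n. 0 \<le> f n" "\<And>n. f n < 1 / real (Suc n)" for f :: "nat \<Rightarrow> real"
    using that by (intro tendsto_sandwich[OF _ _ tendsto_const lim_1_over_n[THEN LIMSEQ_Suc]] always_eventually)
      (auto intro: less_imp_le simp del: of_nat_Suc)
  show "has_trace (Omega L) \<gamma> T u g"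
    unfolding has_trace_iff_sequence[OF a v]
    using \<phi> R by (intro conjI exI[of _ \<phi>] allI lim) (auto simp: trace_approx_def)
qed

lemma smooth_along_curve_L2:
  assumes "smooth \<phi>" "continuous_on {c..d} \<gamma>"
  shows "(\<lambda>t::real. \<phi> (\<gamma> t)) \<in> L2 {c..d}"
proof -
  have "continuous_on (cbox c d) (\<lambda>t. \<phi> (\<gamma> t))"
    using assms by (intro continuous_on_compose2[OF smooth_continuous[OF assms(1), of UNIV]]) auto
  from continuous_L2[OF this] show ?thesis by simp
qed

lemma norm2_lincomb_le:
  assumes "f \<in> L2 S" "g \<in> L2 S" "f' \<in> L2 S" "g' \<in> L2 S"
    and n: "norm2 S (\<lambda>p. f p - g p) < d" "norm2 S (\<lambda>p. f' p - g' p) < d" "d = e / (\<bar>\<alpha>\<bar> + \<bar>\<beta>\<bar> + 1)" "e > 0"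
  shows "norm2 S (\<lambda>p. (\<alpha> * f p + \<beta> * f' p) - (\<alpha> * g p + \<beta> * g' p)) < e"
proof -
  have eq: "(\<lambda>p. (\<alpha> * f p + \<beta> * f' p) - (\<alpha> * g p + \<beta> * g' p)) = (\<lambda>p. \<alpha> * (f p - g p) + \<beta> * (f' p - g' p))"
    by (auto simp: fun_eq_iff algebra_simps)
  have "norm2 S (\<lambda>p. \<alpha> * (f p - g p) + \<beta> * (f' p - g' p)) \<le> \<bar>\<alpha>\<bar> * norm2 S (\<lambda>p. f p - g p) + \<bar>\<beta>\<bar> * norm2 S (\<lambda>p. f' p - g' p)"
    using norm2_triangle[OF L2_scale[OF L2_diff[OF assms(1,2)]] L2_scale[OF L2_diff[OF assms(3,4)]], of \<alpha> \<beta>]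
    by (simp add: norm2_scale)
  also have "\<dots> \<le> \<bar>\<alpha>\<bar> * d + \<bar>\<beta>\<bar> * d" using n by (intro add_mono mult_left_mono) auto
  also have "\<dots> < (\<bar>\<alpha>\<bar> + \<bar>\<beta>\<bar> + 1) * d"
  proof -
    have "d > 0" unfolding n(3) using n(4) by (simp add: add_nonneg_pos)
    then show ?thesis by (simp add: distrib_right)
  qed
  also have "\<dots> = e" using n(3) by (simp add: field_simps add_nonneg_eq_0_iff)
  finally show ?thesis unfolding eq .
qed

lemma has_trace_linear:
  fixes \<gamma> :: "real \<Rightarrow> real \<times> real"
  assumes a: "L2_deriv L (1, 0) u a" and v: "L2_deriv L (0, 1) u v" and t: "has_trace (Omega L) \<gamma> {c..d} u g"
    and a': "L2_deriv L (1, 0) u' a'" and v': "L2_deriv L (0, 1) u' v'" and t': "has_trace (Omega L) \<gamma> {c..d} u' g'"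
    and \<gamma>: "continuous_on {c..d} \<gamma>"
  shows "has_trace (Omega L) \<gamma> {c..d} (\<lambda>p. \<alpha> * u p + \<beta> * u' p) (\<lambda>t. \<alpha> * g t + \<beta> * g' t)"
proof -
  have g: "g \<in> L2 {c..d}" "g' \<in> L2 {c..d}" using t t' has_trace_iff[OF a v] has_trace_iff[OF a' v'] by auto
  note A = L2_deriv_linear[OF a a' Basis_xy(1), of \<alpha> \<beta>] and V = L2_deriv_linear[OF v v' Basis_xy(2), of \<alpha> \<beta>]
  show ?thesis unfolding has_trace_iff[OF A V]
  proof (intro conjI allI impI L2_add L2_scale g)
    fix e :: real assume e: "e > 0"
    define \<delta> where "\<delta> = e / (\<bar>\<alpha>\<bar> + \<bar>\<beta>\<bar> + 1)"
    have \<delta>: "\<delta> > 0" using e by (simp add: \<delta>_def add_nonneg_pos)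
    obtain \<phi> where \<phi>: "trace_approx L \<gamma> {c..d} u a v g \<delta> \<phi>" using t has_trace_iff[OF a v] \<delta> by blast
    obtain \<psi> where \<psi>: "trace_approx L \<gamma> {c..d} u' a' v' g' \<delta> \<psi>" using t' has_trace_iff[OF a' v'] \<delta> by blast
    have s: "smooth \<phi>" "smooth \<psi>" using \<phi> \<psi> by (auto simp: trace_approx_def)
    have n: "norm2 (Omega L) (\<lambda>p. \<phi> p - u p) < \<delta>" "norm2 (Omega L) (\<lambda>p. \<psi> p - u' p) < \<delta>"
      "norm2 (Omega L) (\<lambda>p. part_x \<phi> p - a p) < \<delta>" "norm2 (Omega L) (\<lambda>p. part_x \<psi> p - a' p) < \<delta>"
      "norm2 (Omega L) (\<lambda>p. part_y \<phi> p - v p) < \<delta>" "norm2 (Omega L) (\<lambda>p. part_y \<psi> p - v' p) < \<delta>"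
      "norm2 {c..d} (\<lambda>t. \<phi> (\<gamma> t) - g t) < \<delta>" "norm2 {c..d} (\<lambda>t. \<psi> (\<gamma> t) - g' t) < \<delta>"
      using \<phi> \<psi> by (auto simp: trace_approx_def)
    note sx = smooth_partial_L2[OF s(1) Basis_xy(1)] smooth_partial_L2[OF s(2) Basis_xy(1)]
    note sy = smooth_partial_L2[OF s(1) Basis_xy(2)] smooth_partial_L2[OF s(2) Basis_xy(2)]
    note sc = smooth_along_curve_L2[OF s(1) \<gamma>] smooth_along_curve_L2[OF s(2) \<gamma>]
    have "trace_approx L \<gamma> {c..d} (\<lambda>p. \<alpha> * u p + \<beta> * u' p) (\<lambda>p. \<alpha> * a p + \<beta> * a' p)
        (\<lambda>p. \<alpha> * v p + \<beta> * v' p) (\<lambda>t. \<alpha> * g t + \<beta> * g' t) e (\<lambda>p. \<alpha> * \<phi> p + \<beta> * \<psi> p)"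
      unfolding trace_approx_def partial_add[OF smooth_scale[OF s(1)] smooth_scale[OF s(2)]]
        partial_scale[OF s(1)] partial_scale[OF s(2)]
      by (intro conjI smooth_add smooth_scale s
          norm2_lincomb_le[OF smooth_L2[OF s(1)] L2_derivD(1)[OF a] smooth_L2[OF s(2)] L2_derivD(1)[OF a'] n(1,2) \<delta>_def e]
          norm2_lincomb_le[OF sx(1) L2_derivD(2)[OF a] sx(2) L2_derivD(2)[OF a'] n(3,4) \<delta>_def e]
          norm2_lincomb_le[OF sy(1) L2_derivD(2)[OF v] sy(2) L2_derivD(2)[OF v'] n(5,6) \<delta>_def e]
          norm2_lincomb_le[OF sc(1) g(1) sc(2) g(2) n(7,8) \<delta>_def e])
    then show "\<exists>\<phi>. trace_approx L \<gamma> {c..d} (\<lambda>p. \<alpha> * u p + \<beta> * u' p) (\<lambda>p. \<alpha> * a p + \<beta> * a' p)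
        (\<lambda>p. \<alpha> * v p + \<beta> * v' p) (\<lambda>t. \<alpha> * g t + \<beta> * g' t) e \<phi>" by blast
  qed
qed

text \<open>A diagonal argument: smooth approximations of \<open>u n\<close> with \<open>n\<close> large approximate \<open>U\<close>.\<close>

lemma has_trace_limit:
  fixes \<gamma> :: "real \<Rightarrow> real \<times> real"
  assumes a: "\<And>n. L2_deriv L (1, 0) (u n) (a n)" and v: "\<And>n. L2_deriv L (0, 1) (u n) (v n)"
    and t: "\<And>n. has_trace (Omega L) \<gamma> {c..d} (u n) (g n)"
    and A: "L2_deriv L (1, 0) U A" and V: "L2_deriv L (0, 1) U V"
    and lim: "(\<lambda>n. norm2 (Omega L) (\<lambda>p. u n p - U p)) \<longlonglongrightarrow> 0"
      "(\<lambda>n. norm2 (Omega L) (\<lambda>p. a n p - A p)) \<longlonglongrightarrow> 0"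
      "(\<lambda>n. norm2 (Omega L) (\<lambda>p. v n p - V p)) \<longlonglongrightarrow> 0"
      "(\<lambda>n. norm2 {c..d} (\<lambda>t. g n t - G t)) \<longlonglongrightarrow> 0"
    and G: "G \<in> L2 {c..d}" and \<gamma>: "continuous_on {c..d} \<gamma>"
  shows "has_trace (Omega L) \<gamma> {c..d} U G"
  unfolding has_trace_iff[OF A V]
proof (intro conjI allI impI G)
  fix e :: real assume e: "e > 0"
  then have e2: "e / 2 > 0" by simp
  have g: "g n \<in> L2 {c..d}" for n using t has_trace_iff[OF a v] by auto
  have "\<forall>\<^sub>F n in sequentially. norm2 (Omega L) (\<lambda>p. u n p - U p) < e / 2 \<and>
      norm2 (Omega L) (\<lambda>p. a n p - A p) < e / 2 \<and> norm2 (Omega L) (\<lambda>p. v n p - V p) < e / 2 \<and>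
      norm2 {c..d} (\<lambda>t. g n t - G t) < e / 2"
    by (intro eventually_conj order_tendstoD(2)[OF lim(1) e2] order_tendstoD(2)[OF lim(2) e2]
        order_tendstoD(2)[OF lim(3) e2] order_tendstoD(2)[OF lim(4) e2])
  then obtain n where n: "norm2 (Omega L) (\<lambda>p. u n p - U p) < e / 2"
      "norm2 (Omega L) (\<lambda>p. a n p - A p) < e / 2" "norm2 (Omega L) (\<lambda>p. v n p - V p) < e / 2"
      "norm2 {c..d} (\<lambda>t. g n t - G t) < e / 2"
    using eventually_happens'[OF sequentially_bot] by blast
  obtain \<phi> where \<phi>: "trace_approx L \<gamma> {c..d} (u n) (a n) (v n) (g n) (e / 2) \<phi>"
    using t[of n] has_trace_iff[OF a v] e2 by blast
  then have s: "smooth \<phi>" by (auto simp: trace_approx_def)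
  have *: "norm2 S (\<lambda>p. f p - k p) < e" if "f \<in> L2 S" "h \<in> L2 S" "k \<in> L2 S"
    "norm2 S (\<lambda>p. f p - h p) < e / 2" "norm2 S (\<lambda>p. h p - k p) < e / 2" for S :: "'b::euclidean_space set" and f h k
    using norm2_triangle_diff[OF that(1-3)] that(4,5) by simp
  have m: "norm2 (Omega L) (\<lambda>p. \<phi> p - u n p) < e / 2" "norm2 (Omega L) (\<lambda>p. part_x \<phi> p - a n p) < e / 2"
    "norm2 (Omega L) (\<lambda>p. part_y \<phi> p - v n p) < e / 2" "norm2 {c..d} (\<lambda>t. \<phi> (\<gamma> t) - g n t) < e / 2"
    using \<phi> by (auto simp: trace_approx_def)
  have "trace_approx L \<gamma> {c..d} U A V G e \<phi>"
    unfolding trace_approx_def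
    by (intro conjI s
        *[OF smooth_L2[OF s] L2_derivD(1)[OF a] L2_derivD(1)[OF A] m(1) n(1)]
        *[OF smooth_partial_L2[OF s Basis_xy(1)] L2_derivD(2)[OF a] L2_derivD(2)[OF A] m(2) n(2)]
        *[OF smooth_partial_L2[OF s Basis_xy(2)] L2_derivD(2)[OF v] L2_derivD(2)[OF V] m(3) n(3)]
        *[OF smooth_along_curve_L2[OF s \<gamma>] g G m(4) n(4)])
  then show "\<exists>\<phi>. trace_approx L \<gamma> {c..d} U A V G e \<phi>" by blast
qed

lemma poincare_left:
  assumes a: "L2_deriv L (1, 0) u a" and v: "L2_deriv L (0, 1) u v" and t: "vanishes_left L u" and L: "L > 0"
  shows "(norm2 (Omega L) u)\<^sup>2 \<le> 2 * L\<^sup>2 * (norm2 (Omega L) a)\<^sup>2"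
proof -
  obtain \<phi> where \<phi>: "\<And>n. smooth (\<phi> n)"
    "(\<lambda>n. norm2 (Omega L) (\<lambda>p. \<phi> n p - u p)) \<longlonglongrightarrow> 0"
    "(\<lambda>n. norm2 (Omega L) (\<lambda>p. part_x (\<phi> n) p - a p)) \<longlonglongrightarrow> 0"
    "(\<lambda>n. norm2 (Omega L) (\<lambda>p. part_y (\<phi> n) p - v p)) \<longlonglongrightarrow> 0"
    "(\<lambda>n. norm2 {0..1} (\<lambda>t. \<phi> n (0, t) - 0)) \<longlonglongrightarrow> 0"
    by (rule has_trace_sequence[OF a v t[unfolded vanishes_left_def]], rule that)
  have 1: "(\<lambda>n. (norm2 (Omega L) (\<phi> n))\<^sup>2) \<longlonglongrightarrow> (norm2 (Omega L) u)\<^sup>2"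
    by (intro tendsto_power norm2_tendsto[OF smooth_L2[OF \<phi>(1)] L2_derivD(1)[OF a] \<phi>(2)])
  have "(\<lambda>n. norm2 (Omega L) (part_x (\<phi> n))) \<longlonglongrightarrow> norm2 (Omega L) a"
    by (rule norm2_tendsto[OF smooth_partial_L2[OF \<phi>(1) Basis_xy(1)] L2_derivD(2)[OF a] \<phi>(3)])
  then have 2: "(\<lambda>n. 2 * L * (norm2 {0..1} (\<lambda>t. \<phi> n (0, t)))\<^sup>2 + 2 * L\<^sup>2 * (norm2 (Omega L) (part_x (\<phi> n)))\<^sup>2)
      \<longlonglongrightarrow> 2 * L * 0\<^sup>2 + 2 * L\<^sup>2 * (norm2 (Omega L) a)\<^sup>2"
    using \<phi>(5) by (intro tendsto_intros) simp_all
  show ?thesis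
    using LIMSEQ_le[OF 1 2] smooth_poincare_left[OF \<phi>(1) L] by auto
qed

lemma trace_inequality:
  assumes a: "L2_deriv L (1, 0) u a" and v: "L2_deriv L (0, 1) u v"
    and t: "has_trace (Omega L) (\<lambda>x. (x, z)) {0..L} u g" and L: "L > 0" and z: "z \<in> {0..1}"
  shows "(norm2 {0..L} g)\<^sup>2 \<le> 2 * (norm2 (Omega L) u)\<^sup>2 + 2 * (norm2 (Omega L) v)\<^sup>2"
proof -
  obtain \<phi> where \<phi>: "\<And>n. smooth (\<phi> n)"
    "(\<lambda>n. norm2 (Omega L) (\<lambda>p. \<phi> n p - u p)) \<longlonglongrightarrow> 0"
    "(\<lambda>n. norm2 (Omega L) (\<lambda>p. part_x (\<phi> n) p - a p)) \<longlonglongrightarrow> 0"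
    "(\<lambda>n. norm2 (Omega L) (\<lambda>p. part_y (\<phi> n) p - v p)) \<longlonglongrightarrow> 0"
    "(\<lambda>n. norm2 {0..L} (\<lambda>x. \<phi> n (x, z) - g x)) \<longlonglongrightarrow> 0"
    by (rule has_trace_sequence[OF a v t], rule that)
  have g: "g \<in> L2 {0..L}" using t has_trace_iff[OF a v] by auto
  have 1: "(\<lambda>n. (norm2 {0..L} (\<lambda>x. \<phi> n (x, z)))\<^sup>2) \<longlonglongrightarrow> (norm2 {0..L} g)\<^sup>2"
  proof (intro tendsto_power norm2_tendsto g \<phi>(5))
    show "(\<lambda>x. \<phi> n (x, z)) \<in> L2 {0..L}" for n
      by (intro smooth_along_curve_L2[OF \<phi>(1), where \<gamma>="\<lambda>x. (x, z)"] continuous_intros)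
  qed
  have y: "(\<lambda>n. norm2 (Omega L) (part_y (\<phi> n))) \<longlonglongrightarrow> norm2 (Omega L) v"
    by (rule norm2_tendsto[OF smooth_partial_L2[OF \<phi>(1) Basis_xy(2)] L2_derivD(2)[OF v] \<phi>(4)])
  have u: "(\<lambda>n. norm2 (Omega L) (\<phi> n)) \<longlonglongrightarrow> norm2 (Omega L) u"
    by (rule norm2_tendsto[OF smooth_L2[OF \<phi>(1)] L2_derivD(1)[OF v] \<phi>(2)])
  have 2: "(\<lambda>n. 2 * (norm2 (Omega L) (\<phi> n))\<^sup>2 + 2 * (norm2 (Omega L) (part_y (\<phi> n)))\<^sup>2)
      \<longlonglongrightarrow> 2 * (norm2 (Omega L) u)\<^sup>2 + 2 * (norm2 (Omega L) v)\<^sup>2"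
    by (intro tendsto_intros u y)
  show ?thesis
    using LIMSEQ_le[OF 1 2] smooth_trace_inequality[OF \<phi>(1) L z] by auto
qed

section \<open>Interpolation\<close>

lemma test_function_bounded:
  assumes "test_function S \<phi>" obtains C where "\<And>p. \<bar>\<phi> p\<bar> \<le> C" "C \<ge> 0"
proof -
  let ?K = "closure {p. \<phi> p \<noteq> 0}"
  have "compact ?K" using assms by (simp add: test_function_def)
  then have "bounded (\<phi> ` ?K)"
    by (intro compact_imp_bounded compact_continuous_image smooth_continuous[OF test_function_smooth[OF assms]])
  then obtain C where C: "\<And>p. p \<in> ?K \<Longrightarrow> \<bar>\<phi> p\<bar> \<le> C" unfolding bounded_iff by auto
  have "\<bar>\<phi> p\<bar> \<le> max C 0" for p
    using C[of p] closure_subset[of "{p. \<phi> p \<noteq> 0}"] by (cases "\<phi> p = 0") auto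
  then show ?thesis by (rule that) simp
qed

text \<open>The difference quotient can be placed on the smooth factor, where it is bounded.\<close>

lemma integral_translate_derivative:
  assumes u: "u \<in> L2 (Omega L)" and t: "test_function S \<zeta>" and e: "e \<in> Basis"
  shows "((\<lambda>s. LINT p|lebesgue_on (Omega L). u p * \<zeta> (p + s *\<^sub>R (\<tau> *\<^sub>R e))) has_real_derivative
     (\<tau> * (LINT p|lebesgue_on (Omega L). u p * frechet_derivative \<zeta> (at (p + s *\<^sub>R (\<tau> *\<^sub>R e))) e))) (at s)"
proof -
  let ?M = "lebesgue_on (Omega L)"
  let ?w = "\<tau> *\<^sub>R e"
  let ?d = "\<lambda>p. frechet_derivative \<zeta> (at p) e"
  note st = test_function_smooth[OF t]
  obtain C where C: "\<And>p. \<bar>?d p\<bar> \<le> C" "C \<ge> 0" using test_function_bounded[OF test_function_partial[OF t e]] by blast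
  have D: "((\<lambda>s. \<zeta> (p + s *\<^sub>R ?w)) has_real_derivative \<tau> * ?d (p + s *\<^sub>R ?w)) (at s)" for p s
  proof -
    have "frechet_derivative \<zeta> (at (p + s *\<^sub>R ?w)) ?w = \<tau> * ?d (p + s *\<^sub>R ?w)"
      using linear_cmul[OF has_derivative_linear[OF smooth_has_derivative[OF st]], of "p + s *\<^sub>R ?w" \<tau> e] by simp
    then show ?thesis using smooth_has_real_derivative_line[OF st, of p ?w s] by simp
  qed
  have Lip: "\<bar>\<zeta> (p + x *\<^sub>R ?w) - \<zeta> (p + y *\<^sub>R ?w)\<bar> \<le> \<bar>\<tau>\<bar> * C * \<bar>x - y\<bar>" for p x y
  proof -
    have "norm (\<zeta> (p + x *\<^sub>R ?w) - \<zeta> (p + y *\<^sub>R ?w)) \<le> (\<bar>\<tau>\<bar> * C) * norm (x - y)"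
    proof (rule field_differentiable_bound[of UNIV _ "\<lambda>s. \<tau> * ?d (p + s *\<^sub>R ?w)"])
      show "norm (\<tau> * ?d (p + s *\<^sub>R ?w)) \<le> \<bar>\<tau>\<bar> * C" for s
        unfolding real_norm_def abs_mult by (intro mult_left_mono C(1)) simp
    qed (use D[of p] in auto)
    then show ?thesis by simp
  qed
  have L2t: "(\<lambda>p. \<zeta> (p + s *\<^sub>R ?w)) \<in> L2 (Omega L)" for s by (intro smooth_L2 smooth_translate st)
  have L2d: "(\<lambda>p. ?d (p + s *\<^sub>R ?w)) \<in> L2 (Omega L)" for s
    by (intro smooth_L2 smooth_translate[where f="?d"] smooth_partial st e)
  have uI: "integrable ?M u" by (rule L2_integrable[OF u Omega_lmeasurable])
  show ?thesis
    unfolding DERIV_def tendsto_at_iff_sequentially comp_def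
  proof (intro allI impI)
    fix h :: "nat \<Rightarrow> real" assume h: "\<forall>n. h n \<in> UNIV - {0}" "h \<longlonglongrightarrow> 0"
    let ?q = "\<lambda>n p. u p * ((\<zeta> (p + (s + h n) *\<^sub>R ?w) - \<zeta> (p + s *\<^sub>R ?w)) / h n)"
    have eq: "((LINT p|?M. u p * \<zeta> (p + (s + h n) *\<^sub>R ?w)) - (LINT p|?M. u p * \<zeta> (p + s *\<^sub>R ?w))) / h n
        = (LINT p|?M. ?q n p)" for n
    proof -
      have "(LINT p|?M. ?q n p) = (LINT p|?M. (u p * \<zeta> (p + (s + h n) *\<^sub>R ?w) - u p * \<zeta> (p + s *\<^sub>R ?w)) / h n)"
        by (simp add: right_diff_distrib)
      also have "\<dots> = ((LINT p|?M. u p * \<zeta> (p + (s + h n) *\<^sub>R ?w)) - (LINT p|?M. u p * \<zeta> (p + s *\<^sub>R ?w))) / h n"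
        by (simp only: Bochner_Integration.integral_divide_zero
            Bochner_Integration.integral_diff[OF L2_mult_integrable[OF u L2t] L2_mult_integrable[OF u L2t]])
      finally show ?thesis by (rule sym)
    qed
    have "(\<lambda>n. LINT p|?M. ?q n p) \<longlonglongrightarrow> (LINT p|?M. u p * (\<tau> * ?d (p + s *\<^sub>R ?w)))"
    proof (rule integral_dominated_convergence[where w="\<lambda>p. (\<bar>\<tau>\<bar> * C) * \<bar>u p\<bar>"])
      show "(\<lambda>p. u p * (\<tau> * ?d (p + s *\<^sub>R ?w))) \<in> borel_measurable ?M"
        using L2_measurable[OF u] L2_measurable[OF L2d[of s]] by measurable
      show "(\<lambda>p. ?q n p) \<in> borel_measurable ?M" for n
        using L2_measurable[OF u] L2_measurable[OF L2t[of s]] L2_measurable[OF L2t[of "s + h n"]] by measurable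
      show "integrable ?M (\<lambda>p. (\<bar>\<tau>\<bar> * C) * \<bar>u p\<bar>)" using uI by simp
      show "AE p in ?M. (\<lambda>n. ?q n p) \<longlonglongrightarrow> u p * (\<tau> * ?d (p + s *\<^sub>R ?w))"
      proof (intro AE_I2 tendsto_mult_left)
        fix p
        have "((\<lambda>k. (\<zeta> (p + (s + k) *\<^sub>R ?w) - \<zeta> (p + s *\<^sub>R ?w)) / k) \<longlongrightarrow> \<tau> * ?d (p + s *\<^sub>R ?w)) (at 0)"
          using D[of p s] by (simp add: DERIV_def)
        then show "(\<lambda>n. (\<zeta> (p + (s + h n) *\<^sub>R ?w) - \<zeta> (p + s *\<^sub>R ?w)) / h n) \<longlonglongrightarrow> \<tau> * ?d (p + s *\<^sub>R ?w)"
          using h unfolding tendsto_at_iff_sequentially comp_def by blast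
      qed
      show "AE p in ?M. norm (?q n p) \<le> (\<bar>\<tau>\<bar> * C) * \<bar>u p\<bar>" for n
      proof (rule AE_I2)
        fix p
        have "h n \<noteq> 0" using h(1) by auto
        then have "\<bar>(\<zeta> (p + (s + h n) *\<^sub>R ?w) - \<zeta> (p + s *\<^sub>R ?w)) / h n\<bar> \<le> \<bar>\<tau>\<bar> * C"
          using Lip[of p "s + h n" s] by (simp add: pos_divide_le_eq)
        then show "norm (?q n p) \<le> (\<bar>\<tau>\<bar> * C) * \<bar>u p\<bar>"
          unfolding real_norm_def abs_mult[of "u p"] by (metis abs_ge_zero mult.commute mult_left_mono)
      qed
    qed
    then show "(\<lambda>n. ((LINT p|?M. u p * \<zeta> (p + (s + h n) *\<^sub>R ?w)) - (LINT p|?M. u p * \<zeta> (p + s *\<^sub>R ?w))) / h n)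
        \<longlonglongrightarrow> \<tau> * (LINT p|?M. u p * ?d (p + s *\<^sub>R ?w))"
      unfolding eq by (simp add: mult.left_commute[of "u _" \<tau>])
  qed
qed

lemma test_function_translate:
  assumes t: "test_function S \<zeta>" and sub: "\<And>p. p + a \<in> interior S \<Longrightarrow> p \<in> interior R"
  shows "test_function R (\<lambda>p. \<zeta> (p + a))"
proof -
  have eq: "{p. \<zeta> (p + a) \<noteq> 0} = (\<lambda>p. - a + p) ` {p. \<zeta> p \<noteq> 0}"
    by (auto simp: image_iff) (metis add.commute add_diff_cancel_right' uminus_add_conv_diff)
  have cl: "closure {p. \<zeta> (p + a) \<noteq> 0} = (\<lambda>p. - a + p) ` closure {p. \<zeta> p \<noteq> 0}"
    unfolding eq by (rule closure_translation)
  have "compact (closure {p. \<zeta> (p + a) \<noteq> 0})"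
    unfolding cl using t by (intro compact_translation) (simp add: test_function_def)
  moreover have "closure {p. \<zeta> (p + a) \<noteq> 0} \<subseteq> interior R"
    unfolding cl using t sub by (auto simp: test_function_def)
  ultimately show ?thesis
    using t by (auto simp: test_function_def intro: smooth_translate)
qed

text \<open>Extended by zero, a test function has the same norm over the whole plane, where translations
  preserve the integral.\<close>

lemma test_function_norm2_lborel:
  assumes t: "test_function (Omega L) \<zeta>"
  shows "(norm2 (Omega L) \<zeta>)\<^sup>2 = (LINT p|lborel. (\<zeta> p)\<^sup>2)"
proof -
  have "(norm2 (Omega L) \<zeta>)\<^sup>2 = (LINT p|lebesgue. (if p \<in> Omega L then (\<zeta> p)\<^sup>2 else 0))"
    unfolding norm2_power2 by (rule Lebesgue_Measure.integral_restrict_UNIV[OF Omega_sets, symmetric])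
  also have "(\<lambda>p. if p \<in> Omega L then (\<zeta> p)\<^sup>2 else 0) = (\<lambda>p. (\<zeta> p)\<^sup>2)"
    using test_function_eq_0[OF t] interior_subset[of "Omega L"] by (auto simp: fun_eq_iff)
  also have "(LINT p|lebesgue. (\<zeta> p)\<^sup>2) = (LINT p|lborel. (\<zeta> p)\<^sup>2)"
  proof (rule integral_completion)
    have "continuous_on UNIV (\<lambda>p. (\<zeta> p)\<^sup>2)"
      by (intro continuous_intros smooth_continuous test_function_smooth[OF t])
    then show "(\<lambda>p. (\<zeta> p)\<^sup>2) \<in> borel_measurable lborel"
      by (simp add: borel_measurable_continuous_onI)
  qed
  finally show ?thesis .
qed

lemma test_function_norm2_translate:
  assumes t: "test_function (Omega L) \<zeta>" and t': "test_function (Omega L) (\<lambda>p. \<zeta> (p + a))"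
  shows "norm2 (Omega L) (\<lambda>p. \<zeta> (p + a)) = norm2 (Omega L) \<zeta>"
proof -
  have "continuous_on UNIV (\<lambda>p. (\<zeta> p)\<^sup>2)"
    by (intro continuous_intros smooth_continuous test_function_smooth[OF t])
  then have m: "(\<lambda>p. (\<zeta> p)\<^sup>2) \<in> borel_measurable borel"
    by (simp add: borel_measurable_continuous_onI)
  have "(LINT p|lborel. (\<zeta> p)\<^sup>2) = (LINT p|distr lborel borel ((+) a). (\<zeta> p)\<^sup>2)"
    by (simp add: lborel_distr_plus)
  also have "\<dots> = (LINT p|lborel. (\<zeta> (a + p))\<^sup>2)"
    by (rule integral_distr[OF _ m]) simp
  finally have "(norm2 (Omega L) (\<lambda>p. \<zeta> (p + a)))\<^sup>2 = (norm2 (Omega L) \<zeta>)\<^sup>2"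
    unfolding test_function_norm2_lborel[OF t] test_function_norm2_lborel[OF t'] by (simp add: add.commute)
  then show ?thesis by (simp add: power2_eq_iff_nonneg)
qed

text \<open>Landau's inequality for \<open>F s = \<integral> u(p) \<zeta>(p + s (0, \<tau>)) dp\<close>: moving the derivatives from the test
  function to \<open>u\<close> gives \<open>F' = - \<tau> \<integral> v \<zeta>(\<cdot> + s (0, \<tau>))\<close> and \<open>F'' = \<integral> w \<zeta>(\<cdot> + s (0, \<tau>))\<close>, and Taylor's formula bounds
  \<open>F' 0\<close> by \<open>F\<close> and \<open>F''\<close>. The support of \<open>\<zeta>\<close> lies in a horizontal strip that may be moved in the direction
  \<open>- \<tau>\<close> by up to \<open>1/2\<close> without leaving the rectangle, so no boundary terms arise.\<close>

lemma landau_dual: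
  assumes v: "L2_deriv L (0, 1) u v" and w: "L2_deriv L (0, 1) v w" and L: "L > 0"
    and \<tau>: "\<bar>\<tau>\<bar> = 1" and sh: "\<And>s y. 0 \<le> s \<Longrightarrow> s \<le> 1/2 \<Longrightarrow> c < y + s * \<tau> \<Longrightarrow> y + s * \<tau> < d \<Longrightarrow> 0 < y \<and> y < 1"
    and t: "test_function ({0..L} \<times> {c..d}) \<zeta>" and l: "0 < l" "l \<le> 1/2"
  shows "\<bar>LINT p|lebesgue_on (Omega L). v p * \<zeta> p\<bar>
    \<le> (2 / l * norm2 (Omega L) u + l / 2 * norm2 (Omega L) w) * norm2 (Omega L) \<zeta>"
proof -
  let ?M = "lebesgue_on (Omega L)" and ?y = "(0, 1) :: real \<times> real"
  define Z where "Z s p = \<zeta> (p + s *\<^sub>R (\<tau> *\<^sub>R ?y))" for s p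
  define F where "F s = (LINT p|?M. u p * \<zeta> (p + s *\<^sub>R (\<tau> *\<^sub>R ?y)))" for s
  define G where "G s = \<tau> * (LINT p|?M. u p * part_y \<zeta> (p + s *\<^sub>R (\<tau> *\<^sub>R ?y)))" for s
  define H where "H s = \<tau> * (\<tau> * (LINT p|?M. u p * part_y (part_y \<zeta>) (p + s *\<^sub>R (\<tau> *\<^sub>R ?y))))" for s
  note st = test_function_smooth[OF t]
  note uL = L2_derivD(1)[OF v] and vL = L2_derivD(2)[OF v] and wL = L2_derivD(2)[OF w]
  have tZ: "test_function (Omega L) (Z s)" if "0 \<le> s" "s \<le> 1/2" for s
    unfolding Z_def
  proof (rule test_function_translate[OF t])
    fix p :: "real \<times> real" assume "p + s *\<^sub>R (\<tau> *\<^sub>R ?y) \<in> interior ({0..L} \<times> {c..d})"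
    then show "p \<in> interior (Omega L)"
      using sh[OF that, of "snd p"] by (cases p) (auto simp: interior_Times interior_Omega)
  qed
  have Z0: "Z 0 = \<zeta>" by (simp add: Z_def fun_eq_iff)
  then have t0: "test_function (Omega L) \<zeta>" using tZ[of 0] by simp
  have nZ: "norm2 (Omega L) (Z s) = norm2 (Omega L) \<zeta>" if "0 \<le> s" "s \<le> 1/2" for s
    unfolding Z_def by (rule test_function_norm2_translate[OF t0 tZ[OF that, unfolded Z_def]])
  have DF: "(F has_real_derivative G s) (at s)" for s
    unfolding F_def[abs_def] G_def by (rule integral_translate_derivative[OF uL t Basis_xy(2)])
  have DG: "(G has_real_derivative H s) (at s)" for s
    unfolding G_def[abs_def] H_def
    by (intro DERIV_cmult integral_translate_derivative[OF uL test_function_partial[OF t Basis_xy(2)] Basis_xy(2)])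
  have pZ: "part_y (Z s) = (\<lambda>p. part_y \<zeta> (p + s *\<^sub>R (\<tau> *\<^sub>R ?y)))" for s
    unfolding Z_def partial_translate[OF st] ..
  have ppZ: "part_y (part_y (Z s)) = (\<lambda>p. part_y (part_y \<zeta>) (p + s *\<^sub>R (\<tau> *\<^sub>R ?y)))" for s
    unfolding pZ partial_translate[OF smooth_partial[OF st Basis_xy(2)]] ..
  have Gv: "G s = - \<tau> * (LINT p|?M. v p * Z s p)" if "0 \<le> s" "s \<le> 1/2" for s
    using L2_derivD(3)[OF v tZ[OF that]] unfolding G_def fun_cong[OF pZ, symmetric] by simp
  have Hw: "H s = (LINT p|?M. w p * Z s p)" if "0 \<le> s" "s \<le> 1/2" for s
  proof -
    have "\<tau> * \<tau> = 1" using \<tau> by (metis abs_mult_self_eq mult_1)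
    then have "H s = (LINT p|?M. u p * part_y (part_y (Z s)) p)"
      unfolding H_def fun_cong[OF ppZ, symmetric] by (simp add: mult.assoc[symmetric])
    then show ?thesis
      using L2_derivD(3)[OF v test_function_partial[OF tZ[OF that] Basis_xy(2)]]
        L2_derivD(3)[OF w tZ[OF that]] by simp
  qed
  define D where "D m = (if m = 0 then F else if m = 1 then G else H)" for m :: nat
  have D: "D 0 = F" "D (Suc 0) = G" "D (Suc (Suc 0)) = H" by (simp_all add: D_def)
  have "(D m has_real_derivative D (Suc m) t) (at t)" if m: "m < 2" for m t
  proof -
    consider "m = 0" | "m = Suc 0" using m by linarith
    then show ?thesis by cases (simp_all add: D DF DG)
  qed
  then obtain x where x: "0 < x" "x < l" "F l = (\<Sum>m<2. D m 0 / fact m * l ^ m) + D 2 x / fact 2 * l\<^sup>2"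
    using Maclaurin[of l 2 D F] l(1) D(1) by auto
  have T: "F l = F 0 + l * G 0 + l\<^sup>2 / 2 * H x"
    using x(3) by (simp add: numeral_2_eq_2 D)
  have bF: "\<bar>F s\<bar> \<le> norm2 (Omega L) u * norm2 (Omega L) \<zeta>" if "0 \<le> s" "s \<le> 1/2" for s
    using L2_Cauchy_Schwarz[OF uL test_function_L2[OF tZ[OF that]]] nZ[OF that] by (simp add: F_def Z_def)
  have bH: "\<bar>H x\<bar> \<le> norm2 (Omega L) w * norm2 (Omega L) \<zeta>"
    using L2_Cauchy_Schwarz[OF wL test_function_L2[OF tZ[of x]]] nZ[of x] Hw[of x] x l by simp
  have "l * \<bar>G 0\<bar> = \<bar>F l - F 0 - l\<^sup>2 / 2 * H x\<bar>" using T l by (simp add: abs_mult)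
  also have "\<dots> \<le> \<bar>F l\<bar> + \<bar>F 0\<bar> + l\<^sup>2 / 2 * \<bar>H x\<bar>"
    using abs_triangle_ineq4[of "F l - F 0" "l\<^sup>2 / 2 * H x"] abs_triangle_ineq4[of "F l" "F 0"] by (simp add: abs_mult)
  also have "\<dots> \<le> norm2 (Omega L) u * norm2 (Omega L) \<zeta> + norm2 (Omega L) u * norm2 (Omega L) \<zeta>
      + l\<^sup>2 / 2 * (norm2 (Omega L) w * norm2 (Omega L) \<zeta>)"
    using l by (intro add_mono bF mult_left_mono bH) auto
  finally have "\<bar>G 0\<bar> \<le> (2 * (norm2 (Omega L) u * norm2 (Omega L) \<zeta>) + l\<^sup>2 / 2 * (norm2 (Omega L) w * norm2 (Omega L) \<zeta>)) / l"
    using l by (simp add: pos_le_divide_eq mult.commute)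
  also have "\<dots> = (2 / l * norm2 (Omega L) u + l / 2 * norm2 (Omega L) w) * norm2 (Omega L) \<zeta>"
    using l by (simp add: field_simps power2_eq_square)
  also have "\<bar>G 0\<bar> = \<bar>LINT p|?M. v p * \<zeta> p\<bar>"
    using Gv[of 0] \<tau> by (simp add: Z0 abs_mult)
  finally show ?thesis .
qed

text \<open>To turn the dual bound into a bound on the norm, test with \<open>v\<close> itself. The derivatives of the
  smooth approximations of \<open>u\<close> converge to \<open>v\<close>, and multiplied by a cutoff they are test functions.\<close>

lemma interpolation_cutoff:
  assumes v: "L2_deriv L (0, 1) u v" and w: "L2_deriv L (0, 1) v w" and L: "L > 0"
    and \<tau>: "\<bar>\<tau>\<bar> = 1" and sh: "\<And>s y. 0 \<le> s \<Longrightarrow> s \<le> 1/2 \<Longrightarrow> c < y + s * \<tau> \<Longrightarrow> y + s * \<tau> < d \<Longrightarrow> 0 < y \<and> y < 1"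
    and \<phi>: "\<And>n. smooth (\<phi> n)" "(\<lambda>n. norm2 (Omega L) (\<lambda>p. part_y (\<phi> n) p - v p)) \<longlonglongrightarrow> 0"
    and l: "0 < l" "l \<le> 1/2"
  shows "norm2 (Omega L) (\<lambda>p. v p * cutoff 0 L c d k p) \<le> 2 / l * norm2 (Omega L) u + l / 2 * norm2 (Omega L) w"
    (is "norm2 _ ?g \<le> ?K")
proof -
  let ?M = "lebesgue_on (Omega L)" and ?\<chi> = "cutoff 0 L c d k"
  note vL = L2_derivD(2)[OF v]
  have m: "?\<chi> \<in> borel_measurable ?M" by (rule smooth_measurable[OF smooth_cutoff])
  have b: "\<bar>?\<chi> p\<bar> \<le> 1" for p using cutoff_bounds[of 0 L c d k p] by simp
  define \<zeta> where "\<zeta> n p = part_y (\<phi> n) p * ?\<chi> p" for n p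
  have t: "test_function ({0..L} \<times> {c..d}) (\<zeta> n)" for n
    unfolding \<zeta>_def by (rule test_function_mult_cutoff[OF smooth_partial[OF \<phi>(1) Basis_xy(2)]]) auto
  have gL: "?g \<in> L2 (Omega L)" using L2_bounded_mult(1)[OF vL m b] .
  have \<zeta>L: "\<zeta> n \<in> L2 (Omega L)" for n by (rule smooth_L2[OF test_function_smooth[OF t]])
  have lim: "(\<lambda>n. norm2 (Omega L) (\<lambda>p. \<zeta> n p - ?g p)) \<longlonglongrightarrow> 0"
  proof (rule tendsto_sandwich[OF always_eventually always_eventually tendsto_const \<phi>(2)])
    show "\<forall>n. norm2 (Omega L) (\<lambda>p. \<zeta> n p - ?g p) \<le> norm2 (Omega L) (\<lambda>p. part_y (\<phi> n) p - v p)"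
      using L2_bounded_mult(2)[OF L2_diff[OF smooth_partial_L2[OF \<phi>(1) Basis_xy(2)] vL] m b]
      by (simp add: \<zeta>_def left_diff_distrib)
  qed simp
  have 1: "(\<lambda>n. \<bar>LINT p|?M. \<zeta> n p * v p\<bar>) \<longlonglongrightarrow> \<bar>LINT p|?M. ?g p * v p\<bar>"
    by (intro tendsto_rabs L2_inner_tendsto \<zeta>L gL lim vL)
  have 2: "(\<lambda>n. ?K * norm2 (Omega L) (\<zeta> n)) \<longlonglongrightarrow> ?K * norm2 (Omega L) ?g"
    by (intro tendsto_mult_left norm2_tendsto[OF \<zeta>L gL lim])
  have "\<bar>LINT p|?M. \<zeta> n p * v p\<bar> \<le> ?K * norm2 (Omega L) (\<zeta> n)" for n
    using landau_dual[OF v w L \<tau> sh t l] by (simp add: mult.commute[of "v _"])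
  then have 3: "\<bar>LINT p|?M. ?g p * v p\<bar> \<le> ?K * norm2 (Omega L) ?g"
    by (intro LIMSEQ_le[OF 1 2]) auto
  have "(norm2 (Omega L) ?g)\<^sup>2 \<le> (LINT p|?M. ?g p * v p)"
    unfolding norm2_power2
  proof (rule integral_mono)
    show "integrable ?M (\<lambda>p. (?g p)\<^sup>2)" by (rule L2_square_integrable[OF gL])
    show "integrable ?M (\<lambda>p. ?g p * v p)" by (rule L2_mult_integrable[OF gL vL])
    fix p
    have "?\<chi> p * ?\<chi> p \<le> ?\<chi> p" using cutoff_bounds[of 0 L c d k p] by (intro mult_left_le) auto
    then have "(v p)\<^sup>2 * (?\<chi> p * ?\<chi> p) \<le> (v p)\<^sup>2 * ?\<chi> p" by (intro mult_left_mono) auto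
    then show "(?g p)\<^sup>2 \<le> ?g p * v p" by (simp add: power2_eq_square mult_ac)
  qed
  with 3 have "norm2 (Omega L) ?g * norm2 (Omega L) ?g \<le> ?K * norm2 (Omega L) ?g"
    by (simp add: power2_eq_square)
  then show ?thesis
    using l by (cases "norm2 (Omega L) ?g = 0") (auto simp: mult_le_cancel_right less_le)
qed

text \<open>The lower half of the rectangle can be moved up and the upper half down, each by at most \<open>1/2\<close>;
  this is the origin of the bound on \<open>l\<close>.\<close>

lemma interpolation:
  assumes v: "L2_deriv L (0, 1) u v" and w: "L2_deriv L (0, 1) v w" and L: "L > 0"
    and \<phi>: "\<And>n. smooth (\<phi> n)" "(\<lambda>n. norm2 (Omega L) (\<lambda>p. part_y (\<phi> n) p - v p)) \<longlonglongrightarrow> 0"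
    and l: "0 < l" "l \<le> 1/2"
  shows "(norm2 (Omega L) v)\<^sup>2 \<le> 16 / l\<^sup>2 * (norm2 (Omega L) u)\<^sup>2 + l\<^sup>2 * (norm2 (Omega L) w)\<^sup>2"
proof -
  let ?M = "lebesgue_on (Omega L)"
  let ?U = "norm2 (Omega L) u" and ?W = "norm2 (Omega L) w"
  let ?K = "2 / l * ?U + l / 2 * ?W"
  note vL = L2_derivD(2)[OF v]
  define g1 where "g1 k p = v p * cutoff 0 L 0 (1/2) k p" for k p
  define g2 where "g2 k p = v p * cutoff 0 L (1/2) 1 k p" for k p
  have gL: "g1 k \<in> L2 (Omega L)" "g2 k \<in> L2 (Omega L)" for k
    unfolding g1_def g2_def using cutoff_bounds
    by (intro L2_bounded_mult(1)[OF vL, where C=1] smooth_measurable smooth_cutoff; simp)+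
  have b1: "norm2 (Omega L) (g1 k) \<le> ?K" for k
    unfolding g1_def by (rule interpolation_cutoff[OF v w L, of "-1", OF _ _ \<phi> l]) auto
  have b2: "norm2 (Omega L) (g2 k) \<le> ?K" for k
    unfolding g2_def by (rule interpolation_cutoff[OF v w L, of "1", OF _ _ \<phi> l]) auto
  have K0: "?K \<ge> 0" using l by simp
  have b: "(LINT p|?M. (g1 k p)\<^sup>2 + (g2 k p)\<^sup>2) \<le> 2 * ?K\<^sup>2" for k
  proof -
    have "(LINT p|?M. (g1 k p)\<^sup>2 + (g2 k p)\<^sup>2) = (norm2 (Omega L) (g1 k))\<^sup>2 + (norm2 (Omega L) (g2 k))\<^sup>2"
      unfolding norm2_power2 by (rule Bochner_Integration.integral_add) (intro L2_square_integrable gL)+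
    also have "\<dots> \<le> ?K\<^sup>2 + ?K\<^sup>2" by (intro add_mono power_mono b1 b2) auto
    finally show ?thesis by simp
  qed
  have "(\<lambda>k. LINT p|?M. (g1 k p)\<^sup>2 + (g2 k p)\<^sup>2) \<longlonglongrightarrow> (LINT p|?M. (v p)\<^sup>2)"
  proof (rule integral_dominated_convergence[where w="\<lambda>p. 2 * (v p)\<^sup>2"])
    show "(\<lambda>p. (v p)\<^sup>2) \<in> borel_measurable ?M" using L2_measurable[OF vL] by measurable
    show "(\<lambda>p. (g1 k p)\<^sup>2 + (g2 k p)\<^sup>2) \<in> borel_measurable ?M" for k
      using L2_measurable[OF gL(1)[of k]] L2_measurable[OF gL(2)[of k]] by measurable
    show "integrable ?M (\<lambda>p. 2 * (v p)\<^sup>2)" using L2_square_integrable[OF vL] by simp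
    show "AE p in ?M. norm ((g1 k p)\<^sup>2 + (g2 k p)\<^sup>2) \<le> 2 * (v p)\<^sup>2" for k
    proof (rule AE_I2)
      fix p
      have "(v p)\<^sup>2 * (cutoff 0 L c d k p)\<^sup>2 \<le> (v p)\<^sup>2" for c d
        using cutoff_bounds[of 0 L c d k p] by (intro mult_left_le power_le_one) auto
      from this[of 0 "1/2"] this[of "1/2" 1]
      show "norm ((g1 k p)\<^sup>2 + (g2 k p)\<^sup>2) \<le> 2 * (v p)\<^sup>2"
        by (simp add: g1_def g2_def power_mult_distrib)
    qed
    have half: "AE p in ?M. p \<in> cbox (0, c) (L, d) \<longrightarrow> p \<in> box (0, c) (L, d)" for c d :: real
    proof (rule AE_lebesgue_onI[OF _ Omega_sets])
      show "AE p in lebesgue. p \<in> cbox (0, c) (L, d) \<longrightarrow> p \<in> box (0, c) (L, d)"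
        using AE_in_open_box[of "(0, c)" "(L, d)"] by (simp add: AE_restrict_space_iff)
    qed
    have "AE p in ?M. p \<in> Omega L" by (rule AE_I2) simp
    with half[of 0 "1/2"] half[of "1/2" 1]
    show "AE p in ?M. (\<lambda>k. (g1 k p)\<^sup>2 + (g2 k p)\<^sup>2) \<longlonglongrightarrow> (v p)\<^sup>2"
    proof eventually_elim
      case (elim p)
      have "(\<lambda>k. (g1 k p)\<^sup>2 + (g2 k p)\<^sup>2) \<longlonglongrightarrow> (v p * indicator ({0<..<L} \<times> {0<..<1/2}) p)\<^sup>2
          + (v p * indicator ({0<..<L} \<times> {1/2<..<1}) p)\<^sup>2"
        unfolding g1_def g2_def by (intro tendsto_intros cutoff_tendsto)
      moreover have "(v p * indicator ({0<..<L} \<times> {0<..<1/2}) p)\<^sup>2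
          + (v p * indicator ({0<..<L} \<times> {1/2<..<1}) p)\<^sup>2 = (v p)\<^sup>2"
      proof (cases "snd p \<le> 1/2")
        case True
        then have "p \<in> {0<..<L} \<times> {0<..<1/2}" "p \<notin> {0<..<L} \<times> {1/2<..<1}"
          using elim by (cases p; auto simp: Omega_def cbox_real2 box_real2)+
        then show ?thesis by simp
      next
        case False
        then have "p \<notin> {0<..<L} \<times> {0<..<1/2}" "p \<in> {0<..<L} \<times> {1/2<..<1}"
          using elim by (cases p; auto simp: Omega_def cbox_real2 box_real2)+
        then show ?thesis by simp
      qed
      ultimately show ?case by simp
    qed
  qed
  then have "(norm2 (Omega L) v)\<^sup>2 \<le> 2 * ?K\<^sup>2"
    unfolding norm2_power2 by (rule LIMSEQ_le_const2) (use b in auto)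
  also have "\<dots> \<le> 16 / l\<^sup>2 * ?U\<^sup>2 + l\<^sup>2 * ?W\<^sup>2"
  proof -
    have "(x + y)\<^sup>2 \<le> 2 * x\<^sup>2 + 2 * y\<^sup>2" for x y :: real
      using sum_squares_bound[of x y] by (simp add: power2_sum)
    from this[of "2 / l * ?U" "l / 2 * ?W"] show ?thesis
      by (simp add: power_mult_distrib power_divide)
  qed
  finally show ?thesis .
qed

section \<open>The admissible classes\<close>

definition D2 :: "real \<Rightarrow> real \<times> real \<Rightarrow> real \<times> real \<Rightarrow> (real \<times> real \<Rightarrow> real) \<Rightarrow> real \<times> real \<Rightarrow> real" where
  "D2 L j k u = weak_deriv (Omega L) j (weak_deriv (Omega L) k u)"

text \<open>The pair \<open>(j, k)\<close> stands for the derivative of the \<open>k\<close>-th first derivative in direction \<open>j\<close>. The three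
  models differ in this set only, which allows one proof for all of them.\<close>

primrec second_order :: "model \<Rightarrow> ((real \<times> real) \<times> (real \<times> real)) set" where
  "second_order Model1 = {((0, 1), (0, 1))}"
| "second_order Model2 = {((1, 0), (0, 1)), ((0, 1), (0, 1))}"
| "second_order Model3 = {((1, 0), (1, 0)), ((0, 1), (1, 0)), ((1, 0), (0, 1)), ((0, 1), (0, 1))}"

lemma second_order_finite [simp]: "finite (second_order i)"
  and second_order_yy [simp]: "((0, 1), (0, 1)) \<in> second_order i"
  and second_order_Basis: "(j, k) \<in> second_order i \<Longrightarrow> j \<in> Basis \<and> k \<in> Basis"
  by (cases i; auto)+

definition periodic_trace :: "real \<Rightarrow> (real \<times> real \<Rightarrow> real) \<Rightarrow> bool" where
  "periodic_trace L u \<longleftrightarrow> (\<exists>g. has_trace (Omega L) (\<lambda>x. (x, 0)) {0..L} u g \<and>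
     has_trace (Omega L) (\<lambda>x. (x, 1)) {0..L} u g)"

lemma W12_weak_deriv:
  "u \<in> W12 (Omega L) \<longleftrightarrow> (\<forall>k\<in>Basis. L2_deriv L k u (weak_deriv (Omega L) k u))"
  using L2_deriv_weak_deriv(1) by (auto simp: W12_iff Basis_real2)

lemma adm_iff:
  "u \<in> adm i L \<longleftrightarrow> periodic_trace L u \<and> vanishes_left L u \<and>
    (\<forall>k\<in>Basis. L2_deriv L k u (weak_deriv (Omega L) k u)) \<and>
    (\<forall>(j, k)\<in>second_order i. L2_deriv L j (weak_deriv (Omega L) k u) (D2 L j k u))"
proof -
  let ?W = "\<forall>k\<in>Basis. L2_deriv L k u (weak_deriv (Omega L) k u)"
  have p: "u \<in> W12p L \<longleftrightarrow> periodic_trace L u \<and> ?W"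
    by (auto simp: W12p_def periodic_trace_def W12_weak_deriv)
  have 1: "(\<exists>v\<in>L2 (Omega L). has_weak_deriv (Omega L) (0, 1) (D\<^sub>y L u) v) \<longleftrightarrow> L2_deriv L (0, 1) (D\<^sub>y L u) (D2 L (0, 1) (0, 1) u)"
    if W: ?W
  proof
    assume "\<exists>v\<in>L2 (Omega L). has_weak_deriv (Omega L) (0, 1) (D\<^sub>y L u) v"
    then obtain v where v: "v \<in> L2 (Omega L)" "has_weak_deriv (Omega L) (0, 1) (D\<^sub>y L u) v" by blast
    have "D\<^sub>y L u \<in> L2 (Omega L)" by (rule L2_derivD(2)[OF W[rule_format, OF Basis_xy(2)]])
    with v have "L2_deriv L (0, 1) (D\<^sub>y L u) v" by (simp add: L2_deriv_def)
    then show "L2_deriv L (0, 1) (D\<^sub>y L u) (D2 L (0, 1) (0, 1) u)"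
      unfolding D2_def by (rule L2_deriv_weak_deriv(1))
  next
    assume "L2_deriv L (0, 1) (D\<^sub>y L u) (D2 L (0, 1) (0, 1) u)"
    then show "\<exists>v\<in>L2 (Omega L). has_weak_deriv (Omega L) (0, 1) (D\<^sub>y L u) v"
      unfolding L2_deriv_def by blast
  qed
  show ?thesis
    using p 1 by (cases i) (auto simp: adm1_def adm2_def adm3_def W12_weak_deriv Basis_real2 D2_def)
qed

definition elastic :: "model \<Rightarrow> real \<Rightarrow> real \<Rightarrow> (real \<times> real \<Rightarrow> real) \<Rightarrow> real" where
  "elastic i L \<epsilon> u = \<epsilon>\<^sup>2 * (\<Sum>(j, k)\<in>second_order i. (norm2 (Omega L) (D2 L j k u))\<^sup>2) + (norm2 (Omega L) (D\<^sub>x L u))\<^sup>2"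

lemma elastic_nonneg: "elastic i L \<epsilon> u \<ge> 0"
  unfolding elastic_def by (intro add_nonneg_nonneg mult_nonneg_nonneg sum_nonneg) auto

lemma energy_eq_elastic:
  assumes "u \<in> adm i L"
  shows "energy i L \<epsilon> \<Delta> u = elastic i L \<epsilon> u + \<Delta> * measure lebesgue (A_set L u)"
proof -
  have x: "integrable (lebesgue_on (Omega L)) (\<lambda>p. (D\<^sub>x L u p)\<^sup>2)"
    using assms by (intro L2_square_integrable L2_derivD(2)[of L "(1, 0)" u]) (simp add: adm_iff)
  have jk: "integrable (lebesgue_on (Omega L)) (\<lambda>p. (weak_deriv (Omega L) j (weak_deriv (Omega L) k u) p)\<^sup>2)"
    if "(j, k) \<in> second_order i" for j k
    using assms that by (intro L2_square_integrable L2_derivD(2)[of L j "weak_deriv (Omega L) k u"])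
      (auto simp: adm_iff D2_def)
  show ?thesis
    using x jk by (cases i) (auto simp: E1_def E2_def E3_def elastic_def norm2_power2 D2_def algebra_simps)
qed

text \<open>The second derivatives in the definition are taken of the selected first derivatives; any other
  representatives serve as well.\<close>

lemma admI:
  assumes a: "\<And>k. k \<in> Basis \<Longrightarrow> L2_deriv L k u (a k)"
    and b: "\<And>j k. (j, k) \<in> second_order i \<Longrightarrow> L2_deriv L j (a k) (b j k)"
    and t: "periodic_trace L u" "vanishes_left L u"
  shows "u \<in> adm i L"
    "\<And>k. k \<in> Basis \<Longrightarrow> AE p in lebesgue_on (Omega L). weak_deriv (Omega L) k u p = a k p"
    "\<And>j k. (j, k) \<in> second_order i \<Longrightarrow> AE p in lebesgue_on (Omega L). D2 L j k u p = b j k p"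
proof -
  show A: "AE p in lebesgue_on (Omega L). weak_deriv (Omega L) k u p = a k p" if "k \<in> Basis" for k
    by (rule L2_deriv_weak_deriv(2)[OF a[OF that]])
  have B: "L2_deriv L j (weak_deriv (Omega L) k u) (b j k)" if "(j, k) \<in> second_order i" for j k
  proof (rule L2_deriv_cong_AE[OF b[OF that]])
    show "AE p in lebesgue_on (Omega L). a k p = weak_deriv (Omega L) k u p"
      using A[of k] second_order_Basis[OF that] by (auto elim: AE_mp)
  qed (use second_order_Basis[OF that] in auto)
  show "AE p in lebesgue_on (Omega L). D2 L j k u p = b j k p" if "(j, k) \<in> second_order i" for j k
    unfolding D2_def by (rule L2_deriv_weak_deriv(2)[OF B[OF that]])
  show "u \<in> adm i L"
    unfolding adm_iff D2_def using L2_deriv_weak_deriv(1)[OF a] L2_deriv_weak_deriv(1)[OF B] t by auto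
qed

lemma adm_derivs:
  assumes "u \<in> adm i L"
  shows "u \<in> L2 (Omega L)" "L2_deriv L (1, 0) u (D\<^sub>x L u)" "L2_deriv L (0, 1) u (D\<^sub>y L u)"
    "\<And>k. k \<in> Basis \<Longrightarrow> L2_deriv L k u (weak_deriv (Omega L) k u)"
    "\<And>k. k \<in> Basis \<Longrightarrow> weak_deriv (Omega L) k u \<in> L2 (Omega L)"
    "\<And>j k. (j, k) \<in> second_order i \<Longrightarrow> L2_deriv L j (weak_deriv (Omega L) k u) (D2 L j k u)"
    "\<And>j k. (j, k) \<in> second_order i \<Longrightarrow> D2 L j k u \<in> L2 (Omega L)"
  using assms L2_derivD(1,2) Basis_xy unfolding adm_iff by blast+

lemma adm_poincare:
  assumes u: "u \<in> adm i L" and L: "L > 0"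
  shows "(norm2 (Omega L) u)\<^sup>2 \<le> 2 * L\<^sup>2 * (norm2 (Omega L) (D\<^sub>x L u))\<^sup>2"
  using u by (intro poincare_left[OF adm_derivs(2,3)[OF u] _ L]) (simp add: adm_iff)

lemma adm_interpolation:
  assumes u: "u \<in> adm i L" and L: "L > 0" and l: "0 < l" "l \<le> 1/2"
  shows "(norm2 (Omega L) (D\<^sub>y L u))\<^sup>2
    \<le> 16 / l\<^sup>2 * (norm2 (Omega L) u)\<^sup>2 + l\<^sup>2 * (norm2 (Omega L) (D2 L (0, 1) (0, 1) u))\<^sup>2"
proof -
  have t: "has_trace (Omega L) (\<lambda>y. (0, y)) {0..1} u (\<lambda>y. 0)"
    using u by (simp add: adm_iff vanishes_left_def)
  show ?thesis
    by (rule has_trace_sequence[OF adm_derivs(2,3)[OF u] t])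
      (rule interpolation[OF adm_derivs(3)[OF u] adm_derivs(6)[OF u second_order_yy] L _ _ l]; assumption)
qed

lemma adm_linear:
  fixes \<alpha> \<beta> :: real
  assumes u: "u \<in> adm i L" and v: "v \<in> adm i L"
  defines "w \<equiv> \<lambda>p. \<alpha> * u p + \<beta> * v p"
  shows "w \<in> adm i L"
    "\<And>k. k \<in> Basis \<Longrightarrow> AE p in lebesgue_on (Omega L).
        weak_deriv (Omega L) k w p = \<alpha> * weak_deriv (Omega L) k u p + \<beta> * weak_deriv (Omega L) k v p"
    "\<And>j k. (j, k) \<in> second_order i \<Longrightarrow> AE p in lebesgue_on (Omega L).
        D2 L j k w p = \<alpha> * D2 L j k u p + \<beta> * D2 L j k v p"
proof -
  note U = adm_derivs[OF u] and V = adm_derivs[OF v]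
  have tr: "has_trace (Omega L) \<gamma> {c..d} w (\<lambda>t. \<alpha> * g t + \<beta> * h t)"
    if "has_trace (Omega L) \<gamma> {c..d} u g" "has_trace (Omega L) \<gamma> {c..d} v h" "continuous_on {c..d} \<gamma>"
    for \<gamma> c d g h
    unfolding w_def by (rule has_trace_linear[OF U(2,3) that(1) V(2,3) that(2,3)])
  have 1: "L2_deriv L k w (\<lambda>p. \<alpha> * weak_deriv (Omega L) k u p + \<beta> * weak_deriv (Omega L) k v p)" if "k \<in> Basis" for k
    unfolding w_def by (rule L2_deriv_linear[OF U(4)[OF that] V(4)[OF that] that])
  have 2: "L2_deriv L j (\<lambda>p. \<alpha> * weak_deriv (Omega L) k u p + \<beta> * weak_deriv (Omega L) k v p)
      (\<lambda>p. \<alpha> * D2 L j k u p + \<beta> * D2 L j k v p)" if "(j, k) \<in> second_order i" for j k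
    using second_order_Basis[OF that] by (intro L2_deriv_linear U(6) V(6) that) auto
  have 3: "periodic_trace L w"
  proof -
    obtain g h where g: "has_trace (Omega L) (\<lambda>x. (x, 0)) {0..L} u g" "has_trace (Omega L) (\<lambda>x. (x, 1)) {0..L} u g"
      and h: "has_trace (Omega L) (\<lambda>x. (x, 0)) {0..L} v h" "has_trace (Omega L) (\<lambda>x. (x, 1)) {0..L} v h"
      using u v unfolding adm_iff periodic_trace_def by blast
    show ?thesis unfolding periodic_trace_def
      by (intro exI[of _ "\<lambda>t. \<alpha> * g t + \<beta> * h t"] conjI tr g h continuous_intros)
  qed
  have 4: "vanishes_left L w"
  proof -
    have "has_trace (Omega L) (\<lambda>y. (0, y)) {0..1} w (\<lambda>t. \<alpha> * 0 + \<beta> * 0)"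
      using u v by (intro tr continuous_intros) (auto simp: adm_iff vanishes_left_def)
    then show ?thesis by (simp add: vanishes_left_def)
  qed
  note A = admI[OF 1 2 3 4]
  show "w \<in> adm i L" by (rule A(1))
  show "AE p in lebesgue_on (Omega L).
      weak_deriv (Omega L) k w p = \<alpha> * weak_deriv (Omega L) k u p + \<beta> * weak_deriv (Omega L) k v p"
    if "k \<in> Basis" for k using that by (rule A(2)[rotated -1])
  show "AE p in lebesgue_on (Omega L). D2 L j k w p = \<alpha> * D2 L j k u p + \<beta> * D2 L j k v p"
    if "(j, k) \<in> second_order i" for j k using that by (rule A(3)[rotated -1])
qed

lemma adm_linear_norm:
  assumes u: "u \<in> adm i L" and v: "v \<in> adm i L"
  shows "k \<in> Basis \<Longrightarrow> norm2 (Omega L) (weak_deriv (Omega L) k (\<lambda>p. \<alpha> * u p + \<beta> * v p))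
      = norm2 (Omega L) (\<lambda>p. \<alpha> * weak_deriv (Omega L) k u p + \<beta> * weak_deriv (Omega L) k v p)"
    "(j, k) \<in> second_order i \<Longrightarrow> norm2 (Omega L) (D2 L j k (\<lambda>p. \<alpha> * u p + \<beta> * v p))
      = norm2 (Omega L) (\<lambda>p. \<alpha> * D2 L j k u p + \<beta> * D2 L j k v p)"
proof -
  note w = adm_linear[OF u v, where \<alpha>=\<alpha> and \<beta>=\<beta>]
  note U = adm_derivs[OF u] and V = adm_derivs[OF v] and W = adm_derivs[OF w(1)]
  show "norm2 (Omega L) (weak_deriv (Omega L) k (\<lambda>p. \<alpha> * u p + \<beta> * v p))
      = norm2 (Omega L) (\<lambda>p. \<alpha> * weak_deriv (Omega L) k u p + \<beta> * weak_deriv (Omega L) k v p)" if "k \<in> Basis"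
    by (intro norm2_cong_AE W(5) w(2) L2_add L2_scale U(5) V(5) that)
  show "norm2 (Omega L) (D2 L j k (\<lambda>p. \<alpha> * u p + \<beta> * v p))
      = norm2 (Omega L) (\<lambda>p. \<alpha> * D2 L j k u p + \<beta> * D2 L j k v p)" if "(j, k) \<in> second_order i"
    by (intro norm2_cong_AE W(7) w(3) L2_add L2_scale U(7) V(7) that)
qed

lemma adm_diff:
  assumes u: "u \<in> adm i L" and v: "v \<in> adm i L"
  shows "(\<lambda>p. u p - v p) \<in> adm i L"
    "k \<in> Basis \<Longrightarrow> norm2 (Omega L) (weak_deriv (Omega L) k (\<lambda>p. u p - v p))
      = norm2 (Omega L) (\<lambda>p. weak_deriv (Omega L) k u p - weak_deriv (Omega L) k v p)"
    "(j, k) \<in> second_order i \<Longrightarrow> norm2 (Omega L) (D2 L j k (\<lambda>p. u p - v p))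
      = norm2 (Omega L) (\<lambda>p. D2 L j k u p - D2 L j k v p)"
  using adm_linear(1)[OF u v, where \<alpha>=1 and \<beta>="-1"]
    adm_linear_norm(1)[OF u v, where \<alpha>=1 and \<beta>="-1" and k=k]
    adm_linear_norm(2)[OF u v, where \<alpha>=1 and \<beta>="-1" and k=k and j=j] by simp_all

lemma smooth_adm:
  assumes s: "smooth u" and L: "L > 0" and per: "\<And>x. u (x, 1) = u (x, 0)" and left: "\<And>y. u (0, y) = 0"
  shows "u \<in> adm i L"
    "k \<in> Basis \<Longrightarrow> AE p in lebesgue_on (Omega L). weak_deriv (Omega L) k u p = frechet_derivative u (at p) k"
    "(j, k) \<in> second_order i \<Longrightarrow> AE p in lebesgue_on (Omega L).
       D2 L j k u p = frechet_derivative (\<lambda>p. frechet_derivative u (at p) k) (at p) j"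
proof -
  have 1: "L2_deriv L k u (\<lambda>p. frechet_derivative u (at p) k)" if "k \<in> Basis" for k
    by (rule smooth_L2_deriv[OF s that L])
  have 2: "L2_deriv L j (\<lambda>p. frechet_derivative u (at p) k)
      (\<lambda>p. frechet_derivative (\<lambda>p. frechet_derivative u (at p) k) (at p) j)" if "(j, k) \<in> second_order i" for j k
    using second_order_Basis[OF that] by (intro smooth_L2_deriv smooth_partial s L) auto
  have tr: "has_trace (Omega L) \<gamma> {c..d} u (\<lambda>t. u (\<gamma> t))" if "continuous_on {c..d} \<gamma>" for \<gamma> c d
    unfolding has_trace_iff[OF 1[OF Basis_xy(1)] 1[OF Basis_xy(2)]]
    using s by (intro conjI allI impI smooth_along_curve_L2 that exI[of _ u]) (auto simp: trace_approx_def)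
  have 3: "periodic_trace L u"
    unfolding periodic_trace_def
  proof (intro exI[of _ "\<lambda>x. u (x, 0)"] conjI)
    show "has_trace (Omega L) (\<lambda>x. (x, 0)) {0..L} u (\<lambda>x. u (x, 0))"
      by (intro tr continuous_intros)
    have "has_trace (Omega L) (\<lambda>x. (x, 1)) {0..L} u (\<lambda>x. u (x, 1))"
      by (intro tr continuous_intros)
    then show "has_trace (Omega L) (\<lambda>x. (x, 1)) {0..L} u (\<lambda>x. u (x, 0))" by (simp add: per)
  qed
  have 4: "vanishes_left L u"
  proof -
    have "has_trace (Omega L) (\<lambda>y. (0, y)) {0..1} u (\<lambda>y. u (0, y))"
      by (intro tr continuous_intros)
    then show ?thesis by (simp add: left vanishes_left_def)
  qed
  show "u \<in> adm i L"
    "k \<in> Basis \<Longrightarrow> AE p in lebesgue_on (Omega L). weak_deriv (Omega L) k u p = frechet_derivative u (at p) k"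
    "(j, k) \<in> second_order i \<Longrightarrow> AE p in lebesgue_on (Omega L).
       D2 L j k u p = frechet_derivative (\<lambda>p. frechet_derivative u (at p) k) (at p) j"
    using admI[OF 1 2 3 4] by auto
qed

text \<open>The traces on the two horizontal edges coincide for each \<open>z n\<close>, and the trace inequality makes them
  a Cauchy sequence, so that their limit is a common trace of \<open>U\<close>.\<close>

lemma adm_limit:
  assumes z: "\<And>n. z n \<in> adm i L" and L: "L > 0"
    and U: "U \<in> L2 (Omega L)" "(\<lambda>n. norm2 (Omega L) (\<lambda>p. z n p - U p)) \<longlonglongrightarrow> 0"
    and A: "\<And>k. k \<in> Basis \<Longrightarrow> A k \<in> L2 (Omega L)"
      "\<And>k. k \<in> Basis \<Longrightarrow> (\<lambda>n. norm2 (Omega L) (\<lambda>p. weak_deriv (Omega L) k (z n) p - A k p)) \<longlonglongrightarrow> 0"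
    and B: "\<And>j k. (j, k) \<in> second_order i \<Longrightarrow> B j k \<in> L2 (Omega L)"
      "\<And>j k. (j, k) \<in> second_order i \<Longrightarrow> (\<lambda>n. norm2 (Omega L) (\<lambda>p. D2 L j k (z n) p - B j k p)) \<longlonglongrightarrow> 0"
  shows "U \<in> adm i L"
    "\<And>k. k \<in> Basis \<Longrightarrow> AE p in lebesgue_on (Omega L). weak_deriv (Omega L) k U p = A k p"
    "\<And>j k. (j, k) \<in> second_order i \<Longrightarrow> AE p in lebesgue_on (Omega L). D2 L j k U p = B j k p"
proof -
  note Z = adm_derivs[OF z]
  have 1: "L2_deriv L k U (A k)" if "k \<in> Basis" for k
    by (rule L2_deriv_limit[OF Z(4)[OF that] that U(1) A(1)[OF that] U(2) A(2)[OF that]])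
  have 2: "L2_deriv L j (A k) (B j k)" if "(j, k) \<in> second_order i" for j k
    using second_order_Basis[OF that] by (intro L2_deriv_limit[OF Z(6)[OF that] _ A(1) B(1) A(2) B(2)] that) auto
  have tr: "has_trace (Omega L) \<gamma> {c..d} U G"
    if "\<And>n. has_trace (Omega L) \<gamma> {c..d} (z n) (g n)" "(\<lambda>n. norm2 {c..d} (\<lambda>t. g n t - G t)) \<longlonglongrightarrow> 0"
      "G \<in> L2 {c..d}" "continuous_on {c..d} \<gamma>" for \<gamma> c d g G
    by (rule has_trace_limit[OF Z(2,3) that(1) 1[OF Basis_xy(1)] 1[OF Basis_xy(2)] U(2)
          A(2)[OF Basis_xy(1)] A(2)[OF Basis_xy(2)] that(2-4)])
  have 3: "periodic_trace L U"
  proof -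
    have "\<forall>n. \<exists>g. has_trace (Omega L) (\<lambda>x. (x, 0)) {0..L} (z n) g \<and> has_trace (Omega L) (\<lambda>x. (x, 1)) {0..L} (z n) g"
      using z by (auto simp: adm_iff periodic_trace_def)
    then obtain g where g: "\<And>n. has_trace (Omega L) (\<lambda>x. (x, 0)) {0..L} (z n) (g n)"
      "\<And>n. has_trace (Omega L) (\<lambda>x. (x, 1)) {0..L} (z n) (g n)" by metis
    have gL: "g n \<in> L2 {0..L}" for n using g(1) has_trace_iff[OF Z(2,3)] by blast
    have bound: "(norm2 {0..L} (\<lambda>t. g m t - g n t))\<^sup>2 \<le> 2 * (norm2 (Omega L) (\<lambda>p. z m p - z n p))\<^sup>2
        + 2 * (norm2 (Omega L) (\<lambda>p. D\<^sub>y L (z m) p - D\<^sub>y L (z n) p))\<^sup>2" for m n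
    proof -
      have "continuous_on {0..L} (\<lambda>x::real. (x, 0::real))" by (intro continuous_intros)
      from has_trace_linear[OF Z(2,3) g(1) Z(2,3) g(1) this, where \<alpha>=1 and \<beta>="-1"]
      have "has_trace (Omega L) (\<lambda>x. (x, 0)) {0..L} (\<lambda>p. 1 * z m p + (-1) * z n p) (\<lambda>t. 1 * g m t + (-1) * g n t)" by blast
      from trace_inequality[OF L2_deriv_linear[OF Z(2) Z(2) Basis_xy(1)] L2_deriv_linear[OF Z(3) Z(3) Basis_xy(2)] this L]
      show ?thesis by simp
    qed
    have C: "\<exists>N. \<forall>m\<ge>N. \<forall>n\<ge>N. norm2 {0..L} (\<lambda>t. g m t - g n t) < e" if e: "e > 0" for e
    proof -
      have e2: "e / 2 > 0" using e by simp
      obtain N1 where N1: "\<And>m n. m \<ge> N1 \<Longrightarrow> n \<ge> N1 \<Longrightarrow> norm2 (Omega L) (\<lambda>p. z m p - z n p) < e / 2"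
        using L2_convergent_imp_Cauchy[OF Z(1) U e2] by blast
      obtain N2 where N2: "\<And>m n. m \<ge> N2 \<Longrightarrow> n \<ge> N2 \<Longrightarrow> norm2 (Omega L) (\<lambda>p. D\<^sub>y L (z m) p - D\<^sub>y L (z n) p) < e / 2"
        using L2_convergent_imp_Cauchy[OF Z(5)[OF Basis_xy(2)] A(1)[OF Basis_xy(2)] A(2)[OF Basis_xy(2)] e2] by blast
      have "norm2 {0..L} (\<lambda>t. g m t - g n t) < e" if "m \<ge> max N1 N2" "n \<ge> max N1 N2" for m n
      proof -
        have "(norm2 (Omega L) (\<lambda>p. z m p - z n p))\<^sup>2 < (e / 2)\<^sup>2"
          "(norm2 (Omega L) (\<lambda>p. D\<^sub>y L (z m) p - D\<^sub>y L (z n) p))\<^sup>2 < (e / 2)\<^sup>2"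
          using N1[of m n] N2[of m n] that by (auto intro!: power_strict_mono)
        with bound[of m n] have "(norm2 {0..L} (\<lambda>t. g m t - g n t))\<^sup>2 < e\<^sup>2"
          by (simp add: power_divide)
        then show ?thesis using e by (auto intro: power2_less_imp_less)
      qed
      then show ?thesis by blast
    qed
    obtain G where "G \<in> L2 {0..L}" "(\<lambda>n. norm2 {0..L} (\<lambda>p. g n p - G p)) \<longlonglongrightarrow> 0"
      by (rule L2_complete[OF gL lmeasurable_interval(1) C])
    then show ?thesis
      unfolding periodic_trace_def
      by (intro exI[of _ G] conjI tr[OF g(1)] tr[OF g(2)] continuous_intros)
  qed
  have 4: "vanishes_left L U"
    unfolding vanishes_left_def
    by (rule tr[of _ _ _ "\<lambda>n y. 0"])
      (use z in \<open>auto simp: adm_iff vanishes_left_def L2_zero intro!: continuous_intros\<close>)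
  show "U \<in> adm i L"
    "\<And>k. k \<in> Basis \<Longrightarrow> AE p in lebesgue_on (Omega L). weak_deriv (Omega L) k U p = A k p"
    "\<And>j k. (j, k) \<in> second_order i \<Longrightarrow> AE p in lebesgue_on (Omega L). D2 L j k U p = B j k p"
    using admI[OF 1 2 3 4] by auto
qed

lemma elastic_parallelogram:
  assumes u: "u \<in> adm i L" and v: "v \<in> adm i L"
  shows "elastic i L \<epsilon> (\<lambda>p. u p - v p)
     = 2 * elastic i L \<epsilon> u + 2 * elastic i L \<epsilon> v - 4 * elastic i L \<epsilon> (\<lambda>p. 1/2 * u p + 1/2 * v p)"
proof -
  let ?n = "norm2 (Omega L)"
  have *: "(?n (\<lambda>p. f p - g p))\<^sup>2 = 2 * (?n f)\<^sup>2 + 2 * (?n g)\<^sup>2 - 4 * (?n (\<lambda>p. 1/2 * f p + 1/2 * g p))\<^sup>2"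
    if "f \<in> L2 (Omega L)" "g \<in> L2 (Omega L)" for f g
  proof -
    have "(?n (\<lambda>p. 1/2 * f p + 1/2 * g p))\<^sup>2 = (?n (\<lambda>p. 1/2 * (f p + g p)))\<^sup>2" by (simp add: add_divide_distrib)
    also have "\<dots> = 1/4 * (?n (\<lambda>p. f p + g p))\<^sup>2" unfolding norm2_scale by (simp add: power_divide)
    finally show ?thesis using norm2_parallelogram[OF that] by simp
  qed
  note U = adm_derivs[OF u] and V = adm_derivs[OF v]
  have x: "(?n (D\<^sub>x L (\<lambda>p. u p - v p)))\<^sup>2 = 2 * (?n (D\<^sub>x L u))\<^sup>2 + 2 * (?n (D\<^sub>x L v))\<^sup>2
      - 4 * (?n (D\<^sub>x L (\<lambda>p. 1/2 * u p + 1/2 * v p)))\<^sup>2"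
    using *[OF U(5)[OF Basis_xy(1)] V(5)[OF Basis_xy(1)]] adm_diff(2)[OF u v Basis_xy(1)]
      adm_linear_norm(1)[OF u v Basis_xy(1), where \<alpha>="1/2" and \<beta>="1/2"] by simp
  have s: "(?n (D2 L j k (\<lambda>p. u p - v p)))\<^sup>2 = 2 * (?n (D2 L j k u))\<^sup>2 + 2 * (?n (D2 L j k v))\<^sup>2
      - 4 * (?n (D2 L j k (\<lambda>p. 1/2 * u p + 1/2 * v p)))\<^sup>2" if "(j, k) \<in> second_order i" for j k
    using *[OF U(7)[OF that] V(7)[OF that]] adm_diff(3)[OF u v that]
      adm_linear_norm(2)[OF u v that, where \<alpha>="1/2" and \<beta>="1/2"] by simp
  have "(\<Sum>(j, k)\<in>second_order i. (?n (D2 L j k (\<lambda>p. u p - v p)))\<^sup>2)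
      = (\<Sum>(j, k)\<in>second_order i. 2 * (?n (D2 L j k u))\<^sup>2 + 2 * (?n (D2 L j k v))\<^sup>2
      - 4 * (?n (D2 L j k (\<lambda>p. 1/2 * u p + 1/2 * v p)))\<^sup>2)"
    by (intro sum.cong refl) (auto simp: s)
  also have "\<dots> = 2 * (\<Sum>(j, k)\<in>second_order i. (?n (D2 L j k u))\<^sup>2) + 2 * (\<Sum>(j, k)\<in>second_order i. (?n (D2 L j k v))\<^sup>2)
      - 4 * (\<Sum>(j, k)\<in>second_order i. (?n (D2 L j k (\<lambda>p. 1/2 * u p + 1/2 * v p)))\<^sup>2)"
    unfolding case_prod_beta by (simp add: sum.distrib sum_subtractf sum_distrib_left)
  finally have sum: "(\<Sum>(j, k)\<in>second_order i. (?n (D2 L j k (\<lambda>p. u p - v p)))\<^sup>2) = \<dots>" .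
  show ?thesis unfolding elastic_def x sum by (simp add: algebra_simps)
qed

lemma elastic_bounds:
  assumes "\<epsilon> > 0"
  shows "(norm2 (Omega L) (D\<^sub>x L u))\<^sup>2 \<le> elastic i L \<epsilon> u"
    "(j, k) \<in> second_order i \<Longrightarrow> (norm2 (Omega L) (D2 L j k u))\<^sup>2 \<le> elastic i L \<epsilon> u / \<epsilon>\<^sup>2"
proof -
  show "(norm2 (Omega L) (D\<^sub>x L u))\<^sup>2 \<le> elastic i L \<epsilon> u"
    unfolding elastic_def by (simp add: sum_nonneg case_prod_beta)
  assume jk: "(j, k) \<in> second_order i"
  have "(norm2 (Omega L) (D2 L j k u))\<^sup>2 \<le> (\<Sum>(j, k)\<in>second_order i. (norm2 (Omega L) (D2 L j k u))\<^sup>2)"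
    using member_le_sum[OF jk, of "\<lambda>(j, k). (norm2 (Omega L) (D2 L j k u))\<^sup>2"] by auto
  then have "\<epsilon>\<^sup>2 * (norm2 (Omega L) (D2 L j k u))\<^sup>2 \<le> elastic i L \<epsilon> u"
    unfolding elastic_def by (intro add_increasing2 mult_left_mono) auto
  then show "(norm2 (Omega L) (D2 L j k u))\<^sup>2 \<le> elastic i L \<epsilon> u / \<epsilon>\<^sup>2"
    using assms by (simp add: pos_le_divide_eq mult.commute)
qed

lemma elastic_tendsto:
  assumes z: "\<And>n. z n \<in> adm i L" and U: "U \<in> adm i L"
    and x: "(\<lambda>n. norm2 (Omega L) (\<lambda>p. D\<^sub>x L (z n) p - D\<^sub>x L U p)) \<longlonglongrightarrow> 0"
    and s: "\<And>j k. (j, k) \<in> second_order i \<Longrightarrow> (\<lambda>n. norm2 (Omega L) (\<lambda>p. D2 L j k (z n) p - D2 L j k U p)) \<longlonglongrightarrow> 0"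
  shows "(\<lambda>n. elastic i L \<epsilon> (z n)) \<longlonglongrightarrow> elastic i L \<epsilon> U"
  unfolding elastic_def case_prod_beta
  using norm2_tendsto[OF adm_derivs(5)[OF z Basis_xy(1)] adm_derivs(5)[OF U Basis_xy(1)] x]
    norm2_tendsto[OF adm_derivs(7)[OF z] adm_derivs(7)[OF U] s]
  by (intro tendsto_intros) auto

section \<open>Lower semicontinuity and compactness\<close>

lemma norm2_power2_tendsto_0:
  assumes "(\<lambda>n. (norm2 S (f n))\<^sup>2) \<longlonglongrightarrow> 0" shows "(\<lambda>n. norm2 S (f n)) \<longlonglongrightarrow> 0"
  using tendsto_real_sqrt[OF assms] by simp

text \<open>Minimizing over the admissible functions near \<open>U\<close> replaces weak limits of derivatives. The infima
  \<open>d k\<close> over these shrinking sets are nondecreasing and at most \<open>q\<close>, since almost all \<open>u n\<close> compete.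
  Near-minimizers \<open>z k\<close> converge with all their derivatives, and their limit is \<open>U\<close>.\<close>

lemma adm_lower_semicontinuous:
  assumes u: "\<And>n. u n \<in> adm i L" and L: "L > 0" and eps: "\<epsilon> > 0"
    and U: "U \<in> L2 (Omega L)" "(\<lambda>n. norm2 (Omega L) (\<lambda>p. u n p - U p)) \<longlonglongrightarrow> 0"
    and q: "(\<lambda>n. elastic i L \<epsilon> (u n)) \<longlonglongrightarrow> q"
  shows "U \<in> adm i L" "elastic i L \<epsilon> U \<le> q"
proof -
  let ?n = "norm2 (Omega L)" and ?E = "elastic i L \<epsilon>"
  define Z where "Z k = {z \<in> adm i L. ?n (\<lambda>p. z p - U p) \<le> 1 / real (Suc k)}" for k
  define d where "d k = Inf (?E ` Z k)" for k
  have bdd: "bdd_below (?E ` Z k)" for k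
    by (rule bdd_belowI2[of _ 0]) (rule elastic_nonneg)
  have ev: "\<forall>\<^sub>F n in sequentially. u n \<in> Z k" for k
    using order_tendstoD(2)[OF U(2), of "1 / real (Suc k)"] u
    by (auto simp: Z_def elim!: eventually_mono simp del: of_nat_Suc)
  have ne: "Z k \<noteq> {}" for k using eventually_happens'[OF sequentially_bot ev[of k]] by blast
  have dq: "d k \<le> q" for k
  proof (rule tendsto_lowerbound[OF q])
    show "\<forall>\<^sub>F n in sequentially. d k \<le> ?E (u n)"
      using ev[of k] by eventually_elim (auto simp: d_def intro!: cInf_lower bdd)
  qed simp
  have Zmono: "Z l \<subseteq> Z k" if "k \<le> l" for k l
  proof -
    have "1 / real (Suc l) \<le> 1 / real (Suc k)" using that by (intro divide_left_mono) auto
    then show ?thesis unfolding Z_def by auto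
  qed
  have "incseq d"
    unfolding incseq_def d_def
    by (intro allI impI cInf_superset_mono image_mono Zmono bdd) (use ne in auto)
  then obtain D where D: "d \<longlonglongrightarrow> D" "\<And>k. d k \<le> D"
    using incseq_convergent[of d q] dq by blast
  have "\<exists>z\<in>Z k. ?E z < d k + 1 / real (Suc k)" for k
    using cInf_lessD[of "?E ` Z k" "d k + 1 / real (Suc k)"] ne[of k]
    by (force simp: d_def[symmetric] simp del: of_nat_Suc)
  then obtain z where z: "\<And>k. z k \<in> Z k" "\<And>k. ?E (z k) < d k + 1 / real (Suc k)" by metis
  have za: "z k \<in> adm i L" for k using z(1) by (simp add: Z_def)
  note zD = adm_derivs[OF za]
  have zU: "(\<lambda>k. ?n (\<lambda>p. z k p - U p)) \<longlonglongrightarrow> 0"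
    by (rule tendsto_sandwich[OF always_eventually always_eventually tendsto_const lim_1_over_n[THEN LIMSEQ_Suc]])
      (use z(1) in \<open>auto simp: Z_def\<close>)
  \<comment> \<open>The midpoint of two near-minimizers is still a competitor, so the parallelogram law makes them close.\<close>
  have mid: "?E (\<lambda>p. z k p - z l p) \<le> 4 * (D - d N) + 4 * (1 / real (Suc N))" if kl: "k \<ge> N" "l \<ge> N" for k l N
  proof -
    let ?w = "\<lambda>p. 1/2 * z k p + 1/2 * z l p"
    have kN: "z k \<in> Z N" "z l \<in> Z N" using z(1) Zmono kl by blast+
    have "?w \<in> Z N"
    proof -
      have eq: "(\<lambda>p. ?w p - U p) = (\<lambda>p. 1/2 * (z k p - U p) + 1/2 * (z l p - U p))"
        by (auto simp: fun_eq_iff field_simps)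
      have "?n (\<lambda>p. ?w p - U p) \<le> 1/2 * ?n (\<lambda>p. z k p - U p) + 1/2 * ?n (\<lambda>p. z l p - U p)"
        unfolding eq
        using norm2_triangle[OF L2_scale[OF L2_diff[OF zD(1) U(1)]] L2_scale[OF L2_diff[OF zD(1) U(1)]], of "1/2" k "1/2" l,
            unfolded norm2_scale]
        by simp
      also have "\<dots> \<le> 1 / real (Suc N)" using kN by (simp add: Z_def)
      finally show ?thesis using adm_linear(1)[OF za za, where \<alpha>="1/2" and \<beta>="1/2"] by (simp add: Z_def)
    qed
    then have "d N \<le> ?E ?w" unfolding d_def by (intro cInf_lower bdd) auto
    moreover have "?E (z k) \<le> D + 1 / real (Suc N)" "?E (z l) \<le> D + 1 / real (Suc N)"
    proof -
      have "1 / real (Suc k) \<le> 1 / real (Suc N)" "1 / real (Suc l) \<le> 1 / real (Suc N)"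
        using kl by (auto intro!: divide_left_mono)
      then show "?E (z k) \<le> D + 1 / real (Suc N)" "?E (z l) \<le> D + 1 / real (Suc N)"
        using z(2)[of k] z(2)[of l] D(2)[of k] D(2)[of l] by linarith+
    qed
    moreover have "2 * x + 2 * y - 4 * w \<le> 4 * (D - a) + 4 * h"
      if "a \<le> w" "x \<le> D + h" "y \<le> D + h" for a w x y h :: real
      using that by simp
    ultimately show ?thesis unfolding elastic_parallelogram[OF za za] by blast
  qed
  have EC: "\<exists>N. \<forall>k\<ge>N. \<forall>l\<ge>N. ?E (\<lambda>p. z k p - z l p) < e" if e: "e > 0" for e
  proof -
    have "(\<lambda>N. 4 * (D - d N) + 4 * (1 / real (Suc N))) \<longlonglongrightarrow> 4 * (D - D) + 4 * 0"
      by (intro tendsto_intros D(1) lim_1_over_n[THEN LIMSEQ_Suc])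
    then have "\<forall>\<^sub>F N in sequentially. 4 * (D - d N) + 4 * (1 / real (Suc N)) < e"
      using order_tendstoD(2)[of _ 0 sequentially e] e by simp
    then obtain N where N: "4 * (D - d N) + 4 * (1 / real (Suc N)) < e"
      using eventually_happens'[OF sequentially_bot] by blast
    show ?thesis using le_less_trans[OF mid N] by blast
  qed
  \<comment> \<open>All derivatives in question are Cauchy for the same reason; the constants come from \<open>elastic_bounds\<close>
    and, for \<open>D\<^sub>y\<close>, from interpolation with \<open>l = 1/2\<close>.\<close>
  have lim: "\<exists>G\<in>L2 (Omega L). (\<lambda>k. ?n (\<lambda>p. g k p - G p)) \<longlonglongrightarrow> 0"
    if gL: "\<And>k. g k \<in> L2 (Omega L)" and c: "ca \<ge> 0" "cb \<ge> 0"
      and b: "\<And>k l. (?n (\<lambda>p. g k p - g l p))\<^sup>2 \<le> ca * (?n (\<lambda>p. z k p - z l p))\<^sup>2 + cb * ?E (\<lambda>p. z k p - z l p)"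
    for g and ca cb :: real
  proof -
    have C: "\<exists>N. \<forall>m\<ge>N. \<forall>n\<ge>N. ?n (\<lambda>p. g m p - g n p) < e" if e: "e > 0" for e
    proof -
      define s where "s = e\<^sup>2 / (2 * (ca + cb + 1))"
      have s: "s > 0" using e c by (simp add: s_def)
      have es: "2 * (ca + cb + 1) * s = e\<^sup>2" using c by (simp add: s_def)
      obtain N1 where N1: "\<And>k l. k \<ge> N1 \<Longrightarrow> l \<ge> N1 \<Longrightarrow> ?n (\<lambda>p. z k p - z l p) < sqrt s"
        using L2_convergent_imp_Cauchy[OF zD(1) U(1) zU, of "sqrt s"] s by auto
      obtain N2 where N2: "\<And>k l. k \<ge> N2 \<Longrightarrow> l \<ge> N2 \<Longrightarrow> ?E (\<lambda>p. z k p - z l p) < s"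
        using EC[OF s] by blast
      have "?n (\<lambda>p. g k p - g l p) < e" if kl: "k \<ge> max N1 N2" "l \<ge> max N1 N2" for k l
      proof -
        have "(?n (\<lambda>p. z k p - z l p))\<^sup>2 \<le> (sqrt s)\<^sup>2"
          using N1[of k l] kl by (intro power_mono) auto
        then have "ca * (?n (\<lambda>p. z k p - z l p))\<^sup>2 \<le> ca * s" using c s by (intro mult_left_mono) auto
        moreover have "cb * ?E (\<lambda>p. z k p - z l p) \<le> cb * s" using N2[of k l] kl c by (intro mult_left_mono) auto
        moreover have "ca * s + cb * s < e\<^sup>2"
        proof -
          have "0 \<le> ca * s" "0 \<le> cb * s" using c s by auto
          moreover have "2 * (ca * s) + 2 * (cb * s) + 2 * s = e\<^sup>2" using es by (simp add: algebra_simps)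
          ultimately show ?thesis using s by linarith
        qed
        ultimately have "(?n (\<lambda>p. g k p - g l p))\<^sup>2 < e\<^sup>2" using b[of k l] by linarith
        then show ?thesis using e by (auto intro: power2_less_imp_less)
      qed
      then show ?thesis by blast
    qed
    obtain G where "G \<in> L2 (Omega L)" "(\<lambda>k. ?n (\<lambda>p. g k p - G p)) \<longlonglongrightarrow> 0"
      by (rule L2_complete[where f=g, OF gL Omega_lmeasurable C], assumption, rule that)
    then show ?thesis by (intro bexI[of _ G])
  qed
  note zd = adm_diff[OF za za]
  have X: "\<exists>G\<in>L2 (Omega L). (\<lambda>n. ?n (\<lambda>p. D\<^sub>x L (z n) p - G p)) \<longlonglongrightarrow> 0"
  proof (intro lim[where ca=0 and cb=1] zD(5) Basis_xy)
    show "(?n (\<lambda>p. D\<^sub>x L (z k) p - D\<^sub>x L (z l) p))\<^sup>2 \<le> 0 * (?n (\<lambda>p. z k p - z l p))\<^sup>2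
        + 1 * ?E (\<lambda>p. z k p - z l p)" for k l
      unfolding zd(2)[OF Basis_xy(1), symmetric] using elastic_bounds(1)[OF eps, of L "\<lambda>p. z k p - z l p" i] by simp
  qed auto
  have Y: "\<exists>G\<in>L2 (Omega L). (\<lambda>n. ?n (\<lambda>p. D\<^sub>y L (z n) p - G p)) \<longlonglongrightarrow> 0"
  proof (intro lim[where ca=64 and cb="1 / (4 * \<epsilon>\<^sup>2)"] zD(5) Basis_xy)
    fix k l
    have "(?n (D\<^sub>y L (\<lambda>p. z k p - z l p)))\<^sup>2 \<le> 16 / (1/2)\<^sup>2 * (?n (\<lambda>p. z k p - z l p))\<^sup>2
        + (1/2)\<^sup>2 * (?n (D2 L (0, 1) (0, 1) (\<lambda>p. z k p - z l p)))\<^sup>2"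
      by (rule adm_interpolation[OF zd(1) L]) auto
    also have "\<dots> \<le> 16 / (1/2)\<^sup>2 * (?n (\<lambda>p. z k p - z l p))\<^sup>2 + (1/2)\<^sup>2 * (?E (\<lambda>p. z k p - z l p) / \<epsilon>\<^sup>2)"
      by (intro add_left_mono mult_left_mono elastic_bounds(2)[OF eps]) auto
    finally show "(?n (\<lambda>p. D\<^sub>y L (z k) p - D\<^sub>y L (z l) p))\<^sup>2 \<le> 64 * (?n (\<lambda>p. z k p - z l p))\<^sup>2
        + 1 / (4 * \<epsilon>\<^sup>2) * ?E (\<lambda>p. z k p - z l p)"
      by (simp add: zd(2)[OF Basis_xy(2)] power2_eq_square)
  qed (use eps in auto)
  have S: "\<exists>G\<in>L2 (Omega L). (\<lambda>n. ?n (\<lambda>p. D2 L j k (z n) p - G p)) \<longlonglongrightarrow> 0" if jk: "(j, k) \<in> second_order i" for j k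
  proof (intro lim[where ca=0 and cb="1 / \<epsilon>\<^sup>2"] zD(7) jk)
    show "(?n (\<lambda>p. D2 L j k (z m) p - D2 L j k (z l) p))\<^sup>2 \<le> 0 * (?n (\<lambda>p. z m p - z l p))\<^sup>2
        + 1 / \<epsilon>\<^sup>2 * ?E (\<lambda>p. z m p - z l p)" for m l
      unfolding zd(3)[OF jk, symmetric] using elastic_bounds(2)[OF eps jk, of L "\<lambda>p. z m p - z l p"] by simp
  qed auto
  have XY: "\<exists>G. G \<in> L2 (Omega L) \<and> (\<lambda>n. ?n (\<lambda>p. weak_deriv (Omega L) k (z n) p - G p)) \<longlonglongrightarrow> 0" if "k \<in> Basis" for k
    using X Y that by (auto simp: Basis_real2)
  define A where "A k = (SOME G. G \<in> L2 (Omega L) \<and> (\<lambda>n. ?n (\<lambda>p. weak_deriv (Omega L) k (z n) p - G p)) \<longlonglongrightarrow> 0)" for k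
  have A: "A k \<in> L2 (Omega L)" "(\<lambda>n. ?n (\<lambda>p. weak_deriv (Omega L) k (z n) p - A k p)) \<longlonglongrightarrow> 0" if "k \<in> Basis" for k
    using someI_ex[OF XY[OF that]] unfolding A_def by blast+
  have S': "\<exists>G. G \<in> L2 (Omega L) \<and> (\<lambda>n. ?n (\<lambda>p. D2 L j k (z n) p - G p)) \<longlonglongrightarrow> 0" if "(j, k) \<in> second_order i" for j k
    using S[OF that] by blast
  define B where "B j k = (SOME G. G \<in> L2 (Omega L) \<and> (\<lambda>n. ?n (\<lambda>p. D2 L j k (z n) p - G p)) \<longlonglongrightarrow> 0)" for j k
  have B: "B j k \<in> L2 (Omega L)" "(\<lambda>n. ?n (\<lambda>p. D2 L j k (z n) p - B j k p)) \<longlonglongrightarrow> 0" if "(j, k) \<in> second_order i" for j k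
    using someI_ex[OF S'[OF that]] unfolding B_def by blast+
  note lims = adm_limit[where z=z and A=A and B=B, OF za L U(1) zU A B]
  show Ua: "U \<in> adm i L" by (rule lims(1))
  note UD = adm_derivs[OF Ua]
  have c1: "(\<lambda>n. ?E (z n)) \<longlonglongrightarrow> ?E U"
  proof (rule elastic_tendsto[OF za Ua])
    have "AE p in lebesgue_on (Omega L). D\<^sub>x L U p = A (1, 0) p" using Basis_xy(1) by (rule lims(2)[rotated -1])
    then have "?n (\<lambda>p. D\<^sub>x L (z n) p - D\<^sub>x L U p) = ?n (\<lambda>p. D\<^sub>x L (z n) p - A (1, 0) p)" for n
      by (intro norm2_cong_AE L2_diff zD(5) UD(5) A(1) Basis_xy) (auto elim: AE_mp)
    then show "(\<lambda>n. ?n (\<lambda>p. D\<^sub>x L (z n) p - D\<^sub>x L U p)) \<longlonglongrightarrow> 0" using A(2)[OF Basis_xy(1)] by simp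
    fix j k assume jk: "(j, k) \<in> second_order i"
    have "AE p in lebesgue_on (Omega L). D2 L j k U p = B j k p" using jk by (rule lims(3)[rotated -1])
    then have "?n (\<lambda>p. D2 L j k (z n) p - D2 L j k U p) = ?n (\<lambda>p. D2 L j k (z n) p - B j k p)" for n
      by (intro norm2_cong_AE L2_diff zD(7) UD(7) B(1) jk) (auto elim: AE_mp)
    then show "(\<lambda>n. ?n (\<lambda>p. D2 L j k (z n) p - D2 L j k U p)) \<longlonglongrightarrow> 0" using B(2)[OF jk] by simp
  qed
  have c2: "(\<lambda>k. q + 1 / real (Suc k)) \<longlonglongrightarrow> q + 0"
    by (intro tendsto_intros lim_1_over_n[THEN LIMSEQ_Suc])
  have "?E (z k) \<le> q + 1 / real (Suc k)" for k using z(2)[of k] dq[of k] by linarith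
  then have "?E U \<le> q + 0" by (intro LIMSEQ_le[OF c1 c2]) blast
  then show "?E U \<le> q" by simp
qed

text \<open>Rellich's theorem for smooth functions applies to approximations \<open>\<phi> n\<close> of \<open>u n\<close> with an error that
  tends to zero.\<close>

lemma adm_bounded_L2_subseq:
  assumes u: "\<And>n. u n \<in> adm i L" and L: "L > 0" and eps: "\<epsilon> > 0"
    and b: "\<And>n. elastic i L \<epsilon> (u n) \<le> C"
  obtains r :: "nat \<Rightarrow> nat" and U where "strict_mono r" "U \<in> L2 (Omega L)"
    "(\<lambda>n. norm2 (Omega L) (\<lambda>p. u (r n) p - U p)) \<longlonglongrightarrow> 0"
proof -
  let ?n = "norm2 (Omega L)"
  note D = adm_derivs[OF u]
  have C: "C \<ge> 0" using elastic_nonneg[of i L \<epsilon> "u 0"] b[of 0] by linarith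
  have x: "(?n (D\<^sub>x L (u n)))\<^sup>2 \<le> C" for n using elastic_bounds(1)[OF eps, of L "u n" i] b[of n] by linarith
  have s: "(?n (D2 L (0, 1) (0, 1) (u n)))\<^sup>2 \<le> C / \<epsilon>\<^sup>2" for n
    using elastic_bounds(2)[OF eps second_order_yy, of L "u n" i] b[of n] by (meson divide_right_mono order_trans zero_le_power2)
  have u2: "(?n (u n))\<^sup>2 \<le> 2 * L\<^sup>2 * C" for n
    using adm_poincare[OF u L, of n] mult_left_mono[OF x[of n], of "2 * L\<^sup>2"] by simp
  have y: "(?n (D\<^sub>y L (u n)))\<^sup>2 \<le> 16 / (1/2)\<^sup>2 * (2 * L\<^sup>2 * C) + (1/2)\<^sup>2 * (C / \<epsilon>\<^sup>2)" (is "_ \<le> ?Y") for n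
  proof -
    have "16 / (1/2)\<^sup>2 * (?n (u n))\<^sup>2 + (1/2)\<^sup>2 * (?n (D2 L (0, 1) (0, 1) (u n)))\<^sup>2 \<le> ?Y"
      by (intro add_mono mult_left_mono u2 s) auto
    then show ?thesis using adm_interpolation[OF u L, of "1/2" n] by linarith
  qed
  define K where "K = sqrt C + sqrt (2 * L\<^sup>2 * C) + sqrt ?Y + 1"
  have "sqrt C \<ge> 0" "sqrt (2 * L\<^sup>2 * C) \<ge> 0" "sqrt ?Y \<ge> 0" using C by auto
  then have bx: "?n (D\<^sub>x L (u n)) \<le> K - 1" and bu: "?n (u n) \<le> K - 1" and by': "?n (D\<^sub>y L (u n)) \<le> K - 1" for n
    using real_le_rsqrt[OF x[of n]] real_le_rsqrt[OF u2[of n]] real_le_rsqrt[OF y[of n]] unfolding K_def by linarith+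
  have "\<exists>\<phi>. trace_approx L (\<lambda>y. (0, y)) {0..1} (u n) (D\<^sub>x L (u n)) (D\<^sub>y L (u n)) (\<lambda>y. 0) (1 / real (Suc n)) \<phi>" for n
    using u[of n] has_trace_iff[OF D(2,3)] by (auto simp: adm_iff vanishes_left_def simp del: of_nat_Suc)
  then obtain \<phi> where \<phi>: "\<And>n. trace_approx L (\<lambda>y. (0, y)) {0..1} (u n) (D\<^sub>x L (u n)) (D\<^sub>y L (u n)) (\<lambda>y. 0) (1 / real (Suc n)) (\<phi> n)"
    by metis
  have sm: "smooth (\<phi> n)" for n using \<phi> by (simp add: trace_approx_def)
  have le1: "1 / real (Suc n) \<le> 1" for n by simp
  have k1: "?n (\<phi> n) \<le> K" for n
    using norm2_le_add_diff[OF smooth_L2[OF sm] D(1), of n n] \<phi>[of n] bu[of n] le1[of n]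
    unfolding trace_approx_def by linarith
  have k2: "?n (part_x (\<phi> n)) \<le> K" for n
    using norm2_le_add_diff[OF smooth_partial_L2[OF sm Basis_xy(1)] D(5)[OF Basis_xy(1)], of n n] \<phi>[of n] bx[of n] le1[of n]
    unfolding trace_approx_def by linarith
  have k3: "?n (part_y (\<phi> n)) \<le> K" for n
    using norm2_le_add_diff[OF smooth_partial_L2[OF sm Basis_xy(2)] D(5)[OF Basis_xy(2)], of n n] \<phi>[of n] by'[of n] le1[of n]
    unfolding trace_approx_def by linarith
  obtain r :: "nat \<Rightarrow> nat" where r: "strict_mono r"
    "\<And>e. e > 0 \<Longrightarrow> \<exists>N. \<forall>m\<ge>N. \<forall>n\<ge>N. ?n (\<lambda>p. \<phi> (r m) p - \<phi> (r n) p) < e"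
    by (rule rellich_smooth[OF sm L k1 k2 k3], rule that)
  have C: "\<exists>N. \<forall>m\<ge>N. \<forall>n\<ge>N. ?n (\<lambda>p. u (r m) p - u (r n) p) < e" if e: "e > 0" for e
  proof -
    have e3: "e / 3 > 0" using e by simp
    obtain N1 where N1: "\<And>m n. m \<ge> N1 \<Longrightarrow> n \<ge> N1 \<Longrightarrow> ?n (\<lambda>p. \<phi> (r m) p - \<phi> (r n) p) < e / 3"
      using r(2)[OF e3] by blast
    obtain N2 where N2: "1 / real (Suc N2) < e / 3" using nat_approx_posE[OF e3] by blast
    have close: "?n (\<lambda>p. \<phi> (r n) p - u (r n) p) < e / 3" if "n \<ge> N2" for n
    proof -
      have "?n (\<lambda>p. \<phi> (r n) p - u (r n) p) < 1 / real (Suc (r n))" using \<phi>[of "r n"] by (simp add: trace_approx_def)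
      also have "\<dots> \<le> 1 / real (Suc N2)"
        using seq_suble[OF r(1), of n] that by (intro divide_left_mono) auto
      finally show ?thesis using N2 by linarith
    qed
    have "?n (\<lambda>p. u (r m) p - u (r n) p) < e" if "m \<ge> max N1 N2" "n \<ge> max N1 N2" for m n
      using norm2_triangle_diff[OF D(1)[of "r m"] smooth_L2[OF sm[of "r m"]] D(1)[of "r n"]]
        norm2_triangle_diff[OF smooth_L2[OF sm[of "r m"]] smooth_L2[OF sm[of "r n"]] D(1)[of "r n"]]
        close[of m] close[of n] N1[of m n] that norm2_uminus[of "Omega L" "u (r m)" "\<phi> (r m)"] by simp
    then show ?thesis by blast
  qed
  obtain U where "U \<in> L2 (Omega L)" "(\<lambda>n. norm2 (Omega L) (\<lambda>p. u (r n) p - U p)) \<longlonglongrightarrow> 0"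
    by (rule L2_complete[where f="\<lambda>n. u (r n)", OF D(1) Omega_lmeasurable C], assumption, rule that)
  then show ?thesis by (rule that[OF r(1)])
qed

text \<open>Interpolation between the strongly convergent \<open>u (r n)\<close> and their bounded second derivatives upgrades
  the convergence to \<open>D\<^sub>y\<close>, which decides the shape of \<open>B\<close>.\<close>

lemma adm_compactness:
  assumes u: "\<And>n. u n \<in> adm i L" and L: "L > 0" and eps: "\<epsilon> > 0"
    and b: "\<And>n. elastic i L \<epsilon> (u n) \<le> C"
  obtains r :: "nat \<Rightarrow> nat" and U q where "strict_mono r" "U \<in> adm i L"
    "(\<lambda>n. elastic i L \<epsilon> (u (r n))) \<longlonglongrightarrow> q" "elastic i L \<epsilon> U \<le> q"
    "(\<lambda>n. norm2 (Omega L) (\<lambda>p. D\<^sub>y L (u (r n)) p - D\<^sub>y L U p)) \<longlonglongrightarrow> 0"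
proof -
  let ?n = "norm2 (Omega L)" and ?E = "elastic i L \<epsilon>"
  obtain r1 U where r1: "strict_mono (r1 :: nat \<Rightarrow> nat)" and UL: "U \<in> L2 (Omega L)"
    and l1: "(\<lambda>n. ?n (\<lambda>p. u (r1 n) p - U p)) \<longlonglongrightarrow> 0"
    by (rule adm_bounded_L2_subseq[OF u L eps b], rule that)
  have sc: "seq_compact {0..C}" by (rule compact_imp_seq_compact[OF compact_Icc])
  have in_Icc: "\<forall>n. ?E (u (r1 n)) \<in> {0..C}" using elastic_nonneg b by auto
  obtain r2 q where r2: "strict_mono (r2 :: nat \<Rightarrow> nat)" "((\<lambda>n. ?E (u (r1 n))) \<circ> r2) \<longlonglongrightarrow> q"
    by (rule seq_compactE[OF sc in_Icc], rule that)
  define r where "r = r1 \<circ> r2"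
  have r: "strict_mono r" unfolding r_def by (rule strict_mono_o[OF r1 r2(1)])
  have lim: "(\<lambda>n. ?n (\<lambda>p. u (r n) p - U p)) \<longlonglongrightarrow> 0"
    using LIMSEQ_subseq_LIMSEQ[OF l1 r2(1)] by (simp add: r_def comp_def)
  have q: "(\<lambda>n. ?E (u (r n))) \<longlonglongrightarrow> q" using r2(2) by (simp add: r_def comp_def)
  note lsc = adm_lower_semicontinuous[OF u[of "r _"] L eps UL lim q]
  have "q \<le> C" by (rule LIMSEQ_le_const2[OF q]) (use b in auto)
  with lsc(2) have EUC: "?E U \<le> C" by linarith
  note df = adm_diff[OF u lsc(1)]
  have Y: "(?n (\<lambda>p. D\<^sub>y L (u (r n)) p - D\<^sub>y L U p))\<^sup>2 \<le> 16 / l\<^sup>2 * (?n (\<lambda>p. u (r n) p - U p))\<^sup>2 + l\<^sup>2 * (4 * C / \<epsilon>\<^sup>2)"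
    if l: "0 < l" "l \<le> 1/2" for n l
  proof -
    have "?E (\<lambda>p. u (r n) p - U p) \<le> 4 * C"
      using elastic_parallelogram[OF u lsc(1), of \<epsilon> "r n"] b[of "r n"] EUC elastic_nonneg[of i L \<epsilon> "\<lambda>p. 1/2 * u (r n) p + 1/2 * U p"]
      by linarith
    then have "(?n (D2 L (0, 1) (0, 1) (\<lambda>p. u (r n) p - U p)))\<^sup>2 \<le> 4 * C / \<epsilon>\<^sup>2"
      using elastic_bounds(2)[OF eps second_order_yy, of L "\<lambda>p. u (r n) p - U p" i]
      by (meson divide_right_mono order_trans zero_le_power2)
    then have "16 / l\<^sup>2 * (?n (\<lambda>p. u (r n) p - U p))\<^sup>2 + l\<^sup>2 * (?n (D2 L (0, 1) (0, 1) (\<lambda>p. u (r n) p - U p)))\<^sup>2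
        \<le> 16 / l\<^sup>2 * (?n (\<lambda>p. u (r n) p - U p))\<^sup>2 + l\<^sup>2 * (4 * C / \<epsilon>\<^sup>2)"
      by (intro add_left_mono mult_left_mono) auto
    then show ?thesis
      using adm_interpolation[OF df(1) L l, of "r n"] df(2)[OF Basis_xy(2), of "r n"] by simp
  qed
  have C: "C \<ge> 0" using elastic_nonneg[of i L \<epsilon> "u 0"] b[of 0] by linarith
  have "(\<lambda>n. ?n (\<lambda>p. D\<^sub>y L (u (r n)) p - D\<^sub>y L U p)) \<longlonglongrightarrow> 0"
  proof (rule norm2_power2_tendsto_0, rule LIMSEQ_I)
    fix e :: real assume e: "e > 0"
    define K where "K = 4 * C / \<epsilon>\<^sup>2"
    have K: "K \<ge> 0" using C by (simp add: K_def)
    \<comment> \<open>The bounded second derivative is made small by \<open>l\<close> first, and then the other term by \<open>n\<close>.\<close>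
    define l where "l = min (1/2) (sqrt (e / (2 * (K + 1))))"
    have pos: "e / (2 * (K + 1)) > 0" using e K by simp
    have l: "0 < l" "l \<le> 1/2" using pos by (auto simp: l_def)
    have "l\<^sup>2 \<le> (sqrt (e / (2 * (K + 1))))\<^sup>2" using l by (intro power_mono) (auto simp: l_def)
    then have "l\<^sup>2 * K \<le> e / (2 * (K + 1)) * K" using pos K by (intro mult_right_mono) auto
    also have "\<dots> < e / 2" using e K by (simp add: field_simps)
    finally have lK: "l\<^sup>2 * K < e / 2" .
    have "(\<lambda>n. 16 / l\<^sup>2 * (?n (\<lambda>p. u (r n) p - U p))\<^sup>2) \<longlonglongrightarrow> 16 / l\<^sup>2 * 0\<^sup>2"
      by (intro tendsto_intros lim)
    then have lim0: "(\<lambda>n. 16 / l\<^sup>2 * (?n (\<lambda>p. u (r n) p - U p))\<^sup>2) \<longlonglongrightarrow> 0" by simp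
    have "\<forall>\<^sub>F n in sequentially. 16 / l\<^sup>2 * (?n (\<lambda>p. u (r n) p - U p))\<^sup>2 < e / 2"
      by (rule order_tendstoD(2)[OF lim0]) (use e in simp)
    then obtain N where N: "\<And>n. n \<ge> N \<Longrightarrow> 16 / l\<^sup>2 * (?n (\<lambda>p. u (r n) p - U p))\<^sup>2 < e / 2"
      by (auto simp: eventually_sequentially)
    have "(?n (\<lambda>p. D\<^sub>y L (u (r n)) p - D\<^sub>y L U p))\<^sup>2 < e" if "n \<ge> N" for n
      using Y[OF l, of n] N[OF that] lK unfolding K_def by linarith
    then show "\<exists>N. \<forall>n\<ge>N. norm ((?n (\<lambda>p. D\<^sub>y L (u (r n)) p - D\<^sub>y L U p))\<^sup>2 - 0) < e" by auto
  qed
  then show ?thesis by (rule that[OF r lsc(1) q lsc(2)])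
qed

section \<open>Existence of minimizers\<close>

lemma B_set_sets:
  assumes "u \<in> adm i L" shows "B_set L u \<in> sets (lebesgue_on (Omega L))" "B_set L u \<in> sets lebesgue"
proof -
  have [measurable]: "D\<^sub>y L u \<in> borel_measurable (lebesgue_on (Omega L))"
    by (rule L2_measurable[OF adm_derivs(5)[OF assms Basis_xy(2)]])
  have "{p \<in> space (lebesgue_on (Omega L)). \<bar>D\<^sub>y L u p\<bar> \<ge> 1} \<in> sets (lebesgue_on (Omega L))"
    by measurable
  then show *: "B_set L u \<in> sets (lebesgue_on (Omega L))" by (simp add: B_set_def)
  then show "B_set L u \<in> sets lebesgue" using Omega_sets by (simp add: sets_restrict_space_iff)
qed

lemma Omega_subset_lmeasurable:
  "X \<in> sets lebesgue \<Longrightarrow> X \<subseteq> Omega L \<Longrightarrow> X \<in> lmeasurable"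
  using fmeasurableI2[OF Omega_lmeasurable] by blast

lemma measure_A_set:
  assumes u: "u \<in> adm i L" and L: "L > 0"
  shows "measure lebesgue (A_set L u) = L - measure lebesgue (B_set L u)"
proof -
  have "B_set L u \<subseteq> Omega L" by (auto simp: B_set_def)
  then show ?thesis
    unfolding A_set_def
    using measurable_measure_Diff[OF Omega_lmeasurable B_set_sets(2)[OF u]] measure_Omega[OF L] by simp
qed

lemma LINT_indicator_Omega:
  assumes "X \<in> sets lebesgue" "X \<subseteq> Omega L"
  shows "(LINT p|lebesgue_on (Omega L). indicator X p) = measure lebesgue X"
    "integrable (lebesgue_on (Omega L)) (indicator X :: _ \<Rightarrow> real)"
proof -
  have X: "X \<in> sets (lebesgue_on (Omega L))" using assms Omega_sets by (simp add: sets_restrict_space_iff)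
  interpret finite_measure "lebesgue_on (Omega L)" by (rule finite_measure_lebesgue_on[OF Omega_lmeasurable])
  show "integrable (lebesgue_on (Omega L)) (indicator X :: _ \<Rightarrow> real)"
    by (intro integrable_real_indicator X) (simp add: less_top[symmetric])
  show "(LINT p|lebesgue_on (Omega L). indicator X p) = measure lebesgue X"
    using X assms Omega_sets by (simp add: measure_restrict_space Int_absorb2)
qed

text \<open>Where \<open>|D\<^sub>y U| < 1\<close>, the same strict inequality holds for all large \<open>n\<close>. The converse may fail, so only
  this part of the difference of the two sets vanishes.\<close>

lemma measure_B_set_tendsto:
  assumes u: "\<And>n. u n \<in> adm i L" and U: "U \<in> adm i L"
    and ae: "AE p in lebesgue_on (Omega L). (\<lambda>n. D\<^sub>y L (u n) p) \<longlonglongrightarrow> D\<^sub>y L U p"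
  shows "(\<lambda>n. measure lebesgue (B_set L (u n) - B_set L U)) \<longlonglongrightarrow> 0"
proof -
  have sub: "B_set L (u n) - B_set L U \<subseteq> Omega L" for n by (auto simp: B_set_def)
  have s: "B_set L (u n) - B_set L U \<in> sets lebesgue" for n by (intro sets.Diff B_set_sets(2)[OF u] B_set_sets(2)[OF U])
  have "(\<lambda>n. LINT p|lebesgue_on (Omega L). indicator (B_set L (u n) - B_set L U) p)
      \<longlonglongrightarrow> (LINT p|lebesgue_on (Omega L). (0::real))"
  proof (rule integral_dominated_convergence[where w="\<lambda>p. 1"])
    show "integrable (lebesgue_on (Omega L)) (\<lambda>p. 1::real)"
      by (rule finite_measure.integrable_const[OF finite_measure_lebesgue_on[OF Omega_lmeasurable]])
    show "(indicator (B_set L (u n) - B_set L U) :: _ \<Rightarrow> real) \<in> borel_measurable (lebesgue_on (Omega L))" for n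
      by (rule borel_measurable_integrable[OF LINT_indicator_Omega(2)[OF s sub]])
    have "AE p in lebesgue_on (Omega L). p \<in> Omega L" by (rule AE_I2) simp
    with ae show "AE p in lebesgue_on (Omega L). (\<lambda>n. indicator (B_set L (u n) - B_set L U) p) \<longlonglongrightarrow> (0::real)"
    proof eventually_elim
      case (elim p)
      show ?case
      proof (cases "p \<in> B_set L U")
        case False
        then have "\<bar>D\<^sub>y L U p\<bar> < 1" using elim(2) by (simp add: B_set_def)
        then have "\<forall>\<^sub>F n in sequentially. \<bar>D\<^sub>y L (u n) p\<bar> < 1"
          by (rule order_tendstoD(2)[OF tendsto_rabs[OF elim(1)]])
        then have "\<forall>\<^sub>F n in sequentially. indicator (B_set L (u n) - B_set L U) p = (0::real)"
          by eventually_elim (auto simp: B_set_def)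
        then show ?thesis by (rule tendsto_eventually)
      qed simp
    qed
    show "AE p in lebesgue_on (Omega L). norm (indicator (B_set L (u n) - B_set L U) p :: real) \<le> 1" for n
      by (rule AE_I2) (simp add: indicator_def)
  qed simp
  then show ?thesis using LINT_indicator_Omega(1)[OF s sub] by simp
qed

lemma zero_adm: "L > 0 \<Longrightarrow> (\<lambda>p. 0) \<in> adm i L"
  by (rule smooth_adm(1)[OF smooth_const]) auto

lemma energy_nonneg: "u \<in> adm i L \<Longrightarrow> \<Delta> \<ge> 0 \<Longrightarrow> energy i L \<epsilon> \<Delta> u \<ge> 0"
  unfolding energy_eq_elastic by (intro add_nonneg_nonneg elastic_nonneg mult_nonneg_nonneg) auto

lemma minimizer_exists:
  assumes L: "L > 0" and eps: "\<epsilon> > 0" and D: "\<Delta> \<ge> 0"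
  shows "\<exists>U. global_minimizer i L \<epsilon> \<Delta> U"
proof -
  let ?I = "energy i L \<epsilon> \<Delta>" and ?m = "measure lebesgue"
  define m where "m = Inf (?I ` adm i L)"
  have bdd: "bdd_below (?I ` adm i L)" by (rule bdd_belowI2[of _ 0]) (rule energy_nonneg[OF _ D])
  have "\<exists>u\<in>adm i L. ?I u < m + 1 / real (Suc n)" for n
    using cInf_lessD[of "?I ` adm i L" "m + 1 / real (Suc n)"] zero_adm[OF L, of i]
    by (force simp: m_def[symmetric] simp del: of_nat_Suc)
  then obtain u where u: "\<And>n. u n \<in> adm i L" "\<And>n. ?I (u n) < m + 1 / real (Suc n)" by metis
  have Iu: "?I v = elastic i L \<epsilon> v + \<Delta> * (L - ?m (B_set L v))" if "v \<in> adm i L" for v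
    by (simp add: energy_eq_elastic[OF that] measure_A_set[OF that L])
  have el: "elastic i L \<epsilon> (u n) \<le> m + 1" for n
  proof -
    have "elastic i L \<epsilon> (u n) \<le> ?I (u n)" using D by (simp add: energy_eq_elastic[OF u(1)])
    moreover have "1 / real (Suc n) \<le> 1" by simp
    ultimately show ?thesis using u(2)[of n] by linarith
  qed
  obtain r U q where r: "strict_mono (r :: nat \<Rightarrow> nat)" and U: "U \<in> adm i L"
    and q: "(\<lambda>n. elastic i L \<epsilon> (u (r n))) \<longlonglongrightarrow> q" "elastic i L \<epsilon> U \<le> q"
    and y: "(\<lambda>n. norm2 (Omega L) (\<lambda>p. D\<^sub>y L (u (r n)) p - D\<^sub>y L U p)) \<longlonglongrightarrow> 0"
    by (rule adm_compactness[OF u(1) L eps el], rule that)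
  obtain r2 where r2: "strict_mono (r2 :: nat \<Rightarrow> nat)"
    "AE p in lebesgue_on (Omega L). (\<lambda>n. D\<^sub>y L (u (r (r2 n))) p) \<longlonglongrightarrow> D\<^sub>y L U p"
    using L2_convergent_AE_subseq[OF adm_derivs(5)[OF u(1) Basis_xy(2)] adm_derivs(5)[OF U Basis_xy(2)] y] by blast
  define w where "w n = u (r (r2 n))" for n
  have w: "w n \<in> adm i L" for n using u(1) by (simp add: w_def)
  have 0: "(\<lambda>n. ?m (B_set L (w n) - B_set L U)) \<longlonglongrightarrow> 0"
    unfolding w_def by (rule measure_B_set_tendsto[OF u(1) U r2(2)])
  have q2: "(\<lambda>n. elastic i L \<epsilon> (w n)) \<longlonglongrightarrow> q"
    using LIMSEQ_subseq_LIMSEQ[OF q(1) r2(1)] by (simp add: w_def comp_def)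
  have "(\<lambda>n. elastic i L \<epsilon> (w n) + \<Delta> * (L - (?m (B_set L U) + ?m (B_set L (w n) - B_set L U))))
      \<longlonglongrightarrow> q + \<Delta> * (L - (?m (B_set L U) + 0))"
    by (intro tendsto_intros q2 0)
  moreover have "(\<lambda>n. m + 1 / real (Suc n)) \<longlonglongrightarrow> m + 0"
    by (intro tendsto_intros lim_1_over_n[THEN LIMSEQ_Suc])
  moreover have "elastic i L \<epsilon> (w n) + \<Delta> * (L - (?m (B_set L U) + ?m (B_set L (w n) - B_set L U))) \<le> m + 1 / real (Suc n)" for n
  proof -
    have lm: "B_set L v \<in> lmeasurable" if "v \<in> adm i L" for v
      by (rule Omega_subset_lmeasurable[OF B_set_sets(2)[OF that]]) (auto simp: B_set_def)
    have "?m (B_set L (w n)) \<le> ?m (B_set L U \<union> (B_set L (w n) - B_set L U))"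
      using lm[OF w[of n]] lm[OF U] by (intro measure_mono_fmeasurable) auto
    also have "\<dots> \<le> ?m (B_set L U) + ?m (B_set L (w n) - B_set L U)"
      using B_set_sets(2)[OF w[of n]] B_set_sets(2)[OF U] by (intro measure_Un_le) auto
    finally have "\<Delta> * (L - (?m (B_set L U) + ?m (B_set L (w n) - B_set L U))) \<le> \<Delta> * (L - ?m (B_set L (w n)))"
      using D by (intro mult_left_mono) auto
    then have "elastic i L \<epsilon> (w n) + \<Delta> * (L - (?m (B_set L U) + ?m (B_set L (w n) - B_set L U))) \<le> ?I (w n)"
      by (simp add: Iu[OF w])
    also have "\<dots> \<le> m + 1 / real (Suc (r (r2 n)))" using u(2)[of "r (r2 n)"] by (simp add: w_def)
    also have "\<dots> \<le> m + 1 / real (Suc n)"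
      using seq_suble[OF r, of "r2 n"] seq_suble[OF r2(1), of n]
      by (intro add_left_mono divide_left_mono) auto
    finally show ?thesis .
  qed
  ultimately have "q + \<Delta> * (L - (?m (B_set L U) + 0)) \<le> m + 0"
    by (intro LIMSEQ_le[of _ _ "\<lambda>n. m + 1 / real (Suc n)"]) auto
  then have "?I U \<le> m" using q(2) by (simp add: Iu[OF U])
  moreover have "m \<le> ?I v" if "v \<in> adm i L" for v
    unfolding m_def by (intro cInf_lower bdd imageI that)
  ultimately show ?thesis using U by (auto simp: global_minimizer_def intro: order_trans)
qed

section \<open>Bounds on the critical depth\<close>

lemma measure_B_set_le:
  assumes u: "u \<in> adm i L"
  shows "measure lebesgue (B_set L u) \<le> (norm2 (Omega L) (D\<^sub>y L u))\<^sup>2"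
proof -
  have sub: "B_set L u \<subseteq> Omega L" by (auto simp: B_set_def)
  note y = adm_derivs(5)[OF u Basis_xy(2)]
  have "measure lebesgue (B_set L u) = (LINT p|lebesgue_on (Omega L). indicator (B_set L u) p)"
    by (rule LINT_indicator_Omega(1)[OF B_set_sets(2)[OF u] sub, symmetric])
  also have "\<dots> \<le> (LINT p|lebesgue_on (Omega L). (D\<^sub>y L u p)\<^sup>2)"
  proof (rule integral_mono[OF LINT_indicator_Omega(2)[OF B_set_sets(2)[OF u] sub] L2_square_integrable[OF y]])
    fix p
    show "indicator (B_set L u) p \<le> (D\<^sub>y L u p)\<^sup>2"
      using abs_le_square_iff[of 1 "D\<^sub>y L u p"] by (auto simp: indicator_def B_set_def)
  qed
  finally show ?thesis by (simp add: norm2_power2)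
qed

lemma zero_norms:
  assumes L: "L > 0"
  shows "elastic i L \<epsilon> (\<lambda>p. 0) = 0" "measure lebesgue (B_set L (\<lambda>p. 0)) = 0"
proof -
  note z = zero_adm[OF L]
  have z2: "norm2 (Omega L) f = 0" if "f \<in> L2 (Omega L)" "AE p in lebesgue_on (Omega L). f p = 0" for f
    using norm2_cong_AE[OF that(1) L2_zero that(2)] by simp
  have d0: "frechet_derivative (\<lambda>p::real \<times> real. 0::real) (at q) = (\<lambda>h. 0)" for q
    by (simp add: frechet_derivative_const)
  note s = smooth_adm[where u="\<lambda>p. 0", OF smooth_const L refl refl]
  have 1: "norm2 (Omega L) (weak_deriv (Omega L) k (\<lambda>p. 0)) = 0" if "k \<in> Basis" for k
    by (rule z2[OF adm_derivs(5)[OF z that]]) (use s(2)[OF that] in \<open>simp add: d0\<close>)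
  have 2: "norm2 (Omega L) (D2 L j k (\<lambda>p. 0)) = 0" if "(j, k) \<in> second_order i" for j k
    by (rule z2[OF adm_derivs(7)[OF z that]]) (use s(3)[OF that] in \<open>simp add: d0\<close>)
  have "(\<Sum>(j, k)\<in>second_order i. (norm2 (Omega L) (D2 L j k (\<lambda>p. 0)))\<^sup>2) = 0"
    by (rule sum.neutral) (auto simp: 2)
  then show "elastic i L \<epsilon> (\<lambda>p. 0) = 0"
    by (simp add: elastic_def 1)
  show "measure lebesgue (B_set L (\<lambda>p. 0)) = 0"
    using measure_B_set_le[OF z[of i]] 1[OF Basis_xy(2)] by (simp add: measure_le_0_iff)
qed

lemma energy_zero:
  assumes L: "L > 0" shows "energy i L \<epsilon> \<Delta> (\<lambda>p. 0) = \<Delta> * L"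
  by (simp add: energy_eq_elastic[OF zero_adm[OF L]] measure_A_set[OF zero_adm[OF L, of i] L] zero_norms[OF L])

lemma energy_eq_measure_B:
  assumes "u \<in> adm i L" "L > 0"
  shows "energy i L \<epsilon> \<Delta> u = elastic i L \<epsilon> u + \<Delta> * L - \<Delta> * measure lebesgue (B_set L u)"
  by (simp add: energy_eq_elastic[OF assms(1)] measure_A_set[OF assms] algebra_simps)

text \<open>The energies of \<open>u\<close> and \<open>0\<close> differ by \<open>Q(u) - \<Delta> |B(u)|\<close>.\<close>

lemma zero_minimizer_iff:
  assumes L: "L > 0"
  shows "global_minimizer i L \<epsilon> \<Delta> (\<lambda>p. 0) \<longleftrightarrow>
    (\<forall>u\<in>adm i L. \<Delta> * measure lebesgue (B_set L u) \<le> elastic i L \<epsilon> u)"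
  unfolding global_minimizer_def energy_zero[OF L]
  using zero_adm[OF L, of i] by (auto simp: energy_eq_measure_B[OF _ L])

text \<open>With \<open>l\<^sup>2 = \<epsilon> L / 4\<close> the two terms of the interpolation inequality carry the weights of \<open>u\<^sub>x\<close> and \<open>u\<^sub>y\<^sub>y\<close> in
  the energy up to numerical constants and the common factor \<open>L / \<epsilon>\<close>, and \<open>\<epsilon> L \<le> 1\<close> ensures \<open>l \<le> 1/2\<close>.\<close>

lemma zero_minimizer_small_depth:
  assumes L: "L > 0" and eps: "\<epsilon> > 0" and small: "\<epsilon> * L \<le> 1" and D: "0 \<le> \<Delta>" "\<Delta> \<le> \<epsilon> / (128 * L)"
  shows "global_minimizer i L \<epsilon> \<Delta> (\<lambda>p. 0)"
  unfolding zero_minimizer_iff[OF L]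
proof
  fix u assume u: "u \<in> adm i L"
  let ?n = "norm2 (Omega L)" and ?w = "D2 L (0, 1) (0, 1) u"
  define l where "l = sqrt (\<epsilon> * L) / 2"
  have l2: "l\<^sup>2 = \<epsilon> * L / 4" using L eps by (simp add: l_def power_divide)
  have l: "0 < l" "l \<le> 1/2" using L eps small by (auto simp: l_def)
  have "measure lebesgue (B_set L u) \<le> 16 / l\<^sup>2 * (?n u)\<^sup>2 + l\<^sup>2 * (?n ?w)\<^sup>2"
    by (rule order_trans[OF measure_B_set_le[OF u] adm_interpolation[OF u L l]])
  also have "\<dots> \<le> 16 / l\<^sup>2 * (2 * L\<^sup>2 * (?n (D\<^sub>x L u))\<^sup>2) + l\<^sup>2 * (?n ?w)\<^sup>2"
    by (intro add_right_mono mult_left_mono adm_poincare[OF u L]) auto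
  also have "\<dots> = 128 * L / \<epsilon> * (?n (D\<^sub>x L u))\<^sup>2 + \<epsilon> * L / 4 * (?n ?w)\<^sup>2"
    unfolding l2 using L eps by (simp add: field_simps power2_eq_square)
  finally have B: "measure lebesgue (B_set L u) \<le> 128 * L / \<epsilon> * (?n (D\<^sub>x L u))\<^sup>2 + \<epsilon> * L / 4 * (?n ?w)\<^sup>2" .
  have "\<Delta> * measure lebesgue (B_set L u) \<le> \<epsilon> / (128 * L) * (128 * L / \<epsilon> * (?n (D\<^sub>x L u))\<^sup>2 + \<epsilon> * L / 4 * (?n ?w)\<^sup>2)"
    using B D L eps by (intro mult_mono) auto
  also have "\<dots> = (?n (D\<^sub>x L u))\<^sup>2 + \<epsilon>\<^sup>2 / 512 * (?n ?w)\<^sup>2"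
    using L eps by (simp add: field_simps power2_eq_square)
  also have "\<dots> \<le> (?n (D\<^sub>x L u))\<^sup>2 + \<epsilon>\<^sup>2 * (?n ?w)\<^sup>2"
    by (intro add_left_mono mult_right_mono) auto
  also have "\<dots> \<le> elastic i L \<epsilon> u"
  proof -
    have "(?n ?w)\<^sup>2 \<le> (\<Sum>(j, k)\<in>second_order i. (?n (D2 L j k u))\<^sup>2)"
      using member_le_sum[OF second_order_yy, of i "\<lambda>(j, k). (?n (D2 L j k u))\<^sup>2"] by auto
    then show ?thesis unfolding elastic_def by (simp add: mult_left_mono)
  qed
  finally show "\<Delta> * measure lebesgue (B_set L u) \<le> elastic i L \<epsilon> u" .
qed

subsection \<open>An oscillating competitor\<close>

text \<open>The slope in \<open>y\<close> is of order one for every \<open>N\<close>, whereas the amplitude is \<open>1/N\<close>: larger \<open>N\<close> lowers \<open>u\<^sub>x\<close> and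
  raises \<open>u\<^sub>y\<^sub>y\<close>.\<close>

definition ripple :: "real \<Rightarrow> nat \<Rightarrow> real \<times> real \<Rightarrow> real" where
  "ripple L N p = fst p / (L * real N) * sin (2 * pi * real N * snd p)"

lemma ripple_smooth: "smooth (ripple L N)"
proof -
  have 1: "smooth (\<lambda>p::real \<times> real. fst p / (L * real N))"
    using smooth_affine[of "(1 / (L * real N), 0::real)" 0] by (simp add: inner_prod_def)
  have 2: "smooth (\<lambda>p::real \<times> real. sin (2 * pi * real N * snd p))"
    using smooth_sin_affine[of "(0::real, 2 * pi * real N)" 0] by (simp add: inner_prod_def)
  show ?thesis unfolding ripple_def[abs_def] by (rule smooth_mult[OF 1 2])
qed

lemma ripple_boundary: "ripple L N (x, 1) = ripple L N (x, 0)" "ripple L N (0, y) = 0"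
  using sin_2npi[of N] by (simp_all add: ripple_def mult_ac)

lemma ripple_adm: "L > 0 \<Longrightarrow> ripple L N \<in> adm i L"
  by (rule smooth_adm(1)[OF ripple_smooth _ ripple_boundary])

lemma ripple_derivs:
  assumes L: "L > 0" and N: "N > 0"
  shows "frechet_derivative (ripple L N) (at p) =
      (\<lambda>h. fst h / (L * N) * sin (2 * pi * N * snd p) + 2 * pi / L * (fst p * snd h * cos (2 * pi * N * snd p)))"
    "frechet_derivative (\<lambda>p. frechet_derivative (ripple L N) (at p) k) (at p) j =
      2 * pi / L * ((fst k * snd j + fst j * snd k) * cos (2 * pi * N * snd p))
      - 4 * pi\<^sup>2 * N / L * (snd k * snd j * fst p * sin (2 * pi * N * snd p))"
proof -
  have "(ripple L N has_derivative
      (\<lambda>h. fst h / (L * N) * sin (2 * pi * N * snd p) + 2 * pi / L * (fst p * snd h * cos (2 * pi * N * snd p)))) (at p)" for p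
    unfolding ripple_def[abs_def] using L N
    by (auto intro!: derivative_eq_intros simp: fun_eq_iff field_simps)
  from frechet_derivative_at[OF this]
  show 1: "frechet_derivative (ripple L N) (at p) =
      (\<lambda>h. fst h / (L * N) * sin (2 * pi * N * snd p) + 2 * pi / L * (fst p * snd h * cos (2 * pi * N * snd p)))" for p
    by simp
  have D: "((\<lambda>p. fst k / (L * N) * sin (2 * pi * N * snd p) + 2 * pi / L * (fst p * snd k * cos (2 * pi * N * snd p)))
      has_derivative (\<lambda>j. 2 * pi / L * ((fst k * snd j + fst j * snd k) * cos (2 * pi * N * snd p))
      - 4 * pi\<^sup>2 * N / L * (snd k * snd j * fst p * sin (2 * pi * N * snd p)))) (at p)"
    using L N by (auto intro!: derivative_eq_intros simp: fun_eq_iff field_simps power2_eq_square)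
  show "frechet_derivative (\<lambda>p. frechet_derivative (ripple L N) (at p) k) (at p) j =
      2 * pi / L * ((fst k * snd j + fst j * snd k) * cos (2 * pi * N * snd p))
      - 4 * pi\<^sup>2 * N / L * (snd k * snd j * fst p * sin (2 * pi * N * snd p))"
    unfolding 1 by (rule fun_cong[OF frechet_derivative_at[OF D], of j, symmetric])
qed

lemma norm2_le_sup:
  assumes f: "f \<in> L2 (Omega L)" and L: "L > 0" and M: "AE p in lebesgue_on (Omega L). \<bar>f p\<bar> \<le> M"
  shows "(norm2 (Omega L) f)\<^sup>2 \<le> M\<^sup>2 * L"
proof -
  have "norm2 (Omega L) f \<le> norm2 (Omega L) (\<lambda>p. M)"
    by (rule norm2_mono_AE(2)[OF L2_const[OF Omega_lmeasurable] L2_measurable[OF f]])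
      (use M in \<open>auto elim: AE_mp\<close>)
  then have "(norm2 (Omega L) f)\<^sup>2 \<le> (norm2 (Omega L) (\<lambda>p. M))\<^sup>2" by (intro power_mono) auto
  also have "\<dots> = M\<^sup>2 * L"
    using norm2_continuous[of "(0,0)" "(L,1::real)" "\<lambda>p. M"] L by (simp add: Omega_cbox content_Pair)
  finally show ?thesis .
qed

lemma ripple_elastic:
  assumes L: "L > 0" and N: "N > 0"
  shows "elastic i L \<epsilon> (ripple L N) \<le> L * (\<epsilon>\<^sup>2 * (12 * pi\<^sup>2 / L\<^sup>2 + 16 * pi^4 * (real N)\<^sup>2) + 1 / (L * real N)\<^sup>2)"
proof -
  let ?u = "ripple L N" and ?n = "norm2 (Omega L)"
  note u = ripple_adm[OF L, of N i]
  note sa = smooth_adm[OF ripple_smooth[of L N] L ripple_boundary]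
  have "(?n (D\<^sub>x L ?u))\<^sup>2 \<le> (1 / (L * real N))\<^sup>2 * L"
  proof (rule norm2_le_sup[OF adm_derivs(5)[OF u Basis_xy(1)] L])
    show "AE p in lebesgue_on (Omega L). \<bar>D\<^sub>x L ?u p\<bar> \<le> 1 / (L * real N)"
      using sa(2)[OF Basis_xy(1)]
    proof eventually_elim
      case (elim p)
      have "\<bar>sin (2 * pi * N * snd p)\<bar> / (L * real N) \<le> 1 / (L * real N)"
        using L by (intro divide_right_mono abs_sin_le_one) auto
      then show ?case using elim L by (simp add: ripple_derivs(1)[OF L N])
    qed
  qed
  then have x: "(?n (D\<^sub>x L ?u))\<^sup>2 \<le> L * (1 / (L * real N)\<^sup>2)" by (simp add: power_divide)
  define b where "b j k = (if (j, k) = ((0, 1), (0, 1)) then L * (16 * pi^4 * (real N)\<^sup>2) else L * (4 * pi\<^sup>2 / L\<^sup>2))"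
    for j k :: "real \<times> real"
  have jk: "(?n (D2 L j k ?u))\<^sup>2 \<le> b j k" if "(j, k) \<in> second_order i" for j k
  proof (cases "(j, k) = ((0, 1), (0, 1))")
    case True
    have "(?n (D2 L j k ?u))\<^sup>2 \<le> (4 * pi\<^sup>2 * real N)\<^sup>2 * L"
    proof (rule norm2_le_sup[OF adm_derivs(7)[OF u that] L])
      have "AE p in lebesgue_on (Omega L). p \<in> Omega L" by (rule AE_I2) simp
      with sa(3)[OF that] show "AE p in lebesgue_on (Omega L). \<bar>D2 L j k ?u p\<bar> \<le> 4 * pi\<^sup>2 * real N"
      proof eventually_elim
        case (elim p)
        have "\<bar>fst p\<bar> * \<bar>sin (2 * pi * N * snd p)\<bar> \<le> L * 1"
          using elim(2) L by (intro mult_mono) (auto simp: Omega_def)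
        then have "4 * pi\<^sup>2 * N / L * (\<bar>fst p\<bar> * \<bar>sin (2 * pi * N * snd p)\<bar>) \<le> 4 * pi\<^sup>2 * N / L * (L * 1)"
          using L by (intro mult_left_mono) auto
        then show ?case
          using elim(1) True L by (simp add: ripple_derivs(2)[OF L N] abs_mult)
      qed
    qed
    then show ?thesis using True by (simp add: b_def power_mult_distrib power_mult[symmetric] mult_ac)
  next
    case False
    have "(?n (D2 L j k ?u))\<^sup>2 \<le> (2 * pi / L)\<^sup>2 * L"
    proof (rule norm2_le_sup[OF adm_derivs(7)[OF u that] L])
      show "AE p in lebesgue_on (Omega L). \<bar>D2 L j k ?u p\<bar> \<le> 2 * pi / L"
        using sa(3)[OF that]
      proof eventually_elim
        case (elim p)
        have "2 * pi / L * \<bar>cos (2 * pi * N * snd p)\<bar> \<le> 2 * pi / L * 1"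
          using L by (intro mult_left_mono) auto
        then show ?case
          using elim False second_order_Basis[OF that] L
          by (auto simp: ripple_derivs(2)[OF L N] abs_mult Basis_real2)
      qed
    qed
    moreover have "b j k = L * (4 * pi\<^sup>2 / L\<^sup>2)" using False by (auto simp: b_def)
    ultimately show ?thesis by (simp add: power_mult_distrib power_divide mult_ac)
  qed
  have "(\<Sum>(j, k)\<in>second_order i. (?n (D2 L j k ?u))\<^sup>2) \<le> (\<Sum>(j, k)\<in>second_order i. b j k)"
    by (rule sum_mono) (use jk in auto)
  also have "\<dots> \<le> L * (12 * pi\<^sup>2 / L\<^sup>2 + 16 * pi^4 * (real N)\<^sup>2)"
  proof -
    define s t where "s = L * (4 * pi\<^sup>2 / L\<^sup>2)" and "t = L * (16 * pi^4 * (real N)\<^sup>2)"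
    have "s \<ge> 0" "t \<ge> 0" using L by (auto simp: s_def t_def)
    moreover have "b j k = (if (j, k) = ((0, 1), (0, 1)) then t else s)" for j k
      unfolding b_def s_def t_def ..
    ultimately have "(\<Sum>(j, k)\<in>second_order i. b j k) \<le> 3 * s + t" by (cases i) auto
    also have "\<dots> = L * (12 * pi\<^sup>2 / L\<^sup>2 + 16 * pi^4 * (real N)\<^sup>2)"
      by (simp add: s_def t_def distrib_left)
    finally show ?thesis .
  qed
  finally have "\<epsilon>\<^sup>2 * (\<Sum>(j, k)\<in>second_order i. (?n (D2 L j k ?u))\<^sup>2) \<le> \<epsilon>\<^sup>2 * (L * (12 * pi\<^sup>2 / L\<^sup>2 + 16 * pi^4 * (real N)\<^sup>2))"
    by (rule mult_left_mono) simp
  with x show ?thesis unfolding elastic_def by (simp add: algebra_simps)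
qed

lemma ripple_slope_norm:
  assumes L: "L > 0" and N: "N > 0"
  shows "(norm2 (Omega L) (part_y (ripple L N)))\<^sup>2 = 2 * pi\<^sup>2 / 3 * L"
proof -
  let ?f = "part_y (ripple L N)"
  have f: "?f p = 2 * pi / L * (fst p * cos (2 * pi * N * snd p))" for p
    by (simp add: ripple_derivs(1)[OF L N])
  have c: "continuous_on A ?f" for A by (intro smooth_continuous smooth_partial ripple_smooth) simp
  have c2: "continuous_on UNIV (\<lambda>p. (?f p)\<^sup>2)" by (intro continuous_intros c)
  have X: "integral {0..L} (\<lambda>x. x\<^sup>2) = L^3 / 3"
  proof (rule integral_unique)
    have "((\<lambda>x. x\<^sup>2) has_integral L^3 / 3 - 0^3 / 3) {0..L}"
      using L by (intro fundamental_theorem_of_calculus)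
        (auto intro!: derivative_eq_intros simp: has_real_derivative_iff_has_vector_derivative[symmetric])
    then show "((\<lambda>x. x\<^sup>2) has_integral L^3 / 3) {0..L}" by simp
  qed
  have Y: "integral {0..1} (\<lambda>y. (cos (2 * pi * N * y))\<^sup>2) = 1/2"
  proof (rule integral_unique)
    let ?F = "\<lambda>y. y / 2 + sin (2 * (2 * pi * N * y)) / (8 * pi * N)"
    have "((\<lambda>y. (cos (2 * pi * N * y))\<^sup>2) has_integral ?F 1 - ?F 0) {0..1}"
    proof (intro fundamental_theorem_of_calculus)
      fix y :: real
      have "(?F has_real_derivative 1/2 + cos (2 * (2 * pi * N * y)) * (2 * (2 * pi * N)) / (8 * pi * N)) (at y within {0..1})"
        by (auto intro!: derivative_eq_intros)
      moreover have "1/2 + cos (2 * (2 * pi * N * y)) * (2 * (2 * pi * N)) / (8 * pi * N) = (cos (2 * pi * N * y))\<^sup>2"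
        using N cos_double_cos[of "2 * pi * N * y"] by (simp add: field_simps)
      ultimately show "(?F has_vector_derivative (cos (2 * pi * N * y))\<^sup>2) (at y within {0..1})"
        by (simp only: has_real_derivative_iff_has_vector_derivative)
    qed simp
    moreover have "sin (2 * (2 * pi * N * 1)) = 0" using sin_2npi[of "2 * N"] by (simp add: mult_ac)
    ultimately show "((\<lambda>y. (cos (2 * pi * N * y))\<^sup>2) has_integral 1/2) {0..1}" by simp
  qed
  have sq: "(?f (x, y))\<^sup>2 = ((2 * pi / L)\<^sup>2 * (cos (2 * pi * N * y))\<^sup>2) * x\<^sup>2" for x y
    by (simp add: f power_mult_distrib power_divide)
  have "(norm2 (Omega L) ?f)\<^sup>2 = integral {0..1} (\<lambda>y. integral {0..L} (\<lambda>x. (?f (x, y))\<^sup>2))"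
    unfolding Omega_cbox norm2_continuous[OF c] by (rule iterated_integral(2)[OF c2])
  also have "\<dots> = integral {0..1} (\<lambda>y. integral {0..L} (\<lambda>x. ((2 * pi / L)\<^sup>2 * (cos (2 * pi * N * y))\<^sup>2) * x\<^sup>2))"
    unfolding sq ..
  also have "\<dots> = integral {0..1} (\<lambda>y. ((2 * pi / L)\<^sup>2 * (L^3 / 3)) * (cos (2 * pi * N * y))\<^sup>2)"
    unfolding integral_mult_right X by (simp add: mult_ac)
  also have "\<dots> = 2 * pi\<^sup>2 / 3 * L"
    unfolding integral_mult_right Y using L by (simp add: power2_eq_square power3_eq_cube)
  finally show ?thesis .
qed

lemma pi_square_bounds: "9 \<le> pi\<^sup>2" "pi\<^sup>2 \<le> 16"
  using power_mono[of 3 pi 2] power_mono[of pi 4 2] pi_gt3 pi_less_4 by simp_all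

text \<open>As the slope is bounded by \<open>2 \<pi>\<close>, its mean square bounds the area of \<open>B\<close> from below.\<close>

lemma ripple_B_set:
  assumes L: "L > 0" and N: "N > 0"
  shows "5 * L / 64 \<le> measure lebesgue (B_set L (ripple L N))"
proof -
  let ?u = "ripple L N" and ?M = "lebesgue_on (Omega L)"
  have u: "?u \<in> adm Model1 L" by (rule ripple_adm[OF L])
  note yL = adm_derivs(5)[OF u Basis_xy(2)]
  let ?B = "B_set L ?u"
  have sub: "?B \<subseteq> Omega L" by (auto simp: B_set_def)
  have ae: "AE p in ?M. D\<^sub>y L ?u p = part_y ?u p"
    by (rule smooth_adm(2)[OF ripple_smooth L ripple_boundary Basis_xy(2)])
  have "2 * pi\<^sup>2 / 3 * L = (norm2 (Omega L) (D\<^sub>y L ?u))\<^sup>2"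
    unfolding ripple_slope_norm[OF L N, symmetric]
    using norm2_cong_AE[OF yL smooth_partial_L2[OF ripple_smooth Basis_xy(2)] ae] by simp
  also have "\<dots> \<le> (LINT p|?M. 1 + 4 * pi\<^sup>2 * indicator ?B p)"
    unfolding norm2_power2
  proof (rule integral_mono_AE[OF L2_square_integrable[OF yL]])
    show "integrable ?M (\<lambda>p. 1 + 4 * pi\<^sup>2 * indicator ?B p)"
      using LINT_indicator_Omega(2)[OF B_set_sets(2)[OF u] sub]
        finite_measure.integrable_const[OF finite_measure_lebesgue_on[OF Omega_lmeasurable]]
      by (intro Bochner_Integration.integrable_add integrable_mult_right) auto
    have "AE p in ?M. p \<in> Omega L" by (rule AE_I2) simp
    with ae show "AE p in ?M. (D\<^sub>y L ?u p)\<^sup>2 \<le> 1 + 4 * pi\<^sup>2 * indicator ?B p"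
    proof eventually_elim
      case (elim p)
      show ?case
      proof (cases "p \<in> ?B")
        case False
        then have "\<bar>D\<^sub>y L ?u p\<bar> \<le> 1" using elim(2) by (simp add: B_set_def)
        then show ?thesis using False by (simp add: abs_square_le_1)
      next
        case True
        have "\<bar>fst p\<bar> * \<bar>cos (2 * pi * N * snd p)\<bar> \<le> L * 1"
          using elim(2) L by (intro mult_mono) (auto simp: Omega_def)
        then have "2 * pi / L * (\<bar>fst p\<bar> * \<bar>cos (2 * pi * N * snd p)\<bar>) \<le> 2 * pi / L * (L * 1)"
          using L by (intro mult_left_mono) auto
        then have "\<bar>D\<^sub>y L ?u p\<bar> \<le> 2 * pi"
          using elim(1) L by (simp add: ripple_derivs(1)[OF L N] abs_mult)
        then have "(D\<^sub>y L ?u p)\<^sup>2 \<le> (2 * pi)\<^sup>2" by (rule abs_le_square_iff[THEN iffD1, OF order_trans]) simp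
        then show ?thesis using True by (simp add: power_mult_distrib)
      qed
    qed
  qed
  also have "\<dots> = L + 4 * pi\<^sup>2 * measure lebesgue ?B"
  proof -
    have "(LINT p|?M. (1::real)) = L"
      using LINT_continuous[of "(0,0)" "(L,1::real)" "\<lambda>p. 1"] L by (simp add: Omega_cbox content_Pair)
    then show ?thesis
      using LINT_indicator_Omega[OF B_set_sets(2)[OF u] sub]
        finite_measure.integrable_const[OF finite_measure_lebesgue_on[OF Omega_lmeasurable, of L], of 1]
      by (subst Bochner_Integration.integral_add) auto
  qed
  finally have *: "2 * pi\<^sup>2 / 3 * L \<le> L + 4 * pi\<^sup>2 * measure lebesgue ?B" .
  note p = pi_square_bounds
  have "6 * L \<le> 2 * pi\<^sup>2 / 3 * L" using p L by (intro mult_right_mono) auto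
  moreover have "4 * pi\<^sup>2 * measure lebesgue ?B \<le> 64 * measure lebesgue ?B" using p by (intro mult_right_mono) auto
  ultimately show ?thesis using * by linarith
qed

lemma zero_minimizer_depth_bound:
  assumes L: "L > 0" and eps: "\<epsilon> > 0" and small: "\<epsilon> * L \<le> 1" "\<epsilon> \<le> L"
    and D: "\<Delta> \<ge> 0" and min: "global_minimizer i L \<epsilon> \<Delta> (\<lambda>p. 0)"
  shows "\<Delta> \<le> 220000 * \<epsilon> / L"
proof -
  \<comment> \<open>Up to numerical constants the contributions of \<open>u\<^sub>y\<^sub>y\<close> and \<open>u\<^sub>x\<close> are \<open>\<epsilon>\<^sup>2 N\<^sup>2\<close> and \<open>1 / (L N)\<^sup>2\<close>, which are
    equal for \<open>N = t\<close>; rounding up costs a factor of at most two because \<open>t \<ge> 1\<close>.\<close>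
  define t where "t = 1 / sqrt (\<epsilon> * L)"
  have t: "t \<ge> 1" "t\<^sup>2 = 1 / (\<epsilon> * L)" using L eps small(1) by (auto simp: t_def power_divide le_divide_eq)
  define N where "N = nat \<lceil>t\<rceil>"
  have N: "real N \<ge> t" "real N \<le> 2 * t" using t(1) by (auto simp: N_def) linarith+
  then have N0: "N > 0" using t(1) by (cases N) auto
  have N2: "t\<^sup>2 \<le> (real N)\<^sup>2" "(real N)\<^sup>2 \<le> (2 * t)\<^sup>2"
    by (rule power_mono; use N t(1) in simp)+
  note p = pi_square_bounds(2)
  have p4: "pi^4 \<le> 256" using power_mono[OF p, of 2] by (simp add: power_mult[symmetric])
  have 1: "\<epsilon>\<^sup>2 * (12 * pi\<^sup>2 / L\<^sup>2) \<le> 192 * (\<epsilon> / L)"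
  proof -
    have "\<epsilon> / L \<le> 1" using L small(2) by simp
    then have "(\<epsilon> / L)\<^sup>2 \<le> \<epsilon> / L" unfolding power2_eq_square using L eps by (intro mult_left_le) auto
    then have "12 * pi\<^sup>2 * (\<epsilon> / L)\<^sup>2 \<le> (12 * 16) * (\<epsilon> / L)" using p by (intro mult_mono) auto
    then show ?thesis by (simp add: power_divide mult_ac)
  qed
  have 2: "\<epsilon>\<^sup>2 * (16 * pi^4 * (real N)\<^sup>2) \<le> 16384 * (\<epsilon> / L)"
  proof -
    have "16 * pi^4 * (real N)\<^sup>2 \<le> (16 * 256) * (2 * t)\<^sup>2" using p4 N2 by (intro mult_mono) auto
    then have "\<epsilon>\<^sup>2 * (16 * pi^4 * (real N)\<^sup>2) \<le> \<epsilon>\<^sup>2 * ((16 * 256) * (2 * t)\<^sup>2)" by (intro mult_left_mono) auto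
    also have "\<dots> = 16384 * (\<epsilon> / L)" unfolding power_mult_distrib t(2) using L eps by (simp add: field_simps power2_eq_square)
    finally show ?thesis .
  qed
  have 3: "1 / (L * real N)\<^sup>2 \<le> \<epsilon> / L"
  proof -
    have "1 / (L * real N)\<^sup>2 = 1 / L\<^sup>2 * (1 / (real N)\<^sup>2)" by (simp add: power_mult_distrib)
    also have "\<dots> \<le> 1 / L\<^sup>2 * (1 / t\<^sup>2)" using N2 t(1) N0 by (intro mult_left_mono divide_left_mono) auto
    also have "\<dots> = \<epsilon> / L" unfolding t(2) using L eps by (simp add: power2_eq_square)
    finally show ?thesis .
  qed
  have "\<Delta> * (5 * L / 64) \<le> \<Delta> * measure lebesgue (B_set L (ripple L N))"
    by (intro mult_left_mono ripple_B_set L N0 D)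
  also have "\<dots> \<le> elastic i L \<epsilon> (ripple L N)"
    using min ripple_adm[OF L, of N i] unfolding zero_minimizer_iff[OF L] by blast
  also have "\<dots> \<le> L * (\<epsilon>\<^sup>2 * (12 * pi\<^sup>2 / L\<^sup>2 + 16 * pi^4 * (real N)\<^sup>2) + 1 / (L * real N)\<^sup>2)"
    by (rule ripple_elastic[OF L N0])
  also have "\<dots> \<le> L * (192 * (\<epsilon> / L) + 16384 * (\<epsilon> / L) + \<epsilon> / L)"
    using 1 2 3 L by (intro mult_left_mono) (auto simp: distrib_left)
  also have "\<dots> = 16577 * \<epsilon>" using L by (simp add: field_simps)
  finally have "5 * (\<Delta> * L) \<le> 1060928 * \<epsilon>" by simp
  then have "\<Delta> * L \<le> 220000 * \<epsilon>" using eps by linarith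
  then show ?thesis using L by (simp add: pos_le_divide_eq)
qed

text \<open>If the minimizer had no steep part, its energy would be at least that of \<open>u = 0\<close>, and \<open>\<Delta>\<close> would not
  exceed the critical depth. The case analysis only concerns the conventions for division in the
  extended reals.\<close>

lemma minimizer_B_set_pos:
  assumes L: "L > 0" and D: "\<Delta> \<ge> 0" and U: "global_minimizer i L \<epsilon> \<Delta> U"
    and K: "ereal \<Delta> / critical_depth i L \<epsilon> \<ge> ereal 2"
  shows "measure lebesgue (B_set L U) > 0"
proof (rule ccontr)
  assume "\<not> measure lebesgue (B_set L U) > 0"
  then have B: "measure lebesgue (B_set L U) = 0" using zero_less_measure_iff by blast
  have Ua: "U \<in> adm i L" using U by (simp add: global_minimizer_def)
  have "energy i L \<epsilon> \<Delta> (\<lambda>p. 0) \<le> energy i L \<epsilon> \<Delta> U"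
    using elastic_nonneg[of i L \<epsilon> U] by (simp add: energy_zero[OF L] energy_eq_measure_B[OF Ua L] B)
  then have "global_minimizer i L \<epsilon> \<Delta> (\<lambda>p. 0)"
    using U zero_adm[OF L, of i] by (auto simp: global_minimizer_def intro: order_trans)
  then have le: "ereal \<Delta> \<le> critical_depth i L \<epsilon>"
    unfolding critical_depth_def using D by (intro Sup_upper) auto
  show False
  proof (cases "critical_depth i L \<epsilon>")
    case (real d)
    then have "\<Delta> \<le> d" using le by simp
    then show False
    proof (cases "d = 0")
      case True
      then have "\<Delta> = 0" using \<open>\<Delta> \<le> d\<close> D by simp
      then show False using K real True by (simp add: zero_ereal_def[symmetric])
    next
      case False
      then have "d > 0" using \<open>\<Delta> \<le> d\<close> D by simp
      then have "2 \<le> \<Delta> / d" using K real by simp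
      then show False using \<open>d > 0\<close> \<open>\<Delta> \<le> d\<close> by (simp add: le_divide_eq)
    qed
  next
    case PInf
    then show False using K by (simp add: zero_ereal_def)
  next
    case MInf
    then show False using le by simp
  qed
qed

theorem theorem2p1:
  shows "\<exists>c C :: real. 0 < c \<and> c < C \<and>
    (\<forall>L>0. \<exists>\<epsilon>\<^sub>0>0. \<forall>i. \<forall>\<epsilon>. 0 < \<epsilon> \<and> \<epsilon> < \<epsilon>\<^sub>0 \<longrightarrow>
        ereal (c * \<epsilon> / L) \<le> critical_depth i L \<epsilon> \<and>
        critical_depth i L \<epsilon> \<le> ereal (C * \<epsilon> / L)) \<and>
    (\<forall>L>0. \<forall>\<epsilon>>0. \<forall>i.
        (\<forall>\<Delta>\<ge>0. \<exists>U. global_minimizer i L \<epsilon> \<Delta> U) \<and>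
        (\<exists>K::real. K > 0 \<and>
          (\<forall>\<Delta>\<ge>0. ereal \<Delta> / critical_depth i L \<epsilon> \<ge> ereal K \<longrightarrow>
            (\<forall>U. global_minimizer i L \<epsilon> \<Delta> U \<longrightarrow>
              measure lebesgue (B_set L U) > 0))))"
proof (rule exI[of _ "1/128"], rule exI[of _ "220000"], intro conjI)
  show "0 < (1/128 :: real)" "(1/128 :: real) < 220000" by simp_all
  show "\<forall>L>0. \<exists>\<epsilon>\<^sub>0>0. \<forall>i. \<forall>\<epsilon>. 0 < \<epsilon> \<and> \<epsilon> < \<epsilon>\<^sub>0 \<longrightarrow>
        ereal (1/128 * \<epsilon> / L) \<le> critical_depth i L \<epsilon> \<and>
        critical_depth i L \<epsilon> \<le> ereal (220000 * \<epsilon> / L)"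
  proof (intro allI impI)
    fix L :: real assume L: "0 < L"
    have "ereal (1/128 * \<epsilon> / L) \<le> critical_depth i L \<epsilon> \<and>
        critical_depth i L \<epsilon> \<le> ereal (220000 * \<epsilon> / L)" if "0 < \<epsilon> \<and> \<epsilon> < min L (1 / L)" for i \<epsilon>
    proof
      have eps: "0 < \<epsilon>" "\<epsilon> \<le> L" "\<epsilon> * L \<le> 1" using that L by (auto simp: field_simps)
      have "global_minimizer i L \<epsilon> (1/128 * \<epsilon> / L) (\<lambda>p. 0)"
        using L eps by (intro zero_minimizer_small_depth) auto
      then show "ereal (1/128 * \<epsilon> / L) \<le> critical_depth i L \<epsilon>"
        unfolding critical_depth_def using L eps(1) by (intro Sup_upper) auto
      show "critical_depth i L \<epsilon> \<le> ereal (220000 * \<epsilon> / L)"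
        unfolding critical_depth_def
        using zero_minimizer_depth_bound[OF L eps(1,3,2)] by (intro Sup_least) auto
    qed
    moreover have "0 < min L (1 / L)" using L by simp
    ultimately show "\<exists>\<epsilon>\<^sub>0>0. \<forall>i. \<forall>\<epsilon>. 0 < \<epsilon> \<and> \<epsilon> < \<epsilon>\<^sub>0 \<longrightarrow>
        ereal (1/128 * \<epsilon> / L) \<le> critical_depth i L \<epsilon> \<and>
        critical_depth i L \<epsilon> \<le> ereal (220000 * \<epsilon> / L)" by blast
  qed
  show "\<forall>L>0. \<forall>\<epsilon>>0. \<forall>i.
        (\<forall>\<Delta>\<ge>0. \<exists>U. global_minimizer i L \<epsilon> \<Delta> U) \<and>
        (\<exists>K::real. K > 0 \<and>
          (\<forall>\<Delta>\<ge>0. ereal \<Delta> / critical_depth i L \<epsilon> \<ge> ereal K \<longrightarrow>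
            (\<forall>U. global_minimizer i L \<epsilon> \<Delta> U \<longrightarrow>
              measure lebesgue (B_set L U) > 0)))"
    using minimizer_exists minimizer_B_set_pos
    by (intro allI impI conjI exI[of _ 2]) auto
qed

end
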